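(* Let $c\ge1$ be an integer and $\mu,\nu\in\mathbb R$ with $\mu\ne0$. Let $\Xi$ be the left $E^c_{\mu\nu}$–right $D^c_{\mu\nu}$ projective bimodule, and let $\mathfrak h$ be the Heisenberg Lie algebra with basis $\{X,Y,Z\}$, $[X,Y]=cZ$ and $Z$ central. Let $\nabla$ be a compatible connection on $\Xi$ over $D^c_{\mu\nu}$ with constant curvature. Then $\nabla$ is a minimizer of $\mathrm{YM}$ subject to the constant curvature constraint, in the sense that $\mathrm{YM}(\nabla)\le\mathrm{YM}(\nabla')$ for every compatible connection $\nabla'$ on $\Xi$ with constant curvature, if and only if the curvature $\Theta_\nabla$ is the same as the curvature $\Theta_{\nabla^0}$ of the compatible connection $\nabla^0$ given by $(\nabla^0_X\xi)(x,y)=-\frac{\partial\xi}{\partial y}(x,y)+\frac{\pi c i}{2\mu}x^2\xi(x,y)$, $(\nabla^0_Y\xi)(x,y)=-\frac{\partial\xi}{\partial x}(x,y)$, $(\nabla^0_Z\xi)(x,y)=\frac{\pi i x}{\mu}\xi(x,y)$, i.e. $$\Theta_\nabla(X,Y)=0,\qquad \Theta_\nabla(X,Z)=0,\qquad \Theta_\nabla(Y,Z)=\frac{\pi i}{\mu}\mathrm{Id}_E.$$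
   Context: Notation: $e(t)=\exp(2\pi i t)$, $\bar e(t)=\overline{e(t)}$, $\mathbb T=\mathbb R/\mathbb Z$, $M=\mathbb R\times\mathbb T$, $\delta_0(p)=1$ if $p=0$ and $0$ otherwise. Algebras. $\mathbb Z$ acts on $M$ by $\lambda_p(x,y)=(x+2p\mu,y+2p\nu)$ and $\sigma_p(x,y)=(x-p,y)$. In $C_b(M)\rtimes_\lambda\mathbb Z$: $(\Phi\ast\Psi)(x,y,p)=\sum_q\Phi(x,y,q)\Psi(x-2q\mu,y-2q\nu,p-q)$, $\Phi^*(x,y,p)=\overline{\Phi}(x-2p\mu,y-2p\nu,-p)$. In $C_b(M)\rtimes_\sigma\mathbb Z$: $(\Phi\ast\Psi)(x,y,p)=\sum_q\Phi(x,y,q)\Psi(x+q,y,p-q)$, $\Phi^*(x,y,p)=\overline\Phi(x+p,y,-p)$. The quantum Heisenberg manifold $D^c_{\mu\nu}$ is the closure, in the multiplier algebra of $C_b(M)\rtimes_\lambda\mathbb Z$, of the $*$-algebra $D_0$ of bounded continuous functions $\Phi$ on $M\times\mathbb Z$ with compact support in $\mathbb Z$ and $\bar e(ckp(y-p\nu))\Phi(x+k,y,p)=\Phi(x,y,p)$ for all $k\in\mathbb Z$. $E^c_{\mu\nu}$ is the closure, in the multiplier algebra of $C_b(M)\rtimes_\sigma\mathbb Z$, of the $*$-algebra $E_0$ of bounded continuous functions $\Psi$ on $M\times\mathbb Z$ with compact support in $\mathbb Z$ and $e(cpk(y-k\nu))\Psi(x-2k\mu,y-2k\nu,p)=\Psi(x,y,p)$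 for all $k\in\mathbb Z$. $\mathrm{Id}_E(x,y,p)=\delta_0(p)$ is the identity of $E^c_{\mu\nu}$. Bimodule. $\Xi$ is the $E^c_{\mu\nu}$–$D^c_{\mu\nu}$ equivalence bimodule obtained by completing $C_c(\mathbb R\times\mathbb T)$ for $\langle f,g\rangle_R^D(x,y,p)=\sum_k\bar e(ckp(y-p\nu))f(x+k,y)\overline g(x-2p\mu+k,y-2p\nu)$, $\langle f,g\rangle_L^E(x,y,p)=\sum_k e(cpk(y-k\nu))\overline f(x-2k\mu,y-2k\nu)g(x-2k\mu+p,y-2k\nu)$, with actions $(\Psi\cdot f)(x,y)=\sum_q\overline\Psi(x,y,q)f(x+q,y)$ and $(g\cdot\Phi)(x,y)=\sum_q g(x+2q\mu,y+2q\nu)\overline\Phi(x+2q\mu,y+2q\nu,q)$. Derivations. $\mathfrak h$ acts on the smooth subalgebra of $D^c_{\mu\nu}$ by $\delta_X(\Phi)=2\pi i c p(x-p\mu)\Phi-\frac{\partial\Phi}{\partial y}$, $\delta_Y(\Phi)=-\frac{\partial\Phi}{\partial x}$, $\delta_Z(\Phi)=2\pi i p\,\Phi$ at $(x,y,p)$. By convention all algebras and modules are replaced by their smooth dense versions, with no change in notation. Connections. A linear connection on $\Xi$ is a linear map $\nabla:\Xi\to\Xi\otimes\mathfrak h^*$ with $\nabla_W(\xi\cdot\Phi)=\nabla_W(\xi)\cdot\Phi+\xi\cdot\delta_W(\Phi)$; it is compatible if $\delta_W(\langle\xi,\eta\rangle_R^D)=\langle\nabla_W\xi,\eta\rangle_R^D+\langle\xi,\nabla_W\eta\rangle_R^D$.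 The curvature is $\Theta_\nabla(W,W')=\nabla_W\nabla_{W'}-\nabla_{W'}\nabla_W-\nabla_{[W,W']}$; curvature operators are identified with the elements of $E^c_{\mu\nu}$ (skew-adjoint) that induce them by the left action. The curvature is constant if all its values are scalar multiples of $\mathrm{Id}_E$ (necessarily of the form $ai\,\mathrm{Id}_E$, $a\in\mathbb R$). Yang–Mills functional. $\tau(\Phi)=\int_{\mathbb T^2}\Phi(x,y,0)\,dx\,dy$ on $D^c_{\mu\nu}$; the induced trace on $E^c_{\mu\nu}$ is $\tau_E(\langle\xi,\eta\rangle_L^E)=\tau(\langle\eta,\xi\rangle_R^D)$, which for $\mu>0$ is $\tau_E(\Psi)=\int_0^{2\mu}\int_0^1\Psi(x,y,0)\,dy\,dx$. $\mathrm{YM}(\nabla)=-\tau_E\big(\Theta_\nabla(X,Y)^2+\Theta_\nabla(X,Z)^2+\Theta_\nabla(Y,Z)^2\big)$. *)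

theory Defs
  imports "HOL-Analysis.Analysis"
begin

text \<open>
  Functions on \<open>M = \<real> \<times> \<T>\<close> are functions on \<open>\<real> \<times> \<real>\<close> that are 1-periodic in the second
  variable; a function \<open>\<Phi>\<close> on \<open>M \<times> \<int>\<close> is curried with the integer first, so that
  \<open>\<Phi> p (x, y)\<close> is \<open>\<Phi>(x,y,p)\<close>.
\<close>

type_synonym fnM = "real \<times> real \<Rightarrow> complex"
type_synonym fnMZ = "int \<Rightarrow> real \<times> real \<Rightarrow> complex"

definition e :: "real \<Rightarrow> complex" where
  "e t = exp (2 * of_real pi * \<i> * of_real t)"

definition periodic_y :: "fnM \<Rightarrow> bool" where
  "periodic_y f \<longleftrightarrow> (\<forall>x y. f (x, y + 1) = f (x, y))"

definition partial :: "real \<times> real \<Rightarrow> fnM \<Rightarrow> fnM" where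
  "partial u f z = frechet_derivative f (at z) u"

abbreviation partial_x :: "fnM \<Rightarrow> fnM" where "partial_x \<equiv> partial (1, 0)"
abbreviation partial_y :: "fnM \<Rightarrow> fnM" where "partial_y \<equiv> partial (0, 1)"

text \<open>
  A word \<open>us \<in> lists Basis\<close> over the standard basis \<open>(1,0)\<close>, \<open>(0,1)\<close> of the plane stands for the
  iterated partial derivative in these directions.
\<close>

definition partials :: "(real \<times> real) list \<Rightarrow> fnM \<Rightarrow> fnM" where
  "partials us f = foldr partial us f"

definition smooth :: "fnM \<Rightarrow> bool" where
  "smooth f \<longleftrightarrow> (\<forall>us \<in> lists Basis. partials us f differentiable_on UNIV)"


section \<open>The smooth algebras and the smooth bimodule\<close>

text \<open>
  Smooth versions are taken in Rieffel's sense: all partial derivatives decay faster than any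
  power of \<open>p\<close>, uniformly on compact sets of \<open>(x,y)\<close> (a bound uniform in \<open>x\<close> would be wrong, because
  the phase in the equivariance condition makes derivatives grow with \<open>x\<close>). For \<open>D\<close>
  these are the smooth vectors of the action of the Heisenberg group. An element
  of either \<open>C\<^sup>*\<close>-algebra is determined by its Fourier coefficients, hence is a function on \<open>M \<times> \<int>\<close>.
\<close>

definition rapidly_decreasing_Z :: "fnMZ \<Rightarrow> bool" where
  "rapidly_decreasing_Z \<Phi> \<longleftrightarrow>
     (\<forall>us \<in> lists Basis. \<forall>(n::nat) K. compact K \<longrightarrow>
        (\<exists>B. \<forall>p. \<forall>z\<in>K. \<bar>real_of_int p\<bar> ^ n * norm (partials us (\<Phi> p) z) \<le> B))"

definition D_alg :: "int \<Rightarrow> real \<Rightarrow> fnMZ set" where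
  "D_alg c \<nu> = {\<Phi>.
     (\<forall>p. periodic_y (\<Phi> p) \<and> smooth (\<Phi> p)) \<and> rapidly_decreasing_Z \<Phi> \<and>
     (\<forall>(k::int) (p::int) (x::real) (y::real).
        cnj (e (of_int (c * k * p) * (y - of_int p * \<nu>))) * \<Phi> p (x + of_int k, y) = \<Phi> p (x, y))}"

definition E_alg :: "int \<Rightarrow> real \<Rightarrow> real \<Rightarrow> fnMZ set" where
  "E_alg c \<mu> \<nu> = {\<Psi>.
     (\<forall>p. periodic_y (\<Psi> p) \<and> smooth (\<Psi> p)) \<and> rapidly_decreasing_Z \<Psi> \<and>
     (\<forall>(k::int) (p::int) (x::real) (y::real).
        e (of_int (c * p * k) * (y - of_int k * \<nu>))
          * \<Psi> p (x - 2 * of_int k * \<mu>, y - 2 * of_int k * \<nu>) = \<Psi> p (x, y))}"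

definition mult_E :: "fnMZ \<Rightarrow> fnMZ \<Rightarrow> fnMZ" where
  "mult_E \<Phi> \<Psi> p = (\<lambda>(x, y). \<Sum>\<^sub>\<infinity>q. \<Phi> q (x, y) * \<Psi> (p - q) (x + of_int q, y))"

definition Id_E :: fnMZ where
  "Id_E p z = (if p = 0 then 1 else 0)"

text \<open>
  The smooth version of \<open>\<Xi>\<close> is the Schwartz space of \<open>\<real> \<times> \<T>\<close>.
\<close>

definition Xi :: "fnM set" where
  "Xi = {f. periodic_y f \<and> smooth f \<and>
     (\<forall>us \<in> lists Basis. \<forall>n::nat. \<exists>B. \<forall>x y. \<bar>x\<bar> ^ n * norm (partials us f (x, y)) \<le> B)}"

definition inner_R :: "int \<Rightarrow> real \<Rightarrow> real \<Rightarrow> fnM \<Rightarrow> fnM \<Rightarrow> fnMZ" where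
  "inner_R c \<mu> \<nu> f g p = (\<lambda>(x, y). \<Sum>\<^sub>\<infinity>k::int.
     cnj (e (of_int (c * k * p) * (y - of_int p * \<nu>))) * f (x + of_int k, y)
       * cnj (g (x - 2 * of_int p * \<mu> + of_int k, y - 2 * of_int p * \<nu>)))"

definition inner_L :: "int \<Rightarrow> real \<Rightarrow> real \<Rightarrow> fnM \<Rightarrow> fnM \<Rightarrow> fnMZ" where
  "inner_L c \<mu> \<nu> f g p = (\<lambda>(x, y). \<Sum>\<^sub>\<infinity>k::int.
     e (of_int (c * p * k) * (y - of_int k * \<nu>)) * cnj (f (x - 2 * of_int k * \<mu>, y - 2 * of_int k * \<nu>))
       * g (x - 2 * of_int k * \<mu> + of_int p, y - 2 * of_int k * \<nu>))"

text \<open>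
  Both actions conjugate the algebra element. In particular \<open>a Id_E\<close> acts on \<open>\<Xi>\<close> by pointwise
  multiplication with the conjugate of \<open>a\<close>, which matters for the sign of the curvature below.
\<close>

definition act_L :: "fnMZ \<Rightarrow> fnM \<Rightarrow> fnM" where
  "act_L \<Psi> f = (\<lambda>(x, y). \<Sum>\<^sub>\<infinity>q. cnj (\<Psi> q (x, y)) * f (x + of_int q, y))"

definition act_R :: "real \<Rightarrow> real \<Rightarrow> fnM \<Rightarrow> fnMZ \<Rightarrow> fnM" where
  "act_R \<mu> \<nu> g \<Phi> = (\<lambda>(x, y). \<Sum>\<^sub>\<infinity>q::int.
     g (x + 2 * of_int q * \<mu>, y + 2 * of_int q * \<nu>)
       * cnj (\<Phi> q (x + 2 * of_int q * \<mu>, y + 2 * of_int q * \<nu>)))"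


section \<open>The Heisenberg Lie algebra and its derivations\<close>

text \<open>\<open>(a, b, d)\<close> stands for \<open>a X + b Y + d Z\<close>.\<close>

type_synonym heis = "real \<times> real \<times> real"

definition hX :: heis where "hX = (1, 0, 0)"
definition hY :: heis where "hY = (0, 1, 0)"
definition hZ :: heis where "hZ = (0, 0, 1)"

definition bracket :: "int \<Rightarrow> heis \<Rightarrow> heis \<Rightarrow> heis" where
  "bracket c = (\<lambda>(a, b, d) (a', b', d'). (0, 0, of_int c * (a * b' - a' * b)))"

definition delta_X :: "int \<Rightarrow> real \<Rightarrow> fnMZ \<Rightarrow> fnMZ" where
  "delta_X c \<mu> \<Phi> p = (\<lambda>(x, y).
     2 * of_real pi * \<i> * of_int c * of_int p * of_real (x - of_int p * \<mu>) * \<Phi> p (x, y)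
       - partial_y (\<Phi> p) (x, y))"

definition delta_Y :: "fnMZ \<Rightarrow> fnMZ" where
  "delta_Y \<Phi> p = (\<lambda>z. - partial_x (\<Phi> p) z)"

definition delta_Z :: "fnMZ \<Rightarrow> fnMZ" where
  "delta_Z \<Phi> p = (\<lambda>z. 2 * of_real pi * \<i> * of_int p * \<Phi> p z)"

definition delta :: "int \<Rightarrow> real \<Rightarrow> heis \<Rightarrow> fnMZ \<Rightarrow> fnMZ" where
  "delta c \<mu> = (\<lambda>(a, b, d) \<Phi> p z.
     of_real a * delta_X c \<mu> \<Phi> p z + of_real b * delta_Y \<Phi> p z + of_real d * delta_Z \<Phi> p z)"


section \<open>Connections and curvature\<close>

text \<open>
  A linear map \<open>\<Xi> \<rightarrow> \<Xi> \<otimes> h\<^sup>*\<close> is a map \<open>(W, \<xi>) \<mapsto> nab W \<xi>\<close> into \<open>\<Xi>\<close>, real linear in \<open>W\<close> and complex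
  linear in \<open>\<xi>\<close>. Only the values of \<open>nab W\<close> on \<open>Xi\<close> are constrained or used.
\<close>

definition linear_connection ::
  "int \<Rightarrow> real \<Rightarrow> real \<Rightarrow> (heis \<Rightarrow> fnM \<Rightarrow> fnM) \<Rightarrow> bool" where
  "linear_connection c \<mu> \<nu> nab \<longleftrightarrow>
     (\<forall>W. \<forall>\<xi>\<in>Xi. nab W \<xi> \<in> Xi) \<and>
     (\<forall>\<xi>\<in>Xi. \<forall>z. linear (\<lambda>W. nab W \<xi> z)) \<and>
     (\<forall>W. \<forall>\<xi>\<in>Xi. \<forall>\<eta>\<in>Xi. \<forall>a b.
        nab W (\<lambda>z. a * \<xi> z + b * \<eta> z) = (\<lambda>z. a * nab W \<xi> z + b * nab W \<eta> z)) \<and>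
     (\<forall>W. \<forall>\<xi>\<in>Xi. \<forall>\<Phi>\<in>D_alg c \<nu>.
        nab W (act_R \<mu> \<nu> \<xi> \<Phi>) =
          (\<lambda>z. act_R \<mu> \<nu> (nab W \<xi>) \<Phi> z + act_R \<mu> \<nu> \<xi> (delta c \<mu> W \<Phi>) z))"

definition compatible_connection ::
  "int \<Rightarrow> real \<Rightarrow> real \<Rightarrow> (heis \<Rightarrow> fnM \<Rightarrow> fnM) \<Rightarrow> bool" where
  "compatible_connection c \<mu> \<nu> nab \<longleftrightarrow>
     linear_connection c \<mu> \<nu> nab \<and>
     (\<forall>W. \<forall>\<xi>\<in>Xi. \<forall>\<eta>\<in>Xi.
        delta c \<mu> W (inner_R c \<mu> \<nu> \<xi> \<eta>) =
          (\<lambda>p z. inner_R c \<mu> \<nu> (nab W \<xi>) \<eta> p z + inner_R c \<mu> \<nu> \<xi> (nab W \<eta>) p z))"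

definition curvature_op ::
  "int \<Rightarrow> (heis \<Rightarrow> fnM \<Rightarrow> fnM) \<Rightarrow> heis \<Rightarrow> heis \<Rightarrow> fnM \<Rightarrow> fnM" where
  "curvature_op c nab W W' \<xi> =
     (\<lambda>z. nab W (nab W' \<xi>) z - nab W' (nab W \<xi>) z - nab (bracket c W W') \<xi> z)"

text \<open>The element of \<open>E\<close> inducing the curvature operator through the left action.\<close>

definition curvature ::
  "int \<Rightarrow> real \<Rightarrow> real \<Rightarrow> (heis \<Rightarrow> fnM \<Rightarrow> fnM) \<Rightarrow> heis \<Rightarrow> heis \<Rightarrow> fnMZ" where
  "curvature c \<mu> \<nu> nab W W' =
     (THE \<Psi>. \<Psi> \<in> E_alg c \<mu> \<nu> \<and> (\<forall>\<xi>\<in>Xi. act_L \<Psi> \<xi> = curvature_op c nab W W' \<xi>))"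

definition constant_curvature ::
  "int \<Rightarrow> real \<Rightarrow> real \<Rightarrow> (heis \<Rightarrow> fnM \<Rightarrow> fnM) \<Rightarrow> bool" where
  "constant_curvature c \<mu> \<nu> nab \<longleftrightarrow>
     (\<forall>W W'. \<exists>a::complex. curvature c \<mu> \<nu> nab W W' = (\<lambda>p z. a * Id_E p z))"


section \<open>The Yang--Mills functional\<close>

definition trace_D :: "fnMZ \<Rightarrow> complex" where
  "trace_D \<Phi> = integral (cbox (0, 0) (1, 1)) (\<Phi> 0)"

definition induced_trace ::
  "int \<Rightarrow> real \<Rightarrow> real \<Rightarrow> (fnMZ \<Rightarrow> complex) \<Rightarrow> bool" where
  "induced_trace c \<mu> \<nu> t \<longleftrightarrow>
     (\<forall>\<Phi>\<in>E_alg c \<mu> \<nu>. \<forall>\<Psi>\<in>E_alg c \<mu> \<nu>. \<forall>a b.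
        t (\<lambda>p z. a * \<Phi> p z + b * \<Psi> p z) = a * t \<Phi> + b * t \<Psi>) \<and>
     (\<forall>\<xi>\<in>Xi. \<forall>\<eta>\<in>Xi. t (inner_L c \<mu> \<nu> \<xi> \<eta>) = trace_D (inner_R c \<mu> \<nu> \<eta> \<xi>))"

text \<open>
  For \<open>\<mu> \<noteq> 0\<close> the left inner products span \<open>E\<close>, so the induced trace is unique on \<open>E\<close>: it is
  integration of \<open>\<Psi> 0\<close> over \<open>[0, 2\<bar>\<mu>\<bar>] \<times> [0, 1]\<close>. The choice below only affects irrelevant
  values outside \<open>E\<close>.
\<close>

definition trace_E :: "int \<Rightarrow> real \<Rightarrow> real \<Rightarrow> fnMZ \<Rightarrow> complex" where
  "trace_E c \<mu> \<nu> = (SOME t. induced_trace c \<mu> \<nu> t)"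

text \<open>
  The trace below is real for compatible connections, as curvatures are then skew-adjoint; \<open>Re\<close>
  only makes the values comparable.
\<close>

definition YM :: "int \<Rightarrow> real \<Rightarrow> real \<Rightarrow> (heis \<Rightarrow> fnM \<Rightarrow> fnM) \<Rightarrow> real" where
  "YM c \<mu> \<nu> nab =
     (let \<Theta> = curvature c \<mu> \<nu> nab;
          sq = (\<lambda>W W'. mult_E (\<Theta> W W') (\<Theta> W W'))
      in - Re (trace_E c \<mu> \<nu> (\<lambda>p z. sq hX hY p z + sq hX hZ p z + sq hY hZ p z)))"


section \<open>The reference connection\<close>

definition nabla0_X :: "int \<Rightarrow> real \<Rightarrow> fnM \<Rightarrow> fnM" where
  "nabla0_X c \<mu> \<xi> = (\<lambda>(x, y).
     - partial_y \<xi> (x, y) + of_real pi * of_int c * \<i> / (2 * of_real \<mu>) * of_real (x\<^sup>2) * \<xi> (x, y))"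

definition nabla0_Y :: "fnM \<Rightarrow> fnM" where
  "nabla0_Y \<xi> = (\<lambda>z. - partial_x \<xi> z)"

definition nabla0_Z :: "real \<Rightarrow> fnM \<Rightarrow> fnM" where
  "nabla0_Z \<mu> \<xi> = (\<lambda>(x, y). of_real pi * \<i> * of_real x / of_real \<mu> * \<xi> (x, y))"

definition nabla0 :: "int \<Rightarrow> real \<Rightarrow> heis \<Rightarrow> fnM \<Rightarrow> fnM" where
  "nabla0 c \<mu> = (\<lambda>(a, b, d) \<xi> z.
     of_real a * nabla0_X c \<mu> \<xi> z + of_real b * nabla0_Y \<xi> z + of_real d * nabla0_Z \<mu> \<xi> z)"

end

theory Submission
  imports Defs
begin

text \<open>
  The argument compares an arbitrary compatible connection \<open>\<nabla>\<close> with \<open>\<nabla>\<^sup>0\<close>. The difference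
  \<open>G\<^sub>W = \<nabla>\<^sub>W - \<nabla>\<^sup>0\<^sub>W\<close> commutes with the right action of \<open>D\<close>, hence is the left action of an element of
  \<open>E\<close> (\<open>D_linear_is_act_L\<close>). Expanding the curvature of \<open>\<nabla>\<^sup>0 + G\<close> gives
  \<open>\<Theta>(W,W') = \<Theta>\<^sup>0(W,W') + [\<nabla>\<^sup>0\<^sub>W, G\<^bsub>W'\<^esub>] - [\<nabla>\<^sup>0\<^bsub>W'\<^esub>, G\<^sub>W] + [G\<^sub>W, G\<^bsub>W'\<^esub>] - G\<^bsub>[W,W']\<^esub>\<close>.
  The trace on \<open>E\<close> kills the three commutators: it is translation invariant, so it annihilates
  derivatives (\<open>tr_hat_delta\<close>) and commutators in \<open>E\<close> (\<open>tr_composite_commute\<close>). If \<open>\<Theta>\<close> is a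
  constant, taking traces therefore shows that \<open>\<Theta>(X,Z) = 0\<close> and \<open>\<Theta>(Y,Z) = \<pi>i/\<mu>\<close> as for \<open>\<nabla>\<^sup>0\<close>, because
  these brackets vanish, while \<open>\<Theta>(X,Y)\<close> is a real multiple of the trace of \<open>G\<^sub>Z\<close>. Compatibility makes
  \<open>G\<^sub>Z\<close> skew, so \<open>\<Theta>(X,Y) = si\<close> with \<open>s\<close> real, and
  \<open>YM(\<nabla>) = 2\<bar>\<mu>\<bar> (s\<^sup>2 + (\<pi>/\<mu>)\<^sup>2)\<close> (\<open>constant_curvature_data\<close>). This is minimal exactly for \<open>s = 0\<close>,
  and \<open>\<nabla>\<^sup>0\<close> attains the minimum (\<open>nabla0_compatible\<close>, \<open>curvature_nabla0\<close>).

  Three analytic facts carry this. Termwise differentiation of the series defining the inner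
  products and the actions (\<open>derivs_in_infsum\<close>) places the inner products in the smooth algebras
  (\<open>inner_R_in_D_alg\<close>, \<open>inner_L_in_E_alg\<close>). A smooth partition of unity provides a finite frame
  \<open>\<Sum>\<^sub>j \<langle>f\<^sub>j,g\<^sub>j\<rangle>\<^sub>L = Id\<^sub>E\<close> (\<open>frame_identity\<close>), from which both the description of \<open>D\<close>-linear operators and
  the value of the induced trace on \<open>Id\<^sub>E\<close> (\<open>trace_E_scalar\<close>) are read off. Finally, unfolding the
  two inner products to the same integral over \<open>\<real> \<times> T\<close> (\<open>tr_inner_L\<close>) shows that an induced trace
  exists.
\<close>

section \<open>Iterated partial derivatives\<close>

lemma Basis_plane: "Basis = {(1, 0), (0, 1) :: real \<times> real}"
  by (auto simp: Basis_prod_def)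

lemma x_Basis: "(1, 0) \<in> (Basis :: (real \<times> real) set)"
  and y_Basis: "(0, 1) \<in> (Basis :: (real \<times> real) set)"
  by (simp_all add: Basis_plane)

lemma partial_eqI: "(f has_derivative f') (at z) \<Longrightarrow> partial u f z = f' u"
  unfolding partial_def by (metis frechet_derivative_at)

lemma has_derivative_partial:
  assumes "f differentiable (at z)"
  shows "(f has_derivative (\<lambda>h. fst h *\<^sub>R partial_x f z + snd h *\<^sub>R partial_y f z)) (at z)"
proof -
  let ?D = "frechet_derivative f (at z)"
  have D: "(f has_derivative ?D) (at z)"
    using assms frechet_derivative_works by blast
  then have lin: "linear ?D"
    by (rule has_derivative_linear)
  have "?D h = fst h *\<^sub>R partial_x f z + snd h *\<^sub>R partial_y f z" for h
  proof -
    have "h = fst h *\<^sub>R (1, 0) + snd h *\<^sub>R (0, 1)"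
      by (cases h) simp
    then have "?D h = ?D (fst h *\<^sub>R (1, 0) + snd h *\<^sub>R (0, 1))"
      by simp
    then show ?thesis
      by (simp only: partial_def linear_add[OF lin] linear_scale[OF lin])
  qed
  then have "?D = (\<lambda>h. fst h *\<^sub>R partial_x f z + snd h *\<^sub>R partial_y f z)"
    by (intro ext)
  then show ?thesis
    using D by metis
qed

lemma partial_add:
  "f differentiable (at z) \<Longrightarrow> g differentiable (at z) \<Longrightarrow>
    partial u (\<lambda>z. f z + g z) z = partial u f z + partial u g z"
  unfolding partial_def by (subst frechet_derivative_at[symmetric])
    (auto intro!: has_derivative_add simp flip: frechet_derivative_works)

lemma partial_mult:
  "f differentiable (at z) \<Longrightarrow> g differentiable (at z) \<Longrightarrow>
    partial u (\<lambda>z. f z * g z) z = partial u f z * g z + f z * partial u g z"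
  unfolding partial_def by (subst frechet_derivative_at[symmetric])
    (auto intro!: derivative_eq_intros simp flip: frechet_derivative_works simp: add.commute)

lemma partial_cmult:
  "f differentiable (at z) \<Longrightarrow> partial u (\<lambda>z. a * f z) z = a * partial u f z"
  using partial_mult[of "\<lambda>_. a" z f u] by (simp add: partial_def)

lemma differentiable_cnj:
  "f differentiable (at z) \<Longrightarrow> (\<lambda>z. cnj (f z)) differentiable (at z)"
  unfolding differentiable_def by (blast intro: has_derivative_cnj)

lemma partial_cnj:
  "f differentiable (at z) \<Longrightarrow> partial u (\<lambda>z. cnj (f z)) z = cnj (partial u f z)"
  unfolding partial_def by (subst frechet_derivative_at[symmetric])
    (auto intro!: has_derivative_cnj simp flip: frechet_derivative_works)

lemma has_derivative_shift:
  assumes "(f has_derivative f') (at (z + a))"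
  shows "((\<lambda>z. f (z + a)) has_derivative f') (at (z :: real \<times> real))"
proof -
  have "((\<lambda>z. z + a) has_derivative (\<lambda>h. h)) (at z)"
    by (auto intro!: derivative_eq_intros)
  from diff_chain_at[OF this, of f f'] assms show ?thesis
    by (simp add: o_def)
qed

lemma differentiable_shift:
  "f differentiable (at (z + a)) \<Longrightarrow> (\<lambda>z. f (z + a)) differentiable (at (z :: real \<times> real))"
  unfolding differentiable_def by (blast intro: has_derivative_shift)

lemma partial_shift:
  "f differentiable (at (z + a)) \<Longrightarrow> partial u (\<lambda>z. f (z + a)) z = partial u f (z + a)"
  by (rule partial_eqI, unfold partial_def, rule has_derivative_shift)
    (simp flip: frechet_derivative_works)

lemma partials_Nil [simp]: "partials [] f = f"
  by (simp add: partials_def)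

lemma partials_Cons [simp]: "partials (u # us) f = partial u (partials us f)"
  by (simp add: partials_def)

lemma partials_append: "partials (us @ vs) f = partials us (partials vs f)"
  by (simp add: partials_def)

lemma smooth_partials: "smooth f \<Longrightarrow> vs \<in> lists Basis \<Longrightarrow> smooth (partials vs f)"
  unfolding smooth_def by (metis append_in_lists_conv partials_append)

lemma smooth_partial: "smooth f \<Longrightarrow> u \<in> Basis \<Longrightarrow> smooth (partial u f)"
  using smooth_partials[of f "[u]"] by simp

lemma smooth_partial_x: "smooth f \<Longrightarrow> smooth (partial_x f)"
  and smooth_partial_y: "smooth f \<Longrightarrow> smooth (partial_y f)"
  by (simp_all add: smooth_partial x_Basis y_Basis)

lemma smooth_differentiable:
  assumes "smooth f"
  shows "f differentiable (at z)"
proof -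
  have "partials [] f differentiable_on UNIV"
    using assms lists.Nil unfolding smooth_def by (rule bspec)
  then show ?thesis
    by (cases z) (simp add: differentiable_on_def)
qed

lemma smooth_continuous: "smooth f \<Longrightarrow> continuous_on S f"
  by (meson continuous_at_imp_continuous_on differentiable_imp_continuous_within
      smooth_differentiable)

text \<open>
  All estimates below have the form ``every iterated partial derivative of the family \<open>F\<close> satisfies
  the growth condition \<open>Q\<close>''. A condition on families, rather than on single functions, is what
  makes bounds uniform in a summation index expressible.
\<close>

definition derivs_in :: "(('i \<Rightarrow> fnM) \<Rightarrow> bool) \<Rightarrow> ('i \<Rightarrow> fnM) \<Rightarrow> bool" where
  "derivs_in Q F \<longleftrightarrow>
     (\<forall>i. smooth (F i)) \<and> (\<forall>us \<in> lists Basis. Q (\<lambda>i. partials us (F i)))"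

text \<open>
  The coinduction principle that replaces explicit formulas for higher derivatives: it suffices to
  exhibit a class of families that is closed under \<open>\<partial>/\<partial>x\<close> and \<open>\<partial>/\<partial>y\<close>.
\<close>

lemma derivs_in_coinduct [consumes 1, case_names step]:
  assumes "S F"
    and step: "\<And>F. S F \<Longrightarrow>
      (\<forall>i z. F i differentiable (at z)) \<and> Q F \<and> (\<forall>u \<in> Basis. S (\<lambda>i. partial u (F i)))"
  shows "derivs_in Q F"
proof -
  have S: "S (\<lambda>i. partials us (F i))" if "us \<in> lists Basis" for us
    using that
  proof (induction us)
    case Nil
    then show ?case using assms(1) by simp
  next
    case (Cons u us)
    then show ?case using step[of "\<lambda>i. partials us (F i)"] by simp
  qed
  show ?thesis
    unfolding derivs_in_def smooth_def differentiable_on_def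
    using step[OF S] by simp
qed

lemma derivs_in_smooth: "derivs_in Q F \<Longrightarrow> smooth (F i)"
  by (simp add: derivs_in_def)

lemma derivs_in_differentiable: "derivs_in Q F \<Longrightarrow> F i differentiable (at z)"
  by (simp add: derivs_in_smooth smooth_differentiable)

lemma derivs_in_base:
  assumes "derivs_in Q F"
  shows "Q F"
proof -
  have "Q (\<lambda>i. partials [] (F i))"
    using assms lists.Nil unfolding derivs_in_def by (elim conjE) (rule bspec)
  then show ?thesis
    by (simp only: partials_Nil)
qed

lemma derivs_in_partial:
  assumes "derivs_in Q F" "u \<in> Basis"
  shows "derivs_in Q (\<lambda>i. partial u (F i))"
proof -
  have "Q (\<lambda>i. partials us (partial u (F i)))" if "us \<in> lists Basis" for us
  proof -
    have "us @ [u] \<in> lists Basis"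
      using that assms(2) by simp
    then have "Q (\<lambda>i. partials (us @ [u]) (F i))"
      using assms(1) unfolding derivs_in_def by blast
    then show ?thesis
      by (simp add: partials_append)
  qed
  then show ?thesis
    using assms smooth_partial unfolding derivs_in_def by blast
qed

lemma smooth_iff_derivs_in: "smooth f \<longleftrightarrow> derivs_in (\<lambda>_. True) (\<lambda>_::unit. f)"
  by (simp add: derivs_in_def)

lemma derivs_in_add:
  assumes "derivs_in Q1 F" "derivs_in Q2 G"
    and "\<And>U V. Q1 U \<Longrightarrow> Q2 V \<Longrightarrow> Q (\<lambda>i z. U i z + V i z)"
  shows "derivs_in Q (\<lambda>i z. F i z + G i z)"
proof -
  let ?S = "\<lambda>H. \<exists>U V. derivs_in Q1 U \<and> derivs_in Q2 V \<and> H = (\<lambda>i z. U i z + V i z)"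
  show ?thesis
  proof (rule derivs_in_coinduct[where S = ?S])
    show "?S (\<lambda>i z. F i z + G i z)"
      using assms(1,2) by (intro exI[of _ F] exI[of _ G]) simp
    fix H assume "?S H"
    then obtain U V where 1: "derivs_in Q1 U" "derivs_in Q2 V" "H = (\<lambda>i z. U i z + V i z)"
      by (elim exE conjE) (rule that)
    have d: "U i differentiable (at z)" "V i differentiable (at z)" for i z
      by (rule derivs_in_differentiable[OF 1(1)] derivs_in_differentiable[OF 1(2)])+
    have P: "?S (\<lambda>i. partial u (H i))" if "u \<in> Basis" for u
    proof (intro exI conjI)
      show "derivs_in Q1 (\<lambda>i. partial u (U i))" "derivs_in Q2 (\<lambda>i. partial u (V i))"
        by (rule derivs_in_partial[OF 1(1) that] derivs_in_partial[OF 1(2) that])+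
      show "(\<lambda>i. partial u (H i)) = (\<lambda>i z. partial u (U i) z + partial u (V i) z)"
        unfolding 1(3) by (intro ext partial_add d)
    qed
    have QH: "Q H"
      unfolding 1(3) by (rule assms(3)[OF derivs_in_base[OF 1(1)] derivs_in_base[OF 1(2)]])
    have D: "H i differentiable (at z)" for i z
      unfolding 1(3) by (intro differentiable_add d)
    show "(\<forall>i z. H i differentiable (at z)) \<and> Q H \<and> (\<forall>u \<in> Basis. ?S (\<lambda>i. partial u (H i)))"
      by (intro conjI allI ballI D QH P)
  qed
qed

text \<open>
  The derivatives of products \<open>F\<cdot>G\<close> are sums of products of derivatives; this is the class of
  families that the Leibniz rule leaves invariant.
\<close>

inductive product_sum ::
  "(('i \<Rightarrow> fnM) \<Rightarrow> bool) \<Rightarrow> (('i \<Rightarrow> fnM) \<Rightarrow> bool) \<Rightarrow> ('i \<Rightarrow> fnM) \<Rightarrow> bool" for Q1 Q2 where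
  product: "derivs_in Q1 F \<Longrightarrow> derivs_in Q2 G \<Longrightarrow> H = (\<lambda>i z. F i z * G i z) \<Longrightarrow> product_sum Q1 Q2 H"
| sum: "product_sum Q1 Q2 U \<Longrightarrow> product_sum Q1 Q2 V \<Longrightarrow> H = (\<lambda>i z. U i z + V i z) \<Longrightarrow>
    product_sum Q1 Q2 H"

lemma derivs_in_mult:
  assumes "derivs_in Q1 F" "derivs_in Q2 G"
    and m: "\<And>U V. Q1 U \<Longrightarrow> Q2 V \<Longrightarrow> Q (\<lambda>i z. U i z * V i z)"
    and a: "\<And>U V. Q U \<Longrightarrow> Q V \<Longrightarrow> Q (\<lambda>i z. U i z + V i z)"
  shows "derivs_in Q (\<lambda>i z. F i z * G i z)"
proof -
  have "product_sum Q1 Q2 (\<lambda>i z. F i z * G i z)"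
    by (rule product_sum.product[OF assms(1,2) refl])
  then show ?thesis
  proof (rule derivs_in_coinduct[where S = "product_sum Q1 Q2"])
    fix H assume "product_sum Q1 Q2 H"
    then show "(\<forall>i z. H i differentiable (at z)) \<and> Q H \<and>
        (\<forall>u\<in>Basis. product_sum Q1 Q2 (\<lambda>i. partial u (H i)))"
    proof (induction H)
      case (product F G H)
      have d: "F i differentiable (at z)" "G i differentiable (at z)" for i z
        by (rule derivs_in_differentiable[OF product(1)] derivs_in_differentiable[OF product(2)])+
      have P: "product_sum Q1 Q2 (\<lambda>i. partial u (H i))" if "u \<in> Basis" for u
      proof -
        note dF = derivs_in_partial[OF product(1) that] and dG = derivs_in_partial[OF product(2) that]
        have "(\<lambda>i. partial u (H i)) =
            (\<lambda>i z. partial u (F i) z * G i z + F i z * partial u (G i) z)"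
          unfolding product(3) by (intro ext partial_mult d)
        then show ?thesis
          by (rule product_sum.sum[OF product_sum.product[OF dF product(2) refl]
              product_sum.product[OF product(1) dG refl]])
      qed
      have D: "H i differentiable (at z)" for i z
        unfolding product(3) by (intro differentiable_mult d)
      have QH: "Q H"
        unfolding product(3) by (rule m[OF derivs_in_base[OF product(1)] derivs_in_base[OF product(2)]])
      show ?case
        by (intro conjI allI ballI P D QH)
    next
      case (sum U V H)
      have d: "U i differentiable (at z)" "V i differentiable (at z)" and Q: "Q U" "Q V" for i z
        using sum.IH by blast+
      have P: "product_sum Q1 Q2 (\<lambda>i. partial u (H i))" if "u \<in> Basis" for u
      proof -
        have PU: "product_sum Q1 Q2 (\<lambda>i. partial u (U i))"
          and PV: "product_sum Q1 Q2 (\<lambda>i. partial u (V i))"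
          using sum.IH that by blast+
        have "(\<lambda>i. partial u (H i)) = (\<lambda>i z. partial u (U i) z + partial u (V i) z)"
          unfolding sum(3) by (intro ext partial_add d)
        then show ?thesis
          by (rule product_sum.sum[OF PU PV])
      qed
      have D: "H i differentiable (at z)" for i z
        unfolding sum(3) by (intro differentiable_add d)
      have QH: "Q H"
        unfolding sum(3) by (rule a[OF Q])
      show ?case
        by (intro conjI allI ballI P D QH)
    qed
  qed
qed

lemma derivs_in_cnj:
  assumes "derivs_in Q1 F" and "\<And>U. Q1 U \<Longrightarrow> Q (\<lambda>i z. cnj (U i z))"
  shows "derivs_in Q (\<lambda>i z. cnj (F i z))"
proof -
  let ?S = "\<lambda>H. \<exists>U. derivs_in Q1 U \<and> H = (\<lambda>i z. cnj (U i z))"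
  show ?thesis
  proof (rule derivs_in_coinduct[where S = ?S])
    show "?S (\<lambda>i z. cnj (F i z))"
      using assms(1) by (intro exI[of _ F]) simp
    fix H assume "?S H"
    then obtain U where 1: "derivs_in Q1 U" "H = (\<lambda>i z. cnj (U i z))"
      by (elim exE conjE) (rule that)
    have d: "U i differentiable (at z)" for i z
      by (rule derivs_in_differentiable[OF 1(1)])
    have P: "\<exists>U'. derivs_in Q1 U' \<and> (\<lambda>i. partial u (H i)) = (\<lambda>i z. cnj (U' i z))"
      if "u \<in> Basis" for u
      using derivs_in_partial[OF 1(1) that] by (intro exI[of _ "\<lambda>i. partial u (U i)"]) (simp add: 1(2) partial_cnj d fun_eq_iff)
    have QH: "Q H"
      unfolding 1(2) by (rule assms(2)[OF derivs_in_base[OF 1(1)]])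
    have D: "H i differentiable (at z)" for i z
      unfolding 1(2) using d by (simp add:  differentiable_cnj)
    show "(\<forall>i z. H i differentiable (at z)) \<and> Q H \<and> (\<forall>u \<in> Basis. ?S (\<lambda>i. partial u (H i)))"
      by (intro conjI allI ballI D QH P)
  qed
qed

lemma derivs_in_shift:
  fixes r :: "'j \<Rightarrow> 'i" and a :: "'j \<Rightarrow> real \<times> real"
  assumes "derivs_in Q1 F" and "\<And>U. Q1 U \<Longrightarrow> Q (\<lambda>j z. U (r j) (z + a j))"
  shows "derivs_in Q (\<lambda>j z. F (r j) (z + a j))"
proof -
  let ?S = "\<lambda>H. \<exists>U. derivs_in Q1 U \<and> H = (\<lambda>j z. U (r j) (z + a j))"
  show ?thesis
  proof (rule derivs_in_coinduct[where S = ?S])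
    show "?S (\<lambda>j z. F (r j) (z + a j))"
      using assms(1) by (intro exI[of _ F]) simp
    fix H assume "?S H"
    then obtain U where 1: "derivs_in Q1 U" "H = (\<lambda>j z. U (r j) (z + a j))"
      by (elim exE conjE) (rule that)
    have d: "U i differentiable (at z)" for i z
      by (rule derivs_in_differentiable[OF 1(1)])
    have P: "\<exists>U'. derivs_in Q1 U' \<and> (\<lambda>i. partial u (H i)) = (\<lambda>j z. U' (r j) (z + a j))"
      if "u \<in> Basis" for u
      using derivs_in_partial[OF 1(1) that] by (intro exI[of _ "\<lambda>i. partial u (U i)"]) (simp add: 1(2) partial_shift d fun_eq_iff)
    have QH: "Q H"
      unfolding 1(2) by (rule assms(2)[OF derivs_in_base[OF 1(1)]])
    have D: "H i differentiable (at z)" for i z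
      unfolding 1(2) using d by (simp add:  differentiable_shift)
    show "(\<forall>i z. H i differentiable (at z)) \<and> Q H \<and> (\<forall>u \<in> Basis. ?S (\<lambda>i. partial u (H i)))"
      by (intro conjI allI ballI D QH P)
  qed
qed

lemma derivs_in_cmult:
  assumes "derivs_in Q1 F" and "\<And>U. Q1 U \<Longrightarrow> Q (\<lambda>i z. a i * U i z)"
  shows "derivs_in Q (\<lambda>i z. a i * F i z)"
proof -
  let ?S = "\<lambda>H. \<exists>U. derivs_in Q1 U \<and> H = (\<lambda>i z. a i * U i z)"
  show ?thesis
  proof (rule derivs_in_coinduct[where S = ?S])
    show "?S (\<lambda>i z. a i * F i z)"
      using assms(1) by (intro exI[of _ F]) simp
    fix H assume "?S H"
    then obtain U where 1: "derivs_in Q1 U" "H = (\<lambda>i z. a i * U i z)"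
      by (elim exE conjE) (rule that)
    have d: "U i differentiable (at z)" for i z
      by (rule derivs_in_differentiable[OF 1(1)])
    have P: "\<exists>U'. derivs_in Q1 U' \<and> (\<lambda>i. partial u (H i)) = (\<lambda>i z. a i * U' i z)"
      if "u \<in> Basis" for u
      using derivs_in_partial[OF 1(1) that] by (intro exI[of _ "\<lambda>i. partial u (U i)"]) (simp add: 1(2) partial_cmult d fun_eq_iff)
    have QH: "Q H"
      unfolding 1(2) by (rule assms(2)[OF derivs_in_base[OF 1(1)]])
    have D: "H i differentiable (at z)" for i z
      unfolding 1(2) using d by simp
    show "(\<forall>i z. H i differentiable (at z)) \<and> Q H \<and> (\<forall>u \<in> Basis. ?S (\<lambda>i. partial u (H i)))"
      by (intro conjI allI ballI D QH P)
  qed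
qed

lemma smooth_add: "smooth f \<Longrightarrow> smooth g \<Longrightarrow> smooth (\<lambda>z. f z + g z)"
  unfolding smooth_iff_derivs_in by (rule derivs_in_add)

lemma smooth_mult: "smooth f \<Longrightarrow> smooth g \<Longrightarrow> smooth (\<lambda>z. f z * g z)"
  unfolding smooth_iff_derivs_in by (rule derivs_in_mult)

lemma smooth_cmult: "smooth f \<Longrightarrow> smooth (\<lambda>z. a * f z)"
  unfolding smooth_iff_derivs_in by (rule derivs_in_cmult)

lemma smooth_shift: "smooth f \<Longrightarrow> smooth (\<lambda>z. f (z + a))"
  unfolding smooth_iff_derivs_in by (rule derivs_in_shift)


subsection \<open>Symmetry of second derivatives\<close>

lemma partial_x_vector_derivative:
  assumes "f differentiable (at (x, y))"
  shows "((\<lambda>x. f (x, y)) has_vector_derivative partial_x f (x, y)) (at x)"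
proof -
  have "((\<lambda>x. (x, y)) has_derivative (\<lambda>h. (h, 0))) (at x)"
    by (auto intro!: derivative_eq_intros)
  from diff_chain_at[OF this has_derivative_partial[OF assms]]
  show ?thesis
    by (simp add: o_def has_vector_derivative_def)
qed

lemma partial_y_vector_derivative:
  assumes "f differentiable (at (x, y))"
  shows "((\<lambda>y. f (x, y)) has_vector_derivative partial_y f (x, y)) (at y)"
proof -
  have "((\<lambda>y. (x, y)) has_derivative (\<lambda>h. (0, h))) (at y)"
    by (auto intro!: derivative_eq_intros)
  from diff_chain_at[OF this has_derivative_partial[OF assms]]
  show ?thesis
    by (simp add: o_def has_vector_derivative_def)
qed

lemma continuous_on_slices:
  assumes "continuous_on UNIV (f :: real \<times> real \<Rightarrow> complex)"
  shows "continuous_on S (\<lambda>y. f (x, y))" "continuous_on T (\<lambda>x. f (x, y))"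
proof -
  have "continuous_on S (\<lambda>y. (x, y))" "continuous_on T (\<lambda>x. (x, y))"
    by (intro continuous_intros)+
  then show "continuous_on S (\<lambda>y. f (x, y))" "continuous_on T (\<lambda>x. f (x, y))"
    using continuous_on_compose2[OF assms] by auto
qed

text \<open>
  Differentiating \<open>f(x,y) = f(x,b) + \<integral>\<^sub>b\<^sup>y \<partial>\<^sub>y f(x,t) dt\<close> with respect to \<open>x\<close>, and then with
  respect to \<open>y\<close>, exchanges the order of differentiation.
\<close>

lemma smooth_mixed_partials:
  assumes "smooth f"
  shows "partial_x (partial_y f) = partial_y (partial_x f)"
proof
  fix z :: "real \<times> real"
  obtain x0 y0 where z: "z = (x0, y0)" by (cases z)
  \<comment> \<open>Any \<open>b < y0\<close> would do; it keeps the interval of integration nondegenerate near \<open>y0\<close>.\<close>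
  define b where "b = y0 - 1"
  define h where "h = partial_x (partial_y f)"
  have d: "f differentiable (at w)" "partial_y f differentiable (at w)"
    "partial_x f differentiable (at w)" for w
    by (intro smooth_differentiable smooth_partial_x smooth_partial_y assms)+
  have ch: "continuous_on S h" and cy: "continuous_on S (partial_y f)" for S
    unfolding h_def by (intro smooth_continuous smooth_partial_x smooth_partial_y assms)+
  have ftc: "f (x, y) = f (x, b) + integral (cbox b y) (\<lambda>t. partial_y f (x, t))" if "b \<le> y" for x y
  proof -
    have "((\<lambda>t. partial_y f (x, t)) has_integral (f (x, y) - f (x, b))) {b..y}"
      by (rule fundamental_theorem_of_calculus[where f = "\<lambda>t. f (x, t)", OF that])
        (rule has_vector_derivative_at_within[OF partial_y_vector_derivative[OF d(1)]])
    then show ?thesis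
      by (simp add: integral_unique)
  qed
  have dx: "partial_x f (x0, y) = partial_x f (x0, b) + integral (cbox b y) (\<lambda>t. h (x0, t))"
    if "b \<le> y" for y
  proof -
    have "((\<lambda>x. integral (cbox b y) (\<lambda>t. partial_y f (x, t))) has_vector_derivative
        integral (cbox b y) (\<lambda>t. h (x0, t))) (at x0)"
    proof (rule leibniz_rule_vector_derivative[where U = UNIV])
      show "((\<lambda>x. partial_y f (x, t)) has_vector_derivative h (x, t)) (at x)" for x t
        unfolding h_def by (rule partial_x_vector_derivative[OF d(2)])
      show "(\<lambda>t. partial_y f (x, t)) integrable_on cbox b y" for x
        by (intro integrable_continuous continuous_on_slices(1)[OF cy])
      show "continuous_on (UNIV \<times> cbox b y) (\<lambda>(x, t). h (x, t))"
        using ch by simp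
    qed simp_all
    then have "((\<lambda>x. f (x, b) + integral (cbox b y) (\<lambda>t. partial_y f (x, t)))
        has_vector_derivative (partial_x f (x0, b) + integral (cbox b y) (\<lambda>t. h (x0, t)))) (at x0)"
      by (rule has_vector_derivative_add[OF partial_x_vector_derivative[OF d(1)]])
    then have "((\<lambda>x. f (x, y)) has_vector_derivative
        (partial_x f (x0, b) + integral (cbox b y) (\<lambda>t. h (x0, t)))) (at x0)"
      by (simp only: ftc[OF that, symmetric])
    with partial_x_vector_derivative[OF d(1)] show ?thesis
      by (rule vector_derivative_unique_at)
  qed
  let ?g = "\<lambda>y. partial_x f (x0, b) + integral (cbox b y) (\<lambda>t. h (x0, t))"
  have "((\<lambda>y. integral {b..y} (\<lambda>t. h (x0, t))) has_vector_derivative h (x0, y0))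
      (at y0 within {b..y0 + 1})"
    by (rule integral_has_vector_derivative) (simp_all add: b_def continuous_on_slices(1)[OF ch])
  then have "(?g has_vector_derivative (0 + h (x0, y0))) (at y0 within {b..y0 + 1})"
    by (intro has_vector_derivative_add has_vector_derivative_const) (simp only: interval_cbox)
  moreover have "at y0 within {b..y0 + 1} = at y0"
    by (rule at_within_interior) (simp add: b_def)
  ultimately have "(?g has_vector_derivative h (x0, y0)) (at y0)"
    by simp
  then have "((\<lambda>y. partial_x f (x0, y)) has_vector_derivative h (x0, y0)) (at y0)"
  proof (rule has_vector_derivative_transform_within_open)
    show "open {b<..}" "y0 \<in> {b<..}"
      by (simp_all add: b_def)
    show "?g y = partial_x f (x0, y)" if "y \<in> {b<..}" for y
      using that by (intro dx[symmetric]) simp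
  qed
  with partial_y_vector_derivative[OF d(3)] have "partial_y (partial_x f) (x0, y0) = h (x0, y0)"
    by (rule vector_derivative_unique_at)
  then show "partial_x (partial_y f) z = partial_y (partial_x f) z"
    by (simp only: z h_def)
qed


section \<open>Differentiating series termwise\<close>

definition wgt :: "int \<Rightarrow> real" where
  "wgt k = 1 / (1 + \<bar>of_int k\<bar>)\<^sup>2"

lemma wgt_pos [simp]: "0 < wgt k"
  by (simp add: wgt_def)

lemma wgt_nonneg [simp]: "0 \<le> wgt k"
  using wgt_pos less_imp_le by blast

lemma wgt_minus [simp]: "wgt (- k) = wgt k"
  by (simp add: wgt_def)

lemma summable_wgt: "wgt summable_on UNIV"
proof -
  have "summable (\<lambda>n. inverse (real n ^ 2))"
    by (rule inverse_power_summable) simp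
  then have "summable (\<lambda>n. inverse (real (Suc n) ^ 2))"
    by (subst summable_Suc_iff)
  moreover have "inverse (real (Suc n) ^ 2) = wgt (int n)" for n
    by (simp add: wgt_def inverse_eq_divide)
  ultimately have "summable (\<lambda>n. wgt (int n))"
    by simp
  then have "(\<lambda>n. wgt (int n)) summable_on UNIV"
    by (intro summable_nonneg_imp_summable_on) auto
  then have 1: "wgt summable_on range int" and 2: "wgt summable_on range (\<lambda>n. - int n)"
    by (simp_all add: summable_on_reindex inj_on_def o_def)
  have "range int \<union> range (\<lambda>n. - int n) = UNIV"
  proof -
    have "k \<in> range int \<union> range (\<lambda>n. - int n)" for k :: int
      by (cases k rule: int_cases2) auto
    then show ?thesis by blast
  qed
  then show ?thesis
    using summable_on_union[OF 1 2] by simp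
qed

lemma norm_summable_by_wgt:
  fixes f :: "int \<Rightarrow> complex"
  assumes "\<And>k. norm (f k) \<le> C * wgt k"
  shows "(\<lambda>k. norm (f k)) summable_on UNIV"
proof (rule summable_on_comparison_test)
  show "(\<lambda>k. C * wgt k) summable_on UNIV"
    by (rule summable_on_cmult_right[OF summable_wgt])
qed (use assms in auto)

lemma summable_by_wgt:
  fixes f :: "int \<Rightarrow> complex"
  assumes "\<And>k. norm (f k) \<le> C * wgt k"
  shows "f summable_on UNIV"
  by (rule abs_summable_summable[OF norm_summable_by_wgt[of f C]]) (rule assms)

lemma norm_infsum_by_wgt:
  fixes f :: "int \<Rightarrow> complex"
  assumes "\<And>k. norm (f k) \<le> C * wgt k"
  shows "norm (\<Sum>\<^sub>\<infinity>k. f k) \<le> C * (\<Sum>\<^sub>\<infinity>k. wgt k)"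
proof -
  have s: "(\<lambda>k. norm (f k)) summable_on UNIV"
    by (rule norm_summable_by_wgt[of f C]) (rule assms)
  have "norm (\<Sum>\<^sub>\<infinity>k. f k) \<le> (\<Sum>\<^sub>\<infinity>k. norm (f k))"
    by (rule norm_infsum_bound[OF s])
  also have "\<dots> \<le> (\<Sum>\<^sub>\<infinity>k. C * wgt k)"
    by (rule infsum_mono[OF s summable_on_cmult_right[OF summable_wgt]]) (rule assms)
  also have "\<dots> = C * (\<Sum>\<^sub>\<infinity>k. wgt k)"
    by (rule infsum_cmult_right')
  finally show ?thesis .
qed

text \<open>
  A Weierstrass majorant that is uniform on compact sets, with a fixed summable weight in the index.
\<close>

definition loc_summable :: "(int \<Rightarrow> fnM) \<Rightarrow> bool" where
  "loc_summable f \<longleftrightarrow> (\<forall>K. compact K \<longrightarrow> (\<exists>C. \<forall>k. \<forall>z\<in>K. norm (f k z) \<le> C * wgt k))"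

lemma loc_summableD:
  assumes "loc_summable f" "compact K"
  obtains C where "\<And>k z. z \<in> K \<Longrightarrow> norm (f k z) \<le> C * wgt k"
proof -
  have "\<exists>C. \<forall>k. \<forall>z\<in>K. norm (f k z) \<le> C * wgt k"
    using assms unfolding loc_summable_def by simp
  then show ?thesis
    using that by auto
qed

lemma loc_summable_summable:
  assumes "loc_summable f"
  shows "(\<lambda>k. f k z) summable_on UNIV"
proof -
  obtain C where "\<And>k w. w \<in> {z} \<Longrightarrow> norm (f k w) \<le> C * wgt k"
    by (rule loc_summableD[OF assms compact_sing[of z]]) (rule that)
  then show ?thesis
    by (intro summable_by_wgt[of _ C]) simp
qed

lemma symmetric_intervals_at_top:
  "filterlim (\<lambda>n. {- int n..int n}) (finite_subsets_at_top UNIV) sequentially"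
  unfolding filterlim_finite_subsets_at_top
proof safe
  fix X :: "int set" assume X: "finite X"
  obtain N where "\<forall>k\<in>X. nat \<bar>k\<bar> \<le> N"
    using X finite_nat_set_iff_bounded_le[of "(\<lambda>k. nat \<bar>k\<bar>) ` X"] by auto
  then have "X \<subseteq> {- int n..int n}" if "n \<ge> N" for n
    using that by fastforce
  then show "\<forall>\<^sub>F n in sequentially. finite {- int n..int n} \<and> X \<subseteq> {- int n..int n} \<and> {- int n..int n} \<subseteq> UNIV"
    using eventually_sequentiallyI[of N] by auto
qed

lemma loc_summable_uniform_limit:
  assumes "loc_summable f" "compact K"
  shows "uniform_limit K (\<lambda>X z. \<Sum>k\<in>X. f k z) (\<lambda>z. \<Sum>\<^sub>\<infinity>k. f k z) (finite_subsets_at_top UNIV)"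
proof -
  obtain C where C: "\<And>k z. z \<in> K \<Longrightarrow> norm (f k z) \<le> C * wgt k"
    by (rule loc_summableD[OF assms]) (rule that)
  show ?thesis
  proof (rule Weierstrass_m_test_general[where M = "\<lambda>k. C * wgt k"])
    show "norm (f k z) \<le> C * wgt k" if "z \<in> K" for k z
      by (rule C[OF that])
  qed (rule summable_on_cmult_right[OF summable_wgt])
qed

lemma loc_summable_uniform_limit_symmetric:
  assumes "loc_summable f" "compact K"
  shows "uniform_limit K (\<lambda>n z. \<Sum>k\<in>{- int n..int n}. f k z) (\<lambda>z. \<Sum>\<^sub>\<infinity>k. f k z) sequentially"
  by (rule filterlim_compose[OF loc_summable_uniform_limit[OF assms] symmetric_intervals_at_top])

text \<open>
  The symmetric partial sums form a sequence to which the theorem on uniformly convergent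
  derivatives applies on a ball.
\<close>

lemma has_derivative_infsum:
  assumes d: "\<And>k z. f k differentiable (at z)"
    and s: "loc_summable f" "loc_summable (\<lambda>k. partial_x (f k))" "loc_summable (\<lambda>k. partial_y (f k))"
  shows "((\<lambda>z. \<Sum>\<^sub>\<infinity>k. f k z) has_derivative
    (\<lambda>h. fst h *\<^sub>R (\<Sum>\<^sub>\<infinity>k. partial_x (f k) z) + snd h *\<^sub>R (\<Sum>\<^sub>\<infinity>k. partial_y (f k) z))) (at z)"
proof -
  define X Y where "X w = (\<Sum>\<^sub>\<infinity>k. partial_x (f k) w)" and "Y w = (\<Sum>\<^sub>\<infinity>k. partial_y (f k) w)" for w
  define S where "S n g w = (\<Sum>k\<in>{- int n..int n}. g k w)" for n and g :: "int \<Rightarrow> fnM" and w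
  define SX SY where "SX n = S n (\<lambda>k. partial_x (f k))" and "SY n = S n (\<lambda>k. partial_y (f k))" for n
  let ?B = "ball z 1"
  have lim: "(\<lambda>n. S n f w) \<longlonglongrightarrow> (\<Sum>\<^sub>\<infinity>k. f k w)" for w
    unfolding S_def
    by (rule tendsto_uniform_limitI[OF loc_summable_uniform_limit_symmetric[OF s(1) compact_sing[of w]]])
      simp
  have "\<exists>g. \<forall>w\<in>?B. (\<lambda>n. S n f w) \<longlonglongrightarrow> g w \<and>
      (g has_derivative (\<lambda>h. fst h *\<^sub>R X w + snd h *\<^sub>R Y w)) (at w within ?B)"
  proof (rule has_derivative_sequence[where ?x0.0 = z and l = "\<Sum>\<^sub>\<infinity>k. f k z" and
        f = "\<lambda>n. S n f" and g' = "\<lambda>w h. fst h *\<^sub>R X w + snd h *\<^sub>R Y w" and S = ?B and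
        f' = "\<lambda>n w h. fst h *\<^sub>R SX n w + snd h *\<^sub>R SY n w"])
    show "(S n f has_derivative (\<lambda>h. fst h *\<^sub>R SX n w + snd h *\<^sub>R SY n w)) (at w within ?B)" for n w
    proof -
      have "((\<lambda>w. \<Sum>k\<in>{- int n..int n}. f k w) has_derivative (\<lambda>h. \<Sum>k\<in>{- int n..int n}.
          fst h *\<^sub>R partial_x (f k) w + snd h *\<^sub>R partial_y (f k) w)) (at w within ?B)"
        by (rule has_derivative_sum) (rule has_derivative_at_withinI[OF has_derivative_partial[OF d]])
      moreover have "S n f = (\<lambda>w. \<Sum>k\<in>{- int n..int n}. f k w)"
        by (simp add: S_def fun_eq_iff)
      ultimately show ?thesis
        by (simp add: S_def SX_def SY_def sum.distrib scaleR_sum_right)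
    qed
    show "(\<lambda>n. S n f z) \<longlonglongrightarrow> (\<Sum>\<^sub>\<infinity>k. f k z)"
      by (rule lim)
    fix \<epsilon> :: real assume \<epsilon>: "\<epsilon> > 0"
    then have "\<epsilon> / 2 > 0" by simp
    have "\<forall>\<^sub>F n in sequentially. \<forall>w\<in>cball z 1. dist (SX n w) (X w) < \<epsilon> / 2"
      using uniform_limitD[OF loc_summable_uniform_limit_symmetric[OF s(2) compact_cball[of z 1]] \<open>\<epsilon> / 2 > 0\<close>]
      unfolding SX_def S_def X_def .
    moreover have "\<forall>\<^sub>F n in sequentially. \<forall>w\<in>cball z 1. dist (SY n w) (Y w) < \<epsilon> / 2"
      using uniform_limitD[OF loc_summable_uniform_limit_symmetric[OF s(3) compact_cball[of z 1]] \<open>\<epsilon> / 2 > 0\<close>]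
      unfolding SY_def S_def Y_def .
    ultimately show "\<forall>\<^sub>F n in sequentially. \<forall>w\<in>?B. \<forall>h. norm
        (fst h *\<^sub>R SX n w + snd h *\<^sub>R SY n w - (fst h *\<^sub>R X w + snd h *\<^sub>R Y w)) \<le> \<epsilon> * norm h"
    proof (eventually_elim, intro ballI allI)
      fix n w and h :: "real \<times> real"
      assume *: "\<forall>w\<in>cball z 1. dist (SX n w) (X w) < \<epsilon> / 2"
        "\<forall>w\<in>cball z 1. dist (SY n w) (Y w) < \<epsilon> / 2" and w: "w \<in> ?B"
      have w': "w \<in> cball z 1"
        using w ball_subset_cball by blast
      let ?A = "SX n w - X w" and ?C = "SY n w - Y w"
      have AC: "norm ?A \<le> \<epsilon> / 2" "norm ?C \<le> \<epsilon> / 2"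
        using *[THEN bspec, OF w'] unfolding dist_norm by simp_all
      have h: "\<bar>fst h\<bar> \<le> norm h" "\<bar>snd h\<bar> \<le> norm h"
        using norm_fst_le[of "fst h" "snd h"] norm_snd_le[of "snd h" "fst h"] by simp_all
      have "norm (fst h *\<^sub>R ?A + snd h *\<^sub>R ?C) \<le> \<bar>fst h\<bar> * norm ?A + \<bar>snd h\<bar> * norm ?C"
        by (rule order_trans[OF norm_triangle_ineq]) simp
      also have "\<dots> \<le> norm h * (\<epsilon> / 2) + norm h * (\<epsilon> / 2)"
        by (rule add_mono[OF mult_mono[OF h(1) AC(1)] mult_mono[OF h(2) AC(2)]]) simp_all
      finally have "norm (fst h *\<^sub>R ?A + snd h *\<^sub>R ?C) \<le> \<epsilon> * norm h"
        by simp
      moreover have "fst h *\<^sub>R SX n w + snd h *\<^sub>R SY n w - (fst h *\<^sub>R X w + snd h *\<^sub>R Y w) =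
          fst h *\<^sub>R ?A + snd h *\<^sub>R ?C"
        by (simp add: scaleR_diff_right)
      ultimately show "norm (fst h *\<^sub>R SX n w + snd h *\<^sub>R SY n w -
          (fst h *\<^sub>R X w + snd h *\<^sub>R Y w)) \<le> \<epsilon> * norm h"
        by (simp only:)
    qed
  qed simp_all
  then obtain g where g: "\<forall>w\<in>?B. (\<lambda>n. S n f w) \<longlonglongrightarrow> g w \<and>
      (g has_derivative (\<lambda>h. fst h *\<^sub>R X w + snd h *\<^sub>R Y w)) (at w within ?B)"
    by (rule exE)
  have eq: "g w = (\<Sum>\<^sub>\<infinity>k. f k w)" if "w \<in> ?B" for w
    using LIMSEQ_unique[OF _ lim] bspec[OF g that] by simp
  have "(g has_derivative (\<lambda>h. fst h *\<^sub>R X z + snd h *\<^sub>R Y z)) (at z within ?B)"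
    using bspec[OF g, of z] by simp
  then have "(g has_derivative (\<lambda>h. fst h *\<^sub>R X z + snd h *\<^sub>R Y z)) (at z)"
    by (simp add: at_within_open[OF _ open_ball])
  then have "((\<lambda>z. \<Sum>\<^sub>\<infinity>k. f k z) has_derivative (\<lambda>h. fst h *\<^sub>R X z + snd h *\<^sub>R Y z)) (at z)"
    by (rule has_derivative_transform_within_open[OF _ open_ball[of z 1]]) (simp_all add: eq)
  then show ?thesis
    by (simp only: X_def Y_def)
qed

lemma partial_infsum:
  assumes "\<And>k z. f k differentiable (at z)"
    and "loc_summable f" "\<And>u. u \<in> Basis \<Longrightarrow> loc_summable (\<lambda>k. partial u (f k))"
    and "u \<in> Basis"
  shows "partial u (\<lambda>z. \<Sum>\<^sub>\<infinity>k. f k z) z = (\<Sum>\<^sub>\<infinity>k. partial u (f k) z)"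
    and "(\<lambda>z. \<Sum>\<^sub>\<infinity>k. f k z) differentiable (at z)"
proof -
  have *: "((\<lambda>z. \<Sum>\<^sub>\<infinity>k. f k z) has_derivative
    (\<lambda>h. fst h *\<^sub>R (\<Sum>\<^sub>\<infinity>k. partial_x (f k) z) + snd h *\<^sub>R (\<Sum>\<^sub>\<infinity>k. partial_y (f k) z))) (at z)"
    using assms by (intro has_derivative_infsum) (auto simp: Basis_plane)
  then show "(\<lambda>z. \<Sum>\<^sub>\<infinity>k. f k z) differentiable (at z)"
    by (rule differentiableI)
  show "partial u (\<lambda>z. \<Sum>\<^sub>\<infinity>k. f k z) z = (\<Sum>\<^sub>\<infinity>k. partial u (f k) z)"
    using assms(4) by (auto simp: partial_eqI[OF *] Basis_plane)
qed

text \<open>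
  Termwise differentiation to all orders: the class of sums of families with derivatives in \<open>Q1\<close> is
  closed under both partial derivatives, so coinduction applies.
\<close>

lemma derivs_in_infsum:
  assumes F: "derivs_in Q1 F"
    and s: "\<And>U i. Q1 U \<Longrightarrow> loc_summable (\<lambda>k. U (i, k))"
    and q: "\<And>U. Q1 U \<Longrightarrow> Q (\<lambda>i z. \<Sum>\<^sub>\<infinity>k. U (i, k) z)"
  shows "derivs_in Q (\<lambda>i z. \<Sum>\<^sub>\<infinity>k. F (i, k) z)"
proof -
  let ?S = "\<lambda>H. \<exists>U. derivs_in Q1 U \<and> H = (\<lambda>i z. \<Sum>\<^sub>\<infinity>k. U (i, k) z)"
  show ?thesis
  proof (rule derivs_in_coinduct[where S = ?S])
    show "?S (\<lambda>i z. \<Sum>\<^sub>\<infinity>k. F (i, k) z)"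
      using assms(1) by (intro exI[of _ F]) simp
    fix H assume "?S H"
    then obtain U where 1: "derivs_in Q1 U" "H = (\<lambda>i z. \<Sum>\<^sub>\<infinity>k. U (i, k) z)"
      by (elim exE conjE) (rule that)
    have d: "U i differentiable (at z)" for i z
      by (rule derivs_in_differentiable[OF 1(1)])
    have ls: "loc_summable (\<lambda>k. U (i, k))" for i
      by (rule s[OF derivs_in_base[OF 1(1)]])
    have ls': "loc_summable (\<lambda>k. partial u (U (i, k)))" if "u \<in> Basis" for i u
      using s[OF derivs_in_base[OF derivs_in_partial[OF 1(1) that]]] .
    have p: "partial u (H i) z = (\<Sum>\<^sub>\<infinity>k. partial u (U (i, k)) z)" "H i differentiable (at z)"
      if "u \<in> Basis" for u i z
      unfolding 1(2) using partial_infsum[OF d ls ls' that] by simp_all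
    have P: "\<exists>U'. derivs_in Q1 U' \<and> (\<lambda>i. partial u (H i)) = (\<lambda>i z. \<Sum>\<^sub>\<infinity>k. U' (i, k) z)"
      if "u \<in> Basis" for u
      using derivs_in_partial[OF 1(1) that] p(1)[OF that]
      by (intro exI[of _ "\<lambda>i. partial u (U i)"]) (simp add: fun_eq_iff)
    have QH: "Q H"
      unfolding 1(2) by (rule q[OF derivs_in_base[OF 1(1)]])
    have D: "H i differentiable (at z)" for i z
      using p(2)[of "(1,0)"] by (simp add: Basis_plane)
    show "(\<forall>i z. H i differentiable (at z)) \<and> Q H \<and> (\<forall>u \<in> Basis. ?S (\<lambda>i. partial u (H i)))"
      by (intro conjI allI ballI D QH P)
  qed
qed


section \<open>Growth conditions\<close>

text \<open>
  The bracket \<open>\<langle>t\<rangle>\<close>. Unlike \<open>\<bar>t\<bar>\<close> it is at least \<open>1\<close> and submultiplicative (\<open>jb_add\<close>), so that its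
  powers can be exchanged between factors of a product.
\<close>

definition jb :: "real \<Rightarrow> real" where
  "jb t = 1 + \<bar>t\<bar>"

lemma jb_ge_1 [simp]: "1 \<le> jb t"
  by (simp add: jb_def)

lemma jb_pos [simp]: "0 < jb t" "0 \<le> jb t"
  by (simp_all add: jb_def add_pos_nonneg)

lemma jb_minus [simp]: "jb (- t) = jb t"
  by (simp add: jb_def)

lemma jb_add: "jb (s + t) \<le> jb s * jb t"
proof -
  have "\<bar>s + t\<bar> \<le> \<bar>s\<bar> + \<bar>t\<bar>" by simp
  also have "1 + \<dots> \<le> (1 + \<bar>s\<bar>) * (1 + \<bar>t\<bar>)"
    by (simp add: algebra_simps)
  finally show ?thesis
    by (simp add: jb_def)
qed

lemma jb_diff: "jb (s - t) \<le> jb s * jb t"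
  using jb_add[of s "- t"] by simp

lemma jb_scale:
  assumes "a \<noteq> 0"
  shows "jb t \<le> (1 + 1 / \<bar>a\<bar>) * jb (a * t)"
proof -
  have "\<bar>t\<bar> = (1 / \<bar>a\<bar>) * \<bar>a * t\<bar>"
    using assms by (simp add: abs_mult)
  moreover have "0 \<le> 1 / \<bar>a\<bar>" "0 \<le> \<bar>a * t\<bar>"
    by simp_all
  ultimately show ?thesis
    unfolding jb_def by (simp add: algebra_simps)
qed

lemma wgt_jb: "wgt k = 1 / jb (of_int k) ^ 2"
  by (simp add: wgt_def jb_def)

lemma wgt_boundI:
  assumes "x * jb (of_int k) ^ 2 \<le> C"
  shows "x \<le> C * wgt k"
proof -
  have "0 < jb (of_int k) ^ 2"
    by (rule zero_less_power) simp
  from pos_le_divide_eq[OF this] assms show ?thesis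
    by (simp add: wgt_jb)
qed

lemma jb_power_le: "jb t ^ n \<le> 2 ^ n * (1 + \<bar>t\<bar> ^ n)"
proof (cases "\<bar>t\<bar> \<le> 1")
  case True
  then have "jb t ^ n \<le> 2 ^ n"
    by (intro power_mono) (simp_all add: jb_def)
  also have "\<dots> \<le> 2 ^ n * (1 + \<bar>t\<bar> ^ n)"
    by simp
  finally show ?thesis .
next
  case False
  then have "jb t ^ n \<le> (2 * \<bar>t\<bar>) ^ n"
    by (intro power_mono) (simp_all add: jb_def)
  also have "\<dots> \<le> 2 ^ n * (1 + \<bar>t\<bar> ^ n)"
    by (simp add: power_mult_distrib)
  finally show ?thesis .
qed

text \<open>
  The conditions below are meant as arguments of \<open>derivs_in\<close>. Those for a single function are
  stated for families over \<open>unit\<close> for this reason.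
\<close>

definition loc_rapid :: "('i \<Rightarrow> real) \<Rightarrow> ('i \<Rightarrow> fnM) \<Rightarrow> bool" where
  "loc_rapid \<rho> G \<longleftrightarrow>
     (\<forall>K. compact K \<longrightarrow> (\<forall>n. \<exists>C. \<forall>i. \<forall>z\<in>K. \<rho> i ^ n * norm (G i z) \<le> C))"

definition loc_moderate :: "('i \<Rightarrow> real) \<Rightarrow> ('i \<Rightarrow> fnM) \<Rightarrow> bool" where
  "loc_moderate \<rho> G \<longleftrightarrow>
     (\<forall>K. compact K \<longrightarrow> (\<exists>n C. \<forall>i. \<forall>z\<in>K. norm (G i z) \<le> C * \<rho> i ^ n))"

definition schwartz :: "(unit \<Rightarrow> fnM) \<Rightarrow> bool" where
  "schwartz G \<longleftrightarrow> (\<forall>n. \<exists>C. \<forall>z. jb (fst z) ^ n * norm (G () z) \<le> C)"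

definition slow :: "(unit \<Rightarrow> fnM) \<Rightarrow> bool" where
  "slow G \<longleftrightarrow> (\<exists>n C. \<forall>z. norm (G () z) \<le> C * jb (fst z) ^ n)"

lemma loc_rapidI:
  assumes "\<And>K n. compact K \<Longrightarrow> \<exists>C. \<forall>i. \<forall>z\<in>K. \<rho> i ^ n * norm (G i z) \<le> C"
  shows "loc_rapid \<rho> G"
  using assms by (simp add: loc_rapid_def)

lemma loc_rapidE:
  assumes "loc_rapid \<rho> G" "compact K"
  obtains C where "0 \<le> C" "\<And>i z. z \<in> K \<Longrightarrow> \<rho> i ^ n * norm (G i z) \<le> C"
proof -
  obtain C where C: "\<forall>i. \<forall>z\<in>K. \<rho> i ^ n * norm (G i z) \<le> C"
    using assms unfolding loc_rapid_def by meson
  show ?thesis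
  proof (rule that[of "max 0 C"])
    show "\<rho> i ^ n * norm (G i z) \<le> max 0 C" if "z \<in> K" for i z
      using C that by (auto intro: max.coboundedI2)
  qed simp
qed

lemma loc_moderateE:
  assumes "loc_moderate \<rho> G" "compact K" "\<And>i. 1 \<le> \<rho> i"
  obtains n C where "0 \<le> C" "\<And>i z. z \<in> K \<Longrightarrow> norm (G i z) \<le> C * \<rho> i ^ n"
proof -
  obtain n C where C: "\<forall>i. \<forall>z\<in>K. norm (G i z) \<le> C * \<rho> i ^ n"
    using assms unfolding loc_moderate_def by meson
  show ?thesis
  proof (rule that[of "max 0 C" n])
    show "norm (G i z) \<le> max 0 C * \<rho> i ^ n" if "z \<in> K" for i z
    proof -
      have "norm (G i z) \<le> C * \<rho> i ^ n"
        using C that by blast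
      also have "\<dots> \<le> max 0 C * \<rho> i ^ n"
        using assms(3)[of i] by (intro mult_right_mono) auto
      finally show ?thesis .
    qed
  qed simp
qed

lemma loc_rapid_add:
  assumes "loc_rapid \<rho> U" "loc_rapid \<rho> V" "\<And>i. 0 \<le> \<rho> i"
  shows "loc_rapid \<rho> (\<lambda>i z. U i z + V i z)"
proof (rule loc_rapidI)
  fix K :: "(real \<times> real) set" and n assume K: "compact K"
  obtain A where A: "\<And>i z. z \<in> K \<Longrightarrow> \<rho> i ^ n * norm (U i z) \<le> A"
    using loc_rapidE[OF assms(1) K] by metis
  obtain B where B: "\<And>i z. z \<in> K \<Longrightarrow> \<rho> i ^ n * norm (V i z) \<le> B"
    using loc_rapidE[OF assms(2) K] by metis
  have "\<rho> i ^ n * norm (U i z + V i z) \<le> A + B" if "z \<in> K" for i z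
  proof -
    have "\<rho> i ^ n * norm (U i z + V i z) \<le> \<rho> i ^ n * (norm (U i z) + norm (V i z))"
      by (intro mult_left_mono norm_triangle_ineq zero_le_power assms(3))
    also have "\<dots> \<le> A + B"
      using A[OF that, of i] B[OF that, of i] by (simp add: distrib_left)
    finally show ?thesis .
  qed
  then show "\<exists>C. \<forall>i. \<forall>z\<in>K. \<rho> i ^ n * norm (U i z + V i z) \<le> C"
    by (intro exI[of _ "A + B"]) simp
qed

lemma loc_rapid_mult:
  assumes "loc_rapid \<rho>1 U" "loc_rapid \<rho>2 V"
    and \<rho>: "\<And>i. 1 \<le> \<rho>1 i" "\<And>i. 1 \<le> \<rho>2 i" "\<And>i. 0 \<le> \<rho> i" "\<And>i. \<rho> i \<le> A * (\<rho>1 i * \<rho>2 i) ^ m"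
  shows "loc_rapid \<rho> (\<lambda>i z. U i z * V i z)"
proof (rule loc_rapidI)
  fix K :: "(real \<times> real) set" and n assume K: "compact K"
  obtain B where B: "0 \<le> B" "\<And>i z. z \<in> K \<Longrightarrow> \<rho>1 i ^ (m * n) * norm (U i z) \<le> B"
    using loc_rapidE[OF assms(1) K] by metis
  obtain C where C: "0 \<le> C" "\<And>i z. z \<in> K \<Longrightarrow> \<rho>2 i ^ (m * n) * norm (V i z) \<le> C"
    using loc_rapidE[OF assms(2) K] by metis
  have "\<rho> i ^ n * norm (U i z * V i z) \<le> \<bar>A\<bar> ^ n * (B * C)" if "z \<in> K" for i z
  proof -
    have pos: "0 \<le> \<rho>1 i" "0 \<le> \<rho>2 i"
      using \<rho>(1)[of i] \<rho>(2)[of i] by simp_all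
    have "\<rho> i \<le> \<bar>A\<bar> * (\<rho>1 i * \<rho>2 i) ^ m"
      by (rule order_trans[OF \<rho>(4)]) (simp add: mult_right_mono pos)
    then have "\<rho> i ^ n * norm (U i z * V i z) \<le> (\<bar>A\<bar> * (\<rho>1 i * \<rho>2 i) ^ m) ^ n * norm (U i z * V i z)"
      by (intro mult_right_mono power_mono \<rho>) simp_all
    also have "\<dots> = \<bar>A\<bar> ^ n * ((\<rho>1 i ^ (m * n) * norm (U i z)) * (\<rho>2 i ^ (m * n) * norm (V i z)))"
      by (simp add: power_mult_distrib power_mult norm_mult mult_ac)
    also have "\<dots> \<le> \<bar>A\<bar> ^ n * (B * C)"
      by (intro mult_left_mono mult_mono B C that) (simp_all add: pos)
    finally show ?thesis .
  qed
  then show "\<exists>C. \<forall>i. \<forall>z\<in>K. \<rho> i ^ n * norm (U i z * V i z) \<le> C"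
    by (intro exI[of _ "\<bar>A\<bar> ^ n * (B * C)"]) simp
qed

lemma loc_moderate_mult_rapid:
  assumes "loc_moderate \<rho> U" "loc_rapid \<rho> V" and \<rho>: "\<And>i. 1 \<le> \<rho> i"
  shows "loc_rapid \<rho> (\<lambda>i z. U i z * V i z)"
proof (rule loc_rapidI)
  fix K :: "(real \<times> real) set" and n assume K: "compact K"
  obtain m B where B: "0 \<le> B" "\<And>i z. z \<in> K \<Longrightarrow> norm (U i z) \<le> B * \<rho> i ^ m"
    using loc_moderateE[OF assms(1) K \<rho>] by metis
  obtain C where C: "0 \<le> C" "\<And>i z. z \<in> K \<Longrightarrow> \<rho> i ^ (m + n) * norm (V i z) \<le> C"
    using loc_rapidE[OF assms(2) K] by metis
  have "\<rho> i ^ n * norm (U i z * V i z) \<le> B * C" if "z \<in> K" for i z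
  proof -
    have pos: "0 \<le> \<rho> i"
      using \<rho>[of i] by simp
    have "\<rho> i ^ n * norm (U i z * V i z) \<le> \<rho> i ^ n * ((B * \<rho> i ^ m) * norm (V i z))"
      unfolding norm_mult by (intro mult_left_mono mult_right_mono B that) (simp_all add: pos)
    also have "\<dots> = B * (\<rho> i ^ (m + n) * norm (V i z))"
      by (simp add: power_add mult_ac)
    also have "\<dots> \<le> B * C"
      by (intro mult_left_mono C B that)
    finally show ?thesis .
  qed
  then show "\<exists>C. \<forall>i. \<forall>z\<in>K. \<rho> i ^ n * norm (U i z * V i z) \<le> C"
    by (intro exI[of _ "B * C"]) simp
qed

lemma loc_rapid_cnj: "loc_rapid \<rho> U \<Longrightarrow> loc_rapid \<rho> (\<lambda>i z. cnj (U i z))"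
  by (simp add: loc_rapid_def)

lemma loc_moderate_cnj: "loc_moderate \<rho> U \<Longrightarrow> loc_moderate \<rho> (\<lambda>i z. cnj (U i z))"
  by (simp add: loc_moderate_def)

lemma slow_mult_schwartz:
  assumes "slow U" "schwartz V"
  shows "schwartz (\<lambda>i z. U i z * V i z)"
  unfolding schwartz_def
proof
  fix n
  obtain m B where B: "\<forall>z. norm (U () z) \<le> B * jb (fst z) ^ m"
    using assms(1) unfolding slow_def by meson
  obtain C where C: "\<forall>z. jb (fst z) ^ (m + n) * norm (V () z) \<le> C"
    using assms(2) unfolding schwartz_def by meson
  have "jb (fst z) ^ n * norm (U () z * V () z) \<le> \<bar>B\<bar> * C" for z
  proof -
    have "norm (U () z) \<le> \<bar>B\<bar> * jb (fst z) ^ m"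
      by (rule order_trans[OF B[rule_format]]) (simp add: mult_right_mono)
    then have "jb (fst z) ^ n * norm (U () z * V () z) \<le>
        jb (fst z) ^ n * ((\<bar>B\<bar> * jb (fst z) ^ m) * norm (V () z))"
      unfolding norm_mult by (intro mult_left_mono mult_right_mono) simp_all
    also have "\<dots> = \<bar>B\<bar> * (jb (fst z) ^ (m + n) * norm (V () z))"
      by (simp add: power_add mult_ac)
    also have "\<dots> \<le> \<bar>B\<bar> * C"
      by (intro mult_left_mono C[rule_format]) simp_all
    finally show ?thesis .
  qed
  then show "\<exists>C. \<forall>z. jb (fst z) ^ n * norm (U () z * V () z) \<le> C"
    by (intro exI[of _ "\<bar>B\<bar> * C"]) simp
qed

lemma schwartz_add:
  assumes "schwartz U" "schwartz V"
  shows "schwartz (\<lambda>i z. U i z + V i z)"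
  unfolding schwartz_def
proof
  fix n
  obtain A where A: "\<forall>z. jb (fst z) ^ n * norm (U () z) \<le> A"
    using assms(1) unfolding schwartz_def by meson
  obtain B where B: "\<forall>z. jb (fst z) ^ n * norm (V () z) \<le> B"
    using assms(2) unfolding schwartz_def by meson
  have "jb (fst z) ^ n * norm (U () z + V () z) \<le> A + B" for z
  proof -
    have "jb (fst z) ^ n * norm (U () z + V () z) \<le> jb (fst z) ^ n * (norm (U () z) + norm (V () z))"
      by (intro mult_left_mono norm_triangle_ineq) simp
    also have "\<dots> \<le> A + B"
      using A[rule_format, of z] B[rule_format, of z] by (simp add: distrib_left)
    finally show ?thesis .
  qed
  then show "\<exists>C. \<forall>z. jb (fst z) ^ n * norm (U () z + V () z) \<le> C"
    by (intro exI[of _ "A + B"]) simp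
qed

lemma compact_fst_bound:
  assumes "compact (K :: (real \<times> real) set)"
  obtains M where "0 \<le> M" "\<And>z. z \<in> K \<Longrightarrow> \<bar>fst z\<bar> \<le> M"
proof -
  obtain M where M: "\<forall>z\<in>K. norm z \<le> M"
    using compact_imp_bounded[OF assms] unfolding bounded_iff by meson
  show ?thesis
  proof (rule that[of "max 0 M"])
    show "\<bar>fst z\<bar> \<le> max 0 M" if "z \<in> K" for z
      using M[rule_format, OF that] norm_fst_le[of "fst z" "snd z"] by simp
  qed simp
qed

lemma derivs_in_rapid_add:
  assumes "\<And>i. 0 \<le> \<rho> i" "derivs_in (loc_rapid \<rho>) F" "derivs_in (loc_rapid \<rho>) G"
  shows "derivs_in (loc_rapid \<rho>) (\<lambda>i z. F i z + G i z)"
  using assms(2,3) by (rule derivs_in_add) (rule loc_rapid_add[OF _ _ assms(1)])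

lemma derivs_in_rapid_mult:
  assumes "\<And>i. 1 \<le> \<rho>1 i" "\<And>i. 1 \<le> \<rho>2 i" "\<And>i. 0 \<le> \<rho> i" "\<And>i. \<rho> i \<le> A * (\<rho>1 i * \<rho>2 i) ^ m"
    and "derivs_in (loc_rapid \<rho>1) F" "derivs_in (loc_rapid \<rho>2) G"
  shows "derivs_in (loc_rapid \<rho>) (\<lambda>i z. F i z * G i z)"
  using assms(5,6)
  by (rule derivs_in_mult) (rule loc_rapid_mult[OF _ _ assms(1-4)] loc_rapid_add[OF _ _ assms(3)], assumption+)+

lemma derivs_in_moderate_mult_rapid:
  assumes "\<And>i. 1 \<le> \<rho> i" "derivs_in (loc_moderate \<rho>) F" "derivs_in (loc_rapid \<rho>) G"
  shows "derivs_in (loc_rapid \<rho>) (\<lambda>i z. F i z * G i z)"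
proof -
  have "0 \<le> \<rho> i" for i
    using order_trans[OF zero_le_one assms(1)] .
  with assms(2,3) show ?thesis
    by (intro derivs_in_mult[OF assms(2,3)])
      (rule loc_moderate_mult_rapid[OF _ _ assms(1)] loc_rapid_add, assumption+)+
qed

lemma derivs_in_rapid_cmult:
  assumes "\<And>i. 1 \<le> \<rho> i" "derivs_in (loc_rapid \<rho>) F"
  shows "derivs_in (loc_rapid \<rho>) (\<lambda>i z. a * F i z)"
proof (rule derivs_in_cmult[OF assms(2)])
  have "loc_moderate \<rho> (\<lambda>_ _. a)"
    unfolding loc_moderate_def by (intro allI impI exI[of _ 0] exI[of _ "norm a"]) simp
  then show "loc_rapid \<rho> (\<lambda>i z. a * U i z)" if "loc_rapid \<rho> U" for U
    using loc_moderate_mult_rapid[OF _ that assms(1)] by simp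
qed

text \<open>On a compact set, \<open>\<langle>a\<rangle> \<le> \<langle>x\<rangle>\<langle>x + a\<rangle>\<close> turns decay at \<open>x + a\<close> into decay in the shift \<open>a\<close>.\<close>

lemma schwartz_shift_rapid:
  assumes "schwartz U"
  shows "loc_rapid (\<lambda>j. jb (fst (a j))) (\<lambda>j z. U () (z + a j))"
proof (rule loc_rapidI)
  fix K :: "(real \<times> real) set" and n assume K: "compact K"
  obtain M where M: "0 \<le> M" "\<And>z. z \<in> K \<Longrightarrow> \<bar>fst z\<bar> \<le> M"
    using compact_fst_bound[OF K] by metis
  obtain C where C: "\<forall>z. jb (fst z) ^ n * norm (U () z) \<le> C"
    using assms(1) unfolding schwartz_def by meson
  have "jb (fst (a j)) ^ n * norm (U () (z + a j)) \<le> jb M ^ n * C" if "z \<in> K" for j z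
  proof -
    have "jb (fst (a j)) \<le> jb (fst (z + a j)) * jb (fst z)"
      using jb_diff[of "fst (z + a j)" "fst z"] by simp
    also have "\<dots> \<le> jb (fst (z + a j)) * jb M"
      using M(2)[OF that] M(1) by (intro mult_left_mono) (simp_all add: jb_def)
    finally have "jb (fst (a j)) ^ n * norm (U () (z + a j)) \<le>
        (jb (fst (z + a j)) * jb M) ^ n * norm (U () (z + a j))"
      by (intro mult_right_mono power_mono) simp_all
    also have "\<dots> = jb M ^ n * (jb (fst (z + a j)) ^ n * norm (U () (z + a j)))"
      by (simp only: power_mult_distrib mult_ac)
    also have "\<dots> \<le> jb M ^ n * C"
      by (intro mult_left_mono C[rule_format]) simp_all
    finally show ?thesis .
  qed
  then show "\<exists>C. \<forall>j. \<forall>z\<in>K. jb (fst (a j)) ^ n * norm (U () (z + a j)) \<le> C"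
    by (intro exI[of _ "jb M ^ n * C"]) simp
qed


subsection \<open>The phase functions\<close>

lemma norm_e [simp]: "norm (e t) = 1"
  by (simp add: e_def norm_exp_eq_Re)

lemma e_add: "e (s + t) = e s * e t"
  by (simp add: e_def exp_add distrib_left)

lemma e_minus: "e (- t) = cnj (e t)"
  by (simp add: e_def exp_cnj)

lemma e_cnj: "cnj (e t) * e t = 1" "e t * cnj (e t) = 1"
  by (simp_all add: e_add[symmetric] e_minus[symmetric]) (simp_all add: e_def)

lemma e_of_int [simp]: "e (of_int k) = 1"
  unfolding e_def by (simp add: exp_eq_1)

lemma e_of_int_add [simp]: "e (t + of_int k) = e t"
  by (simp add: e_add)

lemma has_derivative_phase:
  fixes z :: "real \<times> real"
  shows "((\<lambda>z. e (m * (snd z - b))) has_derivative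
     (\<lambda>h. 2 * of_real pi * \<i> * of_real (m * snd h) * e (m * (snd z - b)))) (at z)"
proof -
  let ?g = "\<lambda>z :: real \<times> real. 2 * of_real pi * \<i> * of_real (m * (snd z - b)) :: complex"
  have g: "(?g has_derivative (\<lambda>h. 2 * of_real pi * \<i> * of_real (m * snd h))) (at z)"
    by (auto intro!: derivative_eq_intros)
  have "(exp has_derivative (\<lambda>h. exp (?g z) * h)) (at (?g z))"
    using DERIV_exp[of "?g z"] by (simp add: has_field_derivative_def)
  from diff_chain_at[OF g this] show ?thesis
    by (simp add: o_def e_def mult_ac)
qed

lemma partial_phase:
  "partial_x (\<lambda>z. e (m * (snd z - b))) z = 0"
  "partial_y (\<lambda>z. e (m * (snd z - b))) z = 2 * of_real pi * \<i> * of_real m * e (m * (snd z - b))"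
  using partial_eqI[OF has_derivative_phase[of m b z]] by simp_all

lemma differentiable_phase: "(\<lambda>z. e (m * (snd z - b))) differentiable (at (z :: real \<times> real))"
  using has_derivative_phase by (rule differentiableI)

lemma derivs_in_phase:
  fixes m b :: "'a \<Rightarrow> real"
  assumes m: "\<And>i. \<bar>m i\<bar> \<le> A * \<rho> i ^ N"
  shows "derivs_in (loc_moderate \<rho>) (\<lambda>i z. e (m i * (snd z - b i)))"
proof -
  let ?S = "\<lambda>H :: 'a \<Rightarrow> fnM. \<exists>C n. H = (\<lambda>i z. C * of_real (m i ^ n) * e (m i * (snd z - b i)))"
  show ?thesis
  proof (rule derivs_in_coinduct[where S = ?S])
    show "?S (\<lambda>i z. e (m i * (snd z - b i)))"
      by (rule exI[of _ 1], rule exI[of _ 0]) simp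
    fix H :: "'a \<Rightarrow> fnM" assume "?S H"
    then obtain C n where H: "H = (\<lambda>i z. C * of_real (m i ^ n) * e (m i * (snd z - b i)))"
      by (elim exE) (rule that)
    have D: "H i differentiable (at z)" for i z
      unfolding H by (rule differentiable_mult[OF differentiable_const differentiable_phase])
    have P: "?S (\<lambda>i. partial u (H i))" if "u \<in> Basis" for u
    proof -
      have x: "partial_x (H i) z = 0" for i z
        unfolding H by (simp only: partial_cmult[OF differentiable_phase] partial_phase mult_zero_right)
      have y: "partial_y (H i) z = C * (2 * of_real pi * \<i>) * of_real (m i ^ Suc n) * e (m i * (snd z - b i))"
        for i z
        unfolding H by (simp add: partial_cmult[OF differentiable_phase] partial_phase)
      from that consider "u = (1, 0)" | "u = (0, 1)"
        by (auto simp: Basis_plane)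
      then show ?thesis
      proof cases
        case 1
        show ?thesis
          unfolding 1 by (rule exI[of _ 0], rule exI[of _ 0]) (simp add: x fun_eq_iff)
      next
        case 2
        show ?thesis
          unfolding 2 by (rule exI[of _ "C * (2 * of_real pi * \<i>)"], rule exI[of _ "Suc n"], intro ext y)
      qed
    qed
    have "loc_moderate \<rho> H"
      unfolding loc_moderate_def
    proof (intro allI impI exI ballI)
      fix K i and z :: "real \<times> real"
      have "norm (H i z) = norm C * \<bar>m i\<bar> ^ n"
        by (simp add: H norm_mult norm_power)
      also have "\<dots> \<le> norm C * (A * \<rho> i ^ N) ^ n"
        by (intro mult_left_mono power_mono m) simp_all
      also have "\<dots> = (norm C * A ^ n) * \<rho> i ^ (N * n)"
        by (simp add: power_mult_distrib power_mult)
      finally show "norm (H i z) \<le> (norm C * A ^ n) * \<rho> i ^ (N * n)" .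
    qed
    then show "(\<forall>i z. H i differentiable (at z)) \<and> loc_moderate \<rho> H \<and> (\<forall>u \<in> Basis. ?S (\<lambda>i. partial u (H i)))"
      by (intro conjI allI ballI D P)
  qed
qed

lemma partial_fst:
  fixes z :: "real \<times> real"
  shows
  "partial_x (\<lambda>z. a * of_real (fst z) + b) z = a"
  "partial_y (\<lambda>z. a * of_real (fst z) + b) z = 0"
  "(\<lambda>z. a * of_real (fst z) + b :: complex) differentiable (at z)"
proof -
  have *: "((\<lambda>z. a * of_real (fst z) + b) has_derivative (\<lambda>h. a * of_real (fst h))) (at z)"
    by (auto intro!: derivative_eq_intros)
  show "partial_x (\<lambda>z. a * of_real (fst z) + b) z = a"
    "partial_y (\<lambda>z. a * of_real (fst z) + b) z = 0"
    by (simp_all add: partial_eqI[OF *])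
  show "(\<lambda>z. a * of_real (fst z) + b) differentiable (at z)"
    using * by (rule differentiableI)
qed

lemma derivs_in_affine:
  fixes a b :: "'a \<Rightarrow> complex"
  assumes q: "\<And>c d. (\<And>i. c i = a i \<or> c i = 0) \<Longrightarrow> (\<And>i. d i = b i \<or> d i = a i \<or> d i = 0) \<Longrightarrow>
      Q (\<lambda>i z. c i * of_real (fst z) + d i)"
  shows "derivs_in Q (\<lambda>i z. a i * of_real (fst z) + b i)"
proof -
  let ?S = "\<lambda>H :: 'a \<Rightarrow> fnM. \<exists>c d. (\<forall>i. c i = a i \<or> c i = 0) \<and> (\<forall>i. d i = b i \<or> d i = a i \<or> d i = 0) \<and>
      H = (\<lambda>i z. c i * of_real (fst z) + d i)"
  show ?thesis
  proof (rule derivs_in_coinduct[where S = ?S])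
    show "?S (\<lambda>i z. a i * of_real (fst z) + b i)"
      by (rule exI[of _ a], rule exI[of _ b]) simp
    fix H :: "'a \<Rightarrow> fnM" assume "?S H"
    then obtain c d where cd: "\<forall>i. c i = a i \<or> c i = 0" "\<forall>i. d i = b i \<or> d i = a i \<or> d i = 0"
      and H: "H = (\<lambda>i z. c i * of_real (fst z) + d i)"
      by (elim exE conjE) (rule that)
    have D: "H i differentiable (at z)" for i z
      unfolding H by (rule partial_fst)
    have P: "?S (\<lambda>i. partial u (H i))" if "u \<in> Basis" for u
    proof -
      from that consider "u = (1, 0)" | "u = (0, 1)"
        by (auto simp: Basis_plane)
      then show ?thesis
      proof cases
        case 1
        show ?thesis
          unfolding 1 H partial_fst
          by (rule exI[of _ "\<lambda>_. 0"], rule exI[of _ c]) (use cd in \<open>auto simp: partial_fst fun_eq_iff\<close>)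
      next
        case 2
        show ?thesis
          unfolding 2 H
          by (rule exI[of _ "\<lambda>_. 0"], rule exI[of _ "\<lambda>_. 0"]) (simp add: partial_fst fun_eq_iff)
      qed
    qed
    have "Q H"
      unfolding H by (rule q) (use cd in auto)
    then show "(\<forall>i z. H i differentiable (at z)) \<and> Q H \<and> (\<forall>u \<in> Basis. ?S (\<lambda>i. partial u (H i)))"
      by (intro conjI allI ballI D P)
  qed
qed

lemma slow_affine: "derivs_in slow (\<lambda>_. \<lambda>z. a * of_real (fst z) + b)"
proof (rule derivs_in_affine)
  fix c d :: "unit \<Rightarrow> complex"
  have "norm (c () * of_real (fst z) + d ()) \<le> (norm (c ()) + norm (d ())) * jb (fst z) ^ 1" for z :: "real \<times> real"
  proof -
    have "norm (c () * of_real (fst z) + d ()) \<le> norm (c ()) * \<bar>fst z\<bar> + norm (d ())"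
      by (rule order_trans[OF norm_triangle_ineq]) (simp add: norm_mult)
    also have "\<dots> \<le> (norm (c ()) + norm (d ())) * jb (fst z) ^ 1"
      by (simp add: jb_def algebra_simps)
    finally show ?thesis .
  qed
  then show "slow (\<lambda>i z. c i * of_real (fst z) + d i)"
    unfolding slow_def by (intro exI[of _ 1] exI[of _ "norm (c ()) + norm (d ())"]) simp
qed


section \<open>The bimodule and the two algebras\<close>

lemma decay_iff:
  "(\<forall>n. \<exists>B. \<forall>j\<in>S. \<bar>t j\<bar> ^ n * norm (G j) \<le> B) \<longleftrightarrow> (\<forall>n. \<exists>C. \<forall>j\<in>S. jb (t j) ^ n * norm (G j) \<le> C)"
  (is "?L \<longleftrightarrow> ?R")
proof
  assume L: ?L
  show ?R
  proof
    fix n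
    obtain B0 where B0: "\<forall>j\<in>S. \<bar>t j\<bar> ^ 0 * norm (G j) \<le> B0"
      using L by meson
    obtain B where B: "\<forall>j\<in>S. \<bar>t j\<bar> ^ n * norm (G j) \<le> B"
      using L by meson
    have "jb (t j) ^ n * norm (G j) \<le> 2 ^ n * (B0 + B)" if "j \<in> S" for j
    proof -
      have "jb (t j) ^ n * norm (G j) \<le> (2 ^ n * (1 + \<bar>t j\<bar> ^ n)) * norm (G j)"
        by (intro mult_right_mono jb_power_le) simp
      also have "\<dots> = 2 ^ n * (\<bar>t j\<bar> ^ 0 * norm (G j) + \<bar>t j\<bar> ^ n * norm (G j))"
        by (simp add: algebra_simps)
      also have "\<dots> \<le> 2 ^ n * (B0 + B)"
        by (intro mult_left_mono add_mono B0[rule_format] B[rule_format] that) simp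
      finally show ?thesis .
    qed
    then show "\<exists>C. \<forall>j\<in>S. jb (t j) ^ n * norm (G j) \<le> C"
      by (intro exI[of _ "2 ^ n * (B0 + B)"]) simp
  qed
next
  assume R: ?R
  show ?L
  proof
    fix n
    obtain C where C: "\<forall>j\<in>S. jb (t j) ^ n * norm (G j) \<le> C"
      using R by meson
    have "\<bar>t j\<bar> ^ n * norm (G j) \<le> C" if "j \<in> S" for j
      by (rule order_trans[OF _ C[rule_format, OF that]], intro mult_right_mono power_mono)
        (simp_all add: jb_def)
    then show "\<exists>B. \<forall>j\<in>S. \<bar>t j\<bar> ^ n * norm (G j) \<le> B"
      by (intro exI[of _ C]) simp
  qed
qed

text \<open>
  Replacing \<open>\<bar>x\<bar>\<close> and \<open>\<bar>p\<bar>\<close> by brackets in the decay conditions turns membership in the module and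
  in the two algebras into statements about \<open>derivs_in\<close>.
\<close>

lemma Xi_iff: "f \<in> Xi \<longleftrightarrow> periodic_y f \<and> derivs_in schwartz (\<lambda>_. f)"
proof -
  have "(\<forall>n. \<exists>B. \<forall>x y. \<bar>x\<bar> ^ n * norm (g (x, y)) \<le> B) \<longleftrightarrow> schwartz (\<lambda>_. g)" for g :: fnM
    using decay_iff[of UNIV fst g] by (simp add: schwartz_def)
  then show ?thesis
    by (simp add: Xi_def derivs_in_def)
qed

lemma rapid_iff:
  "(\<forall>p. smooth (\<Phi> p)) \<and> rapidly_decreasing_Z \<Phi> \<longleftrightarrow> derivs_in (loc_rapid (\<lambda>p. jb (of_int p))) \<Phi>"
proof -
  have *: "(\<forall>(n::nat) K. compact K \<longrightarrow> (\<exists>B. \<forall>p. \<forall>z\<in>K. \<bar>of_int p\<bar> ^ n * norm (G p z) \<le> B)) \<longleftrightarrow>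
      loc_rapid (\<lambda>p. jb (of_int p)) G" for G :: fnMZ
  proof -
    have "(\<forall>n. \<exists>B. \<forall>p. \<forall>z\<in>K. \<bar>of_int p :: real\<bar> ^ n * norm (G p z) \<le> B) \<longleftrightarrow>
        (\<forall>n. \<exists>C. \<forall>p. \<forall>z\<in>K. jb (of_int p) ^ n * norm (G p z) \<le> C)" for K
      using decay_iff[of "UNIV \<times> K" "\<lambda>j. of_int (fst j)" "\<lambda>j. G (fst j) (snd j)"]
      by (simp add: Ball_def)
    then show ?thesis
      unfolding loc_rapid_def by meson
  qed
  show ?thesis
    unfolding rapidly_decreasing_Z_def derivs_in_def * by (rule refl)
qed

lemma D_alg_iff:
  "\<Phi> \<in> D_alg c \<nu> \<longleftrightarrow> (\<forall>p. periodic_y (\<Phi> p)) \<and> derivs_in (loc_rapid (\<lambda>p. jb (of_int p))) \<Phi> \<and>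
     (\<forall>k p x y. cnj (e (of_int (c * k * p) * (y - of_int p * \<nu>))) * \<Phi> p (x + of_int k, y) = \<Phi> p (x, y))"
  unfolding D_alg_def rapid_iff[symmetric] by blast

lemma E_alg_iff:
  "\<Psi> \<in> E_alg c \<mu> \<nu> \<longleftrightarrow> (\<forall>p. periodic_y (\<Psi> p)) \<and> derivs_in (loc_rapid (\<lambda>p. jb (of_int p))) \<Psi> \<and>
     (\<forall>k p x y. e (of_int (c * p * k) * (y - of_int k * \<nu>))
          * \<Psi> p (x - 2 * of_int k * \<mu>, y - 2 * of_int k * \<nu>) = \<Psi> p (x, y))"
  unfolding E_alg_def rapid_iff[symmetric] by blast

lemma Xi_smooth: "f \<in> Xi \<Longrightarrow> smooth f"
  by (simp add: Xi_def)

lemma Xi_differentiable: "f \<in> Xi \<Longrightarrow> f differentiable (at z)"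
  by (intro smooth_differentiable Xi_smooth)

lemma Xi_periodic: "f \<in> Xi \<Longrightarrow> f (x, y + 1) = f (x, y)"
  by (simp add: Xi_def periodic_y_def)

lemma periodic_partial:
  assumes "smooth f" "periodic_y f"
  shows "periodic_y (partial u f)"
  unfolding periodic_y_def
proof (intro allI)
  fix x y
  have "(\<lambda>z. f (z + (0, 1))) = f"
    using assms(2) by (simp add: periodic_y_def fun_eq_iff)
  then have "partial u f (x, y) = partial u (\<lambda>z. f (z + (0, 1))) (x, y)"
    by simp
  also have "\<dots> = partial u f ((x, y) + (0, 1))"
    by (rule partial_shift[OF smooth_differentiable[OF assms(1)]])
  finally show "partial u f (x, y + 1) = partial u f (x, y)"
    by simp
qed

lemma Xi_partial:
  assumes "f \<in> Xi" "u \<in> Basis"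
  shows "partial u f \<in> Xi"
  using assms derivs_in_partial[of schwartz "\<lambda>_. f" u] periodic_partial Xi_smooth
  unfolding Xi_iff by blast

lemma Xi_partial_x: "f \<in> Xi \<Longrightarrow> partial_x f \<in> Xi"
  and Xi_partial_y: "f \<in> Xi \<Longrightarrow> partial_y f \<in> Xi"
  by (simp_all add: Xi_partial x_Basis y_Basis)

lemma Xi_add:
  assumes "f \<in> Xi" "g \<in> Xi"
  shows "(\<lambda>z. f z + g z) \<in> Xi"
proof -
  have "derivs_in schwartz (\<lambda>_ :: unit. \<lambda>z. f z + g z)"
    by (rule derivs_in_add[of schwartz _ schwartz]) (use assms in \<open>simp_all add: Xi_iff schwartz_add\<close>)
  then show ?thesis
    using assms by (simp add: Xi_iff periodic_y_def)
qed

lemma Xi_slow_mult: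
  assumes "derivs_in slow (\<lambda>_. u)" "periodic_y u" "f \<in> Xi"
  shows "(\<lambda>z. u z * f z) \<in> Xi"
proof -
  have "derivs_in schwartz (\<lambda>_ :: unit. \<lambda>z. u z * f z)"
    by (rule derivs_in_mult[of slow _ schwartz])
      (use assms in \<open>simp_all add: Xi_iff schwartz_add slow_mult_schwartz\<close>)
  then show ?thesis
    using assms by (simp add: Xi_iff periodic_y_def)
qed

lemma Xi_affine_mult: "f \<in> Xi \<Longrightarrow> (\<lambda>z. (a * of_real (fst z) + b) * f z) \<in> Xi"
  by (rule Xi_slow_mult[OF slow_affine]) (simp_all add: periodic_y_def)

lemma Xi_cmult: "f \<in> Xi \<Longrightarrow> (\<lambda>z. a * f z) \<in> Xi"
  using Xi_affine_mult[of f 0 a] by simp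

lemma Xi_x_mult: "f \<in> Xi \<Longrightarrow> (\<lambda>z. of_real (fst z) * f z) \<in> Xi"
  using Xi_affine_mult[of f 1 0] by simp

lemma Xi_zero: "(\<lambda>z. 0) \<in> Xi"
proof -
  have "derivs_in schwartz (\<lambda>_ :: unit. \<lambda>z. 0)"
  proof (rule derivs_in_coinduct[where S = "\<lambda>H. H = (\<lambda>_ z. 0)"])
    fix F :: "unit \<Rightarrow> fnM" assume F: "F = (\<lambda>_ z. 0)"
    have "schwartz F"
      unfolding F schwartz_def by (intro allI exI[of _ 0]) simp
    then show "(\<forall>i z. F i differentiable (at z)) \<and> schwartz F \<and>
        (\<forall>u\<in>Basis. (\<lambda>i. partial u (F i)) = (\<lambda>_ z. 0))"
      by (simp add: F partial_def fun_eq_iff)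
  qed simp
  then show ?thesis
    by (simp add: Xi_iff periodic_y_def)
qed

lemma Xi_bounded:
  assumes "f \<in> Xi"
  obtains C where "0 \<le> C" "\<And>z. jb (fst z) ^ n * norm (f z) \<le> C"
proof -
  have "schwartz (\<lambda>_. f)"
    using assms derivs_in_base[of schwartz "\<lambda>_. f"] by (simp add: Xi_iff)
  then obtain C where C: "\<forall>z. jb (fst z) ^ n * norm (f z) \<le> C"
    unfolding schwartz_def by meson
  show ?thesis
  proof (rule that)
    show "0 \<le> C"
      by (rule order_trans[OF _ C[rule_format, of "(0, 0)"]]) simp
    show "jb (fst z) ^ n * norm (f z) \<le> C" for z
      by (rule C[rule_format])
  qed
qed

lemma Xi_shift_rapid:
  assumes "f \<in> Xi"
  shows "derivs_in (loc_rapid (\<lambda>j. jb (fst (a j)))) (\<lambda>j z. f (z + a j))"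
proof -
  have "derivs_in schwartz (\<lambda>_. f)"
    using assms by (simp add: Xi_iff)
  then show ?thesis
    by (rule derivs_in_shift) (rule schwartz_shift_rapid)
qed

lemma derivs_in_rapid_cnj:
  "derivs_in (loc_rapid \<rho>) F \<Longrightarrow> derivs_in (loc_rapid \<rho>) (\<lambda>i z. cnj (F i z))"
  by (erule derivs_in_cnj) (rule loc_rapid_cnj)

lemma derivs_in_moderate_cnj:
  "derivs_in (loc_moderate \<rho>) F \<Longrightarrow> derivs_in (loc_moderate \<rho>) (\<lambda>i z. cnj (F i z))"
  by (erule derivs_in_cnj) (rule loc_moderate_cnj)


subsection \<open>The summands of the inner products\<close>

definition term_R :: "int \<Rightarrow> real \<Rightarrow> real \<Rightarrow> fnM \<Rightarrow> fnM \<Rightarrow> int \<times> int \<Rightarrow> fnM" where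
  "term_R c \<mu> \<nu> f g i z =
     cnj (e (of_int (c * snd i * fst i) * (snd z - of_int (fst i) * \<nu>))) * f (z + (of_int (snd i), 0))
       * cnj (g (z + (of_int (snd i) - 2 * of_int (fst i) * \<mu>, - (2 * of_int (fst i) * \<nu>))))"

definition term_L :: "int \<Rightarrow> real \<Rightarrow> real \<Rightarrow> fnM \<Rightarrow> fnM \<Rightarrow> int \<times> int \<Rightarrow> fnM" where
  "term_L c \<mu> \<nu> f g i z =
     e (of_int (c * fst i * snd i) * (snd z - of_int (snd i) * \<nu>))
       * cnj (f (z + (- (2 * of_int (snd i) * \<mu>), - (2 * of_int (snd i) * \<nu>))))
       * g (z + (of_int (fst i) - 2 * of_int (snd i) * \<mu>, - (2 * of_int (snd i) * \<nu>)))"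

lemma inner_R_eq: "inner_R c \<mu> \<nu> f g p = (\<lambda>z. \<Sum>\<^sub>\<infinity>k. term_R c \<mu> \<nu> f g (p, k) z)"
  by (rule ext) (simp add: inner_R_def term_R_def case_prod_beta' algebra_simps plus_prod_def)

lemma inner_L_eq: "inner_L c \<mu> \<nu> f g p = (\<lambda>z. \<Sum>\<^sub>\<infinity>k. term_L c \<mu> \<nu> f g (p, k) z)"
  by (rule ext) (simp add: inner_L_def term_L_def case_prod_beta' algebra_simps plus_prod_def)

abbreviation jb2 :: "int \<times> int \<Rightarrow> real" where
  "jb2 i \<equiv> jb (of_int (fst i)) * jb (of_int (snd i))"

lemma jb2_ge_1: "1 \<le> jb2 i"
  using mult_mono[of 1 "jb (of_int (fst i))" 1 "jb (of_int (snd i))"] by simp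

lemma derivs_in_phase2:
  "derivs_in (loc_moderate jb2) (\<lambda>i z. e (of_int (c * fst i * snd i) * (snd z - b i)))"
proof (rule derivs_in_phase)
  fix i :: "int \<times> int"
  have "\<bar>of_int (c * fst i * snd i) :: real\<bar> = \<bar>of_int c\<bar> * (\<bar>of_int (fst i)\<bar> * \<bar>of_int (snd i)\<bar>)"
    by (simp add: abs_mult)
  also have "\<dots> \<le> \<bar>of_int c\<bar> * jb2 i ^ 1"
    by (intro mult_left_mono) (simp_all add: jb_def mult_mono)
  finally show "\<bar>of_int (c * fst i * snd i) :: real\<bar> \<le> \<bar>of_int c\<bar> * jb2 i ^ 1" .
qed

text \<open>
  Both inner products are sums over \<open>k\<close> of products of a phase with two Schwartz functions. One of
  these decays in one linear form in \<open>(p, k)\<close> and the other one in a second, independent linear form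
  (this uses \<open>\<mu> \<noteq> 0\<close>), so together they decay in \<open>(p, k)\<close>.
\<close>

lemma term_R_rapid:
  assumes "f \<in> Xi" "g \<in> Xi" "\<mu> \<noteq> 0"
  shows "derivs_in (loc_rapid jb2) (term_R c \<mu> \<nu> f g)"
proof -
  let ?a = "\<lambda>i :: int \<times> int. (of_int (snd i) :: real, 0 :: real)"
  let ?b = "\<lambda>i :: int \<times> int. (of_int (snd i) - 2 * of_int (fst i) * \<mu>, - (2 * of_int (fst i) * \<nu>))"
  have F: "derivs_in (loc_rapid (\<lambda>i. jb (fst (?a i)))) (\<lambda>i z. f (z + ?a i))"
    by (rule Xi_shift_rapid[OF assms(1)])
  have G: "derivs_in (loc_rapid (\<lambda>i. jb (fst (?b i)))) (\<lambda>i z. cnj (g (z + ?b i)))"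
    by (rule derivs_in_rapid_cnj[OF Xi_shift_rapid[OF assms(2)]])
  have bound: "jb2 i \<le> (1 + 1 / \<bar>2 * \<mu>\<bar>) * (jb (fst (?a i)) * jb (fst (?b i))) ^ 2" for i
  proof -
    let ?A = "1 + 1 / \<bar>2 * \<mu>\<bar>" and ?s = "jb (fst (?a i))" and ?t = "jb (fst (?b i))"
    have A: "0 \<le> ?A" by simp
    have "jb (of_int (fst i)) \<le> ?A * jb (2 * \<mu> * of_int (fst i))"
      using assms(3) by (intro jb_scale) simp
    also have "\<dots> \<le> ?A * (?s * ?t)"
      using jb_diff[of "fst (?a i)" "fst (?b i)"] by (intro mult_left_mono A) (simp add: mult.commute mult.left_commute)
    finally have 1: "jb (of_int (fst i)) \<le> ?A * (?s * ?t)" .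
    have "jb (of_int (snd i)) = ?s * 1" by simp
    also have "\<dots> \<le> ?s * ?t"
      by (intro mult_left_mono) simp_all
    finally have 2: "jb (of_int (snd i)) \<le> ?s * ?t" .
    have "jb2 i \<le> (?A * (?s * ?t)) * (?s * ?t)"
      by (intro mult_mono 1 2) (simp_all add: A)
    then show ?thesis
      by (simp only: power2_eq_square mult.assoc)
  qed
  have FG: "derivs_in (loc_rapid jb2) (\<lambda>i z. f (z + ?a i) * cnj (g (z + ?b i)))"
    by (rule derivs_in_rapid_mult[OF _ _ _ bound F G]) simp_all
  have P: "derivs_in (loc_moderate jb2)
      (\<lambda>i z. cnj (e (of_int (c * fst i * snd i) * (snd z - of_int (fst i) * \<nu>))))"
    by (rule derivs_in_moderate_cnj[OF derivs_in_phase2])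
  have "derivs_in (loc_rapid jb2) (\<lambda>i z. cnj (e (of_int (c * fst i * snd i) * (snd z - of_int (fst i) * \<nu>)))
      * (f (z + ?a i) * cnj (g (z + ?b i))))"
    by (rule derivs_in_moderate_mult_rapid[OF jb2_ge_1 P FG])
  moreover have "term_R c \<mu> \<nu> f g = (\<lambda>i z. cnj (e (of_int (c * fst i * snd i) * (snd z - of_int (fst i) * \<nu>)))
      * (f (z + ?a i) * cnj (g (z + ?b i))))"
    by (intro ext) (simp only: term_R_def mult.assoc mult.commute[of "snd _" "fst _"])
  ultimately show ?thesis
    by (simp only:)
qed

lemma term_L_rapid:
  assumes "f \<in> Xi" "g \<in> Xi" "\<mu> \<noteq> 0"
  shows "derivs_in (loc_rapid jb2) (term_L c \<mu> \<nu> f g)"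
proof -
  let ?a = "\<lambda>i :: int \<times> int. (- (2 * of_int (snd i) * \<mu>), - (2 * of_int (snd i) * \<nu>))"
  let ?b = "\<lambda>i :: int \<times> int. (of_int (fst i) - 2 * of_int (snd i) * \<mu>, - (2 * of_int (snd i) * \<nu>))"
  have F: "derivs_in (loc_rapid (\<lambda>i. jb (fst (?a i)))) (\<lambda>i z. cnj (f (z + ?a i)))"
    by (rule derivs_in_rapid_cnj[OF Xi_shift_rapid[OF assms(1)]])
  have G: "derivs_in (loc_rapid (\<lambda>i. jb (fst (?b i)))) (\<lambda>i z. g (z + ?b i))"
    by (rule Xi_shift_rapid[OF assms(2)])
  have bound: "jb2 i \<le> (1 + 1 / \<bar>2 * \<mu>\<bar>) * (jb (fst (?a i)) * jb (fst (?b i))) ^ 2" for i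
  proof -
    let ?A = "1 + 1 / \<bar>2 * \<mu>\<bar>" and ?s = "jb (fst (?a i))" and ?t = "jb (fst (?b i))"
    have A: "0 \<le> ?A" by simp
    have "jb (of_int (snd i)) \<le> ?A * jb (2 * \<mu> * of_int (snd i))"
      using assms(3) by (intro jb_scale) simp
    also have "\<dots> = ?A * (?s * 1)"
      by (simp add: mult.commute mult.left_commute)
    also have "\<dots> \<le> ?A * (?s * ?t)"
      by (intro mult_left_mono A) simp_all
    finally have 1: "jb (of_int (snd i)) \<le> ?A * (?s * ?t)" .
    have 2: "jb (of_int (fst i)) \<le> ?s * ?t"
      using jb_diff[of "fst (?b i)" "fst (?a i)"] by (simp add: mult.commute)
    have "jb2 i \<le> (?s * ?t) * (?A * (?s * ?t))"
      by (intro mult_mono 1 2) simp_all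
    then show ?thesis
      by (simp only: power2_eq_square mult_ac)
  qed
  have FG: "derivs_in (loc_rapid jb2) (\<lambda>i z. cnj (f (z + ?a i)) * g (z + ?b i))"
    by (rule derivs_in_rapid_mult[OF _ _ _ bound F G]) simp_all
  have "derivs_in (loc_rapid jb2) (\<lambda>i z. e (of_int (c * fst i * snd i) * (snd z - of_int (snd i) * \<nu>))
      * (cnj (f (z + ?a i)) * g (z + ?b i)))"
    by (rule derivs_in_moderate_mult_rapid[OF jb2_ge_1 derivs_in_phase2 FG])
  moreover have "term_L c \<mu> \<nu> f g = (\<lambda>i z. e (of_int (c * fst i * snd i) * (snd z - of_int (snd i) * \<nu>))
      * (cnj (f (z + ?a i)) * g (z + ?b i)))"
    by (intro ext) (simp only: term_L_def mult.assoc)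
  ultimately show ?thesis
    by (simp only:)
qed

lemma jb2_wgt:
  assumes "jb2 (p, k) ^ (n + 2) * norm w \<le> C"
  shows "jb (of_int p) ^ n * norm w \<le> C * wgt k"
proof -
  have "jb (of_int p) ^ n * jb (of_int k) ^ 2 \<le> jb (of_int p) ^ (n + 2) * jb (of_int k) ^ (n + 2)"
    by (intro mult_mono power_increasing) simp_all
  then have "jb (of_int p) ^ n * jb (of_int k) ^ 2 \<le> jb2 (p, k) ^ (n + 2)"
    by (simp only: power_mult_distrib fst_conv snd_conv)
  then have "(jb (of_int p) ^ n * jb (of_int k) ^ 2) * norm w \<le> jb2 (p, k) ^ (n + 2) * norm w"
    by (rule mult_right_mono) simp
  also have "\<dots> \<le> C" by (rule assms)
  finally have "(jb (of_int p) ^ n * norm w) * jb (of_int k) ^ 2 \<le> C"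
    by (simp only: mult_ac)
  then show ?thesis
    by (rule wgt_boundI)
qed

lemma loc_rapid2_summable:
  assumes "loc_rapid jb2 U"
  shows "loc_summable (\<lambda>k. U (p, k))"
  unfolding loc_summable_def
proof (intro allI impI)
  fix K :: "(real \<times> real) set" assume K: "compact K"
  obtain C where C: "\<And>i z. z \<in> K \<Longrightarrow> jb2 i ^ (0 + 2) * norm (U i z) \<le> C"
    using loc_rapidE[OF assms K] by metis
  have "norm (U (p, k) z) \<le> C * wgt k" if "z \<in> K" for k z
    using jb2_wgt[OF C[OF that, of "(p, k)"]] by simp
  then show "\<exists>C. \<forall>k. \<forall>z\<in>K. norm (U (p, k) z) \<le> C * wgt k"
    by (intro exI[of _ C]) simp
qed

lemma loc_rapid2_infsum:
  assumes "loc_rapid jb2 U"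
  shows "loc_rapid (\<lambda>p. jb (of_int p)) (\<lambda>p z. \<Sum>\<^sub>\<infinity>k. U (p, k) z)"
proof (rule loc_rapidI)
  fix K :: "(real \<times> real) set" and n assume K: "compact K"
  obtain C where C: "\<And>i z. z \<in> K \<Longrightarrow> jb2 i ^ (n + 2) * norm (U i z) \<le> C"
    using loc_rapidE[OF assms K] by metis
  have "jb (of_int p) ^ n * norm (\<Sum>\<^sub>\<infinity>k. U (p, k) z) \<le> C * (\<Sum>\<^sub>\<infinity>k. wgt k)" if "z \<in> K" for p z
  proof -
    have "norm (\<Sum>\<^sub>\<infinity>k. of_real (jb (of_int p) ^ n) * U (p, k) z) \<le> C * (\<Sum>\<^sub>\<infinity>k. wgt k)"
    proof (rule norm_infsum_by_wgt)
      fix k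
      show "norm (of_real (jb (of_int p) ^ n) * U (p, k) z) \<le> C * wgt k"
        using jb2_wgt[OF C[OF that, of "(p, k)"]] by (simp add: norm_mult norm_power)
    qed
    then show ?thesis
      by (simp only: infsum_cmult_right' norm_mult norm_of_real) simp
  qed
  then show "\<exists>C. \<forall>p. \<forall>z\<in>K. jb (of_int p) ^ n * norm (\<Sum>\<^sub>\<infinity>k. U (p, k) z) \<le> C"
    by (intro exI[of _ "C * (\<Sum>\<^sub>\<infinity>k. wgt k)"]) simp
qed

lemma infsum_shift_int: "(\<Sum>\<^sub>\<infinity>k::int. F (k + m)) = (\<Sum>\<^sub>\<infinity>k. F k)"
  by (rule infsum_reindex_bij_betw) (rule bij_betw_byWitness[where f' = "\<lambda>k. k - m"], auto)

lemma infsum_minus_int: "(\<Sum>\<^sub>\<infinity>k::int. F (- k)) = (\<Sum>\<^sub>\<infinity>k. F k)"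
  by (rule infsum_reindex_bij_betw) (rule bij_betw_byWitness[where f' = "\<lambda>k. - k"], auto)

lemma phase_periodic: "e (of_int m * (y + 1 - b)) = e (of_int m * (y - b))"
proof -
  have "of_int m * (y + 1 - b) = of_int m * (y - b) + of_int m"
    by (simp add: algebra_simps)
  then show ?thesis
    by (simp only: e_of_int_add)
qed

theorem inner_R_in_D_alg:
  assumes "f \<in> Xi" "g \<in> Xi" "\<mu> \<noteq> 0"
  shows "inner_R c \<mu> \<nu> f g \<in> D_alg c \<nu>"
  unfolding D_alg_iff
proof (intro conjI allI)
  have eq: "inner_R c \<mu> \<nu> f g = (\<lambda>p z. \<Sum>\<^sub>\<infinity>k. term_R c \<mu> \<nu> f g (p, k) z)"
    by (rule ext) (rule inner_R_eq)
  show "derivs_in (loc_rapid (\<lambda>p. jb (of_int p))) (inner_R c \<mu> \<nu> f g)"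
    unfolding eq using term_R_rapid[OF assms]
    by (rule derivs_in_infsum) (rule loc_rapid2_summable loc_rapid2_infsum, assumption)+
  show "periodic_y (inner_R c \<mu> \<nu> f g p)" for p
  proof -
    have "term_R c \<mu> \<nu> f g (p, k) (x, y + 1) = term_R c \<mu> \<nu> f g (p, k) (x, y)" for k x y
      using Xi_periodic[OF assms(1), of "x + of_int k" y]
        Xi_periodic[OF assms(2), of "x + (of_int k - 2 * of_int p * \<mu>)" "y - 2 * of_int p * \<nu>"]
      by (simp only: term_R_def fst_conv snd_conv phase_periodic add_Pair) (simp add: algebra_simps)
    then show ?thesis
      unfolding inner_R_eq periodic_y_def by simp
  qed
  fix k p x y
  have "cnj (e (of_int (c * k * p) * (y - of_int p * \<nu>))) * term_R c \<mu> \<nu> f g (p, j) (x + of_int k, y) =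
      term_R c \<mu> \<nu> f g (p, j + k) (x, y)" for j
  proof -
    have "of_int (c * (j + k) * p) * (y - of_int p * \<nu>) =
        of_int (c * k * p) * (y - of_int p * \<nu>) + of_int (c * j * p) * (y - of_int p * \<nu>)"
      by (simp add: algebra_simps)
    then have "e (of_int (c * (j + k) * p) * (y - of_int p * \<nu>)) =
        e (of_int (c * k * p) * (y - of_int p * \<nu>)) * e (of_int (c * j * p) * (y - of_int p * \<nu>))"
      by (simp only: e_add)
    then show ?thesis
      by (simp add: term_R_def add.assoc add.commute[of "of_int k"] add_diff_eq)
  qed
  then show "cnj (e (of_int (c * k * p) * (y - of_int p * \<nu>))) * inner_R c \<mu> \<nu> f g p (x + of_int k, y) =
      inner_R c \<mu> \<nu> f g p (x, y)"
    unfolding inner_R_eq infsum_cmult_right'[symmetric]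
    using infsum_shift_int[of "\<lambda>j. term_R c \<mu> \<nu> f g (p, j) (x, y)" k] by (simp only:)
qed

theorem inner_L_in_E_alg:
  assumes "f \<in> Xi" "g \<in> Xi" "\<mu> \<noteq> 0"
  shows "inner_L c \<mu> \<nu> f g \<in> E_alg c \<mu> \<nu>"
  unfolding E_alg_iff
proof (intro conjI allI)
  have eq: "inner_L c \<mu> \<nu> f g = (\<lambda>p z. \<Sum>\<^sub>\<infinity>k. term_L c \<mu> \<nu> f g (p, k) z)"
    by (rule ext) (rule inner_L_eq)
  show "derivs_in (loc_rapid (\<lambda>p. jb (of_int p))) (inner_L c \<mu> \<nu> f g)"
    unfolding eq using term_L_rapid[OF assms]
    by (rule derivs_in_infsum) (rule loc_rapid2_summable loc_rapid2_infsum, assumption)+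
  show "periodic_y (inner_L c \<mu> \<nu> f g p)" for p
  proof -
    have "term_L c \<mu> \<nu> f g (p, k) (x, y + 1) = term_L c \<mu> \<nu> f g (p, k) (x, y)" for k x y
      using Xi_periodic[OF assms(1), of "x - 2 * of_int k * \<mu>" "y - 2 * of_int k * \<nu>"]
        Xi_periodic[OF assms(2), of "x + (of_int p - 2 * of_int k * \<mu>)" "y - 2 * of_int k * \<nu>"]
      by (simp only: term_L_def fst_conv snd_conv phase_periodic add_Pair) (simp add: algebra_simps)
    then show ?thesis
      unfolding inner_L_eq periodic_y_def by simp
  qed
  fix k p x y
  have "e (of_int (c * p * k) * (y - of_int k * \<nu>)) *
      term_L c \<mu> \<nu> f g (p, j) (x - 2 * of_int k * \<mu>, y - 2 * of_int k * \<nu>) =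
      term_L c \<mu> \<nu> f g (p, j + k) (x, y)" for j
  proof -
    have "of_int (c * p * (j + k)) * (y - of_int (j + k) * \<nu>) =
        of_int (c * p * k) * (y - of_int k * \<nu>) + of_int (c * p * j) * (y - 2 * of_int k * \<nu> - of_int j * \<nu>)"
      by (simp add: algebra_simps)
    then have ph: "e (of_int (c * p * (j + k)) * (y - of_int (j + k) * \<nu>)) =
        e (of_int (c * p * k) * (y - of_int k * \<nu>)) * e (of_int (c * p * j) * (y - 2 * of_int k * \<nu> - of_int j * \<nu>))"
      by (simp only: e_add)
    have arg: "(x - 2 * of_int k * \<mu>, y - 2 * of_int k * \<nu>) + (- (2 * of_int j * \<mu>), - (2 * of_int j * \<nu>)) =
        (x, y) + (- (2 * of_int (j + k) * \<mu>), - (2 * of_int (j + k) * \<nu>))"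
      "(x - 2 * of_int k * \<mu>, y - 2 * of_int k * \<nu>) + (of_int p - 2 * of_int j * \<mu>, - (2 * of_int j * \<nu>)) =
        (x, y) + (of_int p - 2 * of_int (j + k) * \<mu>, - (2 * of_int (j + k) * \<nu>))"
      by (simp_all add: algebra_simps)
    show ?thesis
      unfolding term_L_def fst_conv snd_conv arg ph by (simp only: mult.assoc)
  qed
  then show "e (of_int (c * p * k) * (y - of_int k * \<nu>)) *
      inner_L c \<mu> \<nu> f g p (x - 2 * of_int k * \<mu>, y - 2 * of_int k * \<nu>) = inner_L c \<mu> \<nu> f g p (x, y)"
    unfolding inner_L_eq infsum_cmult_right'[symmetric]
    using infsum_shift_int[of "\<lambda>j. term_L c \<mu> \<nu> f g (p, j) (x, y)" k] by (simp only:)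
qed

lemma inner_R_partial:
  assumes "f \<in> Xi" "g \<in> Xi" "\<mu> \<noteq> 0" "u \<in> Basis"
  shows "partial u (inner_R c \<mu> \<nu> f g p) z = (\<Sum>\<^sub>\<infinity>k. partial u (term_R c \<mu> \<nu> f g (p, k)) z)"
  unfolding inner_R_eq
proof (rule partial_infsum(1)[OF _ _ _ assms(4)])
  note T = term_R_rapid[OF assms(1-3), of c \<nu>]
  show "term_R c \<mu> \<nu> f g (p, k) differentiable (at z)" for k z
    by (rule derivs_in_differentiable[OF T])
  show "loc_summable (\<lambda>k. term_R c \<mu> \<nu> f g (p, k))"
    by (rule loc_rapid2_summable[OF derivs_in_base[OF T]])
  show "loc_summable (\<lambda>k. partial u (term_R c \<mu> \<nu> f g (p, k)))" if "u \<in> Basis" for u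
    by (rule loc_rapid2_summable[OF derivs_in_base[OF derivs_in_partial[OF T that]]])
qed

lemma inner_R_summable:
  assumes "f \<in> Xi" "g \<in> Xi" "\<mu> \<noteq> 0"
  shows "(\<lambda>k. term_R c \<mu> \<nu> f g (p, k) z) summable_on UNIV"
  by (rule loc_summable_summable[OF loc_rapid2_summable[OF derivs_in_base[OF term_R_rapid[OF assms]]]])


section \<open>The right action and the reference connection\<close>

lemma periodic_y_int:
  assumes "periodic_y f"
  shows "f (x, y + of_int m) = f (x, y)"
proof -
  have n: "f (x, y + real n) = f (x, y)" for n y
  proof (induction n)
    case (Suc n)
    have "f (x, y + real (Suc n)) = f (x, (y + real n) + 1)"
      by (simp add: algebra_simps)
    also have "\<dots> = f (x, y + real n)"
      using assms unfolding periodic_y_def by blast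
    finally show ?case
      by (simp only: Suc)
  qed simp
  show ?thesis
  proof (cases m rule: int_cases2)
    case (nonneg k)
    then show ?thesis using n[of y k] by simp
  next
    case (nonpos k)
    then show ?thesis using n[of "y + of_int m" k] by simp
  qed
qed

lemma periodic_y_floor: "periodic_y f \<Longrightarrow> f (x, y) = f (x, y - of_int \<lfloor>y\<rfloor>)"
  using periodic_y_int[of f x y "- \<lfloor>y\<rfloor>"] by simp

lemma floor_in_unit: "x - of_int \<lfloor>x\<rfloor> \<in> {0..1 :: real}"
  unfolding atLeastAtMost_iff by linarith

definition unit_square :: "(real \<times> real) set" where
  "unit_square = cbox (0, 0) (1, 1)"

lemma compact_unit_square: "compact unit_square"
  by (simp add: unit_square_def)

lemma in_unit_square: "(x - of_int \<lfloor>x\<rfloor>, y - of_int \<lfloor>y\<rfloor>) \<in> unit_square"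
  using floor_in_unit[of x] floor_in_unit[of y] by (simp add: unit_square_def cbox_Pair_eq)

lemma jb_floor: "\<bar>of_int \<lfloor>x\<rfloor>\<bar> \<le> jb x"
  unfolding jb_def by linarith

lemma D_alg_phase:
  assumes "\<Phi> \<in> D_alg c \<nu>"
  shows "\<Phi> p = (\<lambda>z. cnj (e (of_int (c * k * p) * (snd z - of_int p * \<nu>))) * \<Phi> p (z + (of_int k, 0)))"
proof
  fix z :: "real \<times> real"
  show "\<Phi> p z = cnj (e (of_int (c * k * p) * (snd z - of_int p * \<nu>))) * \<Phi> p (z + (of_int k, 0))"
    using assms unfolding D_alg_iff by (cases z) simp
qed

lemma D_alg_derivs: "\<Phi> \<in> D_alg c \<nu> \<Longrightarrow> derivs_in (loc_rapid (\<lambda>p. jb (of_int p))) \<Phi>"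
  by (simp add: D_alg_iff)

lemma D_alg_partial_phase:
  assumes "\<Phi> \<in> D_alg c \<nu>"
  shows "partial_x (\<Phi> p) z =
      cnj (e (of_int (c * k * p) * (snd z - of_int p * \<nu>))) * partial_x (\<Phi> p) (z + (of_int k, 0))"
    and "partial_y (\<Phi> p) z = cnj (e (of_int (c * k * p) * (snd z - of_int p * \<nu>))) *
      (partial_y (\<Phi> p) (z + (of_int k, 0)) -
       2 * of_real pi * \<i> * of_int (c * k * p) * \<Phi> p (z + (of_int k, 0)))"
proof -
  let ?ph = "\<lambda>z. e (of_int (c * k * p) * (snd z - of_int p * \<nu>))"
  let ?F = "\<lambda>z. \<Phi> p (z + (of_int k, 0))"
  have d: "\<Phi> p differentiable (at w)" for w
    by (rule derivs_in_differentiable[OF D_alg_derivs[OF assms]])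
  have dp: "(\<lambda>z. cnj (?ph z)) differentiable (at z)"
    by (rule differentiable_cnj[OF differentiable_phase])
  have *: "partial u (\<Phi> p) z = cnj (partial u ?ph z) * ?F z + cnj (?ph z) * partial u (\<Phi> p) (z + (of_int k, 0))"
    for u
  proof -
    have "partial u (\<Phi> p) z = partial u (\<lambda>z. cnj (?ph z) * ?F z) z"
      using D_alg_phase[OF assms, of p k] by simp
    also have "\<dots> = partial u (\<lambda>z. cnj (?ph z)) z * ?F z + cnj (?ph z) * partial u ?F z"
      by (rule partial_mult[OF dp differentiable_shift[OF d]])
    also have "partial u (\<lambda>z. cnj (?ph z)) z = cnj (partial u ?ph z)"
      by (rule partial_cnj[OF differentiable_phase])
    also have "partial u ?F z = partial u (\<Phi> p) (z + (of_int k, 0))"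
      by (rule partial_shift[OF d])
    finally show ?thesis .
  qed
  show "partial_x (\<Phi> p) z = cnj (?ph z) * partial_x (\<Phi> p) (z + (of_int k, 0))"
    using *[of "(1, 0)"] unfolding partial_phase by simp
  show "partial_y (\<Phi> p) z = cnj (?ph z) * (partial_y (\<Phi> p) (z + (of_int k, 0)) -
      2 * of_real pi * \<i> * of_int (c * k * p) * \<Phi> p (z + (of_int k, 0)))"
    using *[of "(0, 1)"] unfolding partial_phase by (simp add: algebra_simps)
qed

lemma D_alg_unit_square_bound:
  assumes "\<Phi> \<in> D_alg c \<nu>"
  obtains C where "0 \<le> C" "\<And>p z. z \<in> unit_square \<Longrightarrow> jb (of_int p) ^ n * norm (\<Phi> p z) \<le> C"
    "\<And>(u :: real \<times> real) p z. u \<in> Basis \<Longrightarrow> z \<in> unit_square \<Longrightarrow> jb (of_int p) ^ n * norm (partial u (\<Phi> p) z) \<le> C"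
proof -
  note D = D_alg_derivs[OF assms]
  note R = loc_rapidE[OF derivs_in_base compact_unit_square, where n = n]
  obtain A where A: "0 \<le> A" "\<And>p z. z \<in> unit_square \<Longrightarrow> jb (of_int p) ^ n * norm (\<Phi> p z) \<le> A"
    using R[OF D] by metis
  obtain X where X: "0 \<le> X" "\<And>p z. z \<in> unit_square \<Longrightarrow> jb (of_int p) ^ n * norm (partial_x (\<Phi> p) z) \<le> X"
    using R[OF derivs_in_partial[OF D x_Basis]] by metis
  obtain Y where Y: "0 \<le> Y" "\<And>p z. z \<in> unit_square \<Longrightarrow> jb (of_int p) ^ n * norm (partial_y (\<Phi> p) z) \<le> Y"
    using R[OF derivs_in_partial[OF D y_Basis]] by metis
  show ?thesis
  proof (rule that[of "A + X + Y"])
    show "0 \<le> A + X + Y"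
      using A X Y by simp
    show "jb (of_int p) ^ n * norm (\<Phi> p z) \<le> A + X + Y" if "z \<in> unit_square" for p z
      using A(2)[OF that, of p] X(1) Y(1) by simp
    show "jb (of_int p) ^ n * norm (partial u (\<Phi> p) z) \<le> A + X + Y"
      if "u \<in> Basis" "z \<in> unit_square" for u :: "real \<times> real" and p z
    proof -
      from that(1) consider "u = (1, 0)" | "u = (0, 1)"
        by (auto simp: Basis_plane)
      then show ?thesis
        using X(2)[OF that(2), of p] Y(2)[OF that(2), of p] X(1) Y(1) A(1) by cases simp_all
    qed
  qed
qed

text \<open>
  Equivariance carries bounds from the unit square to all of \<open>M\<close>; only the phase in the
  \<open>y\<close>-derivative costs a factor growing linearly in \<open>x\<close>.
\<close>

lemma D_alg_global_bound:
  assumes "\<Phi> \<in> D_alg c \<nu>"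
  obtains C where "0 \<le> C" "\<And>p z. jb (of_int p) ^ n * norm (\<Phi> p z) \<le> C * jb (fst z)"
    "\<And>(u :: real \<times> real) p z. u \<in> Basis \<Longrightarrow> jb (of_int p) ^ n * norm (partial u (\<Phi> p) z) \<le> C * jb (fst z)"
proof -
  obtain B where B: "0 \<le> B" "\<And>p z. z \<in> unit_square \<Longrightarrow> jb (of_int p) ^ Suc n * norm (\<Phi> p z) \<le> B"
    "\<And>(u :: real \<times> real) p z. u \<in> Basis \<Longrightarrow> z \<in> unit_square \<Longrightarrow> jb (of_int p) ^ Suc n * norm (partial u (\<Phi> p) z) \<le> B"
    using D_alg_unit_square_bound[OF assms, of "Suc n"] by metis
  define C where "C = B + 2 * pi * \<bar>of_int c\<bar> * B"
  have le: "jb (of_int p) ^ n * norm w \<le> jb (of_int p) ^ Suc n * norm w" for p and w :: complex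
    by (intro mult_right_mono power_increasing) simp_all
  have BC: "B \<le> C * jb x" and BC0: "0 \<le> C" for x
  proof -
    show "0 \<le> C"
      unfolding C_def using B(1) by simp
    have "B * 1 \<le> C * jb x"
      unfolding C_def using B(1) by (intro mult_mono) simp_all
    then show "B \<le> C * jb x" by simp
  qed
  have per: "periodic_y (\<Phi> p)" "smooth (\<Phi> p)" for p
    using assms by (simp_all add: D_alg_def)
  define r :: "real \<times> real \<Rightarrow> real \<times> real" where "r z = (fst z - of_int \<lfloor>fst z\<rfloor>, snd z - of_int \<lfloor>snd z\<rfloor>)" for z
  have r: "r z \<in> unit_square" for z
    unfolding r_def by (rule in_unit_square)
  have red: "f (z + (of_int (- \<lfloor>fst z\<rfloor>), 0)) = f (r z)" if "periodic_y f" for f z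
    using periodic_y_floor[OF that, of "fst z - of_int \<lfloor>fst z\<rfloor>" "snd z"]
    by (cases z) (simp add: r_def)
  note per' = periodic_partial[OF per(2,1)]
  show ?thesis
  proof (rule that[OF BC0])
    fix p and z :: "real \<times> real"
    have "norm (\<Phi> p z) = norm (\<Phi> p (r z))"
      using D_alg_phase[OF assms, of p "- \<lfloor>fst z\<rfloor>", THEN fun_cong, of z] red[OF per(1), of p z]
      by (simp add: norm_mult)
    then show "jb (of_int p) ^ n * norm (\<Phi> p z) \<le> C * jb (fst z)"
      using order_trans[OF order_trans[OF le B(2)[OF r]] BC] by simp
  next
    fix u z :: "real \<times> real" and p assume u: "u \<in> Basis"
    from u consider "u = (1, 0)" | "u = (0, 1)"
      by (auto simp: Basis_plane)
    then show "jb (of_int p) ^ n * norm (partial u (\<Phi> p) z) \<le> C * jb (fst z)"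
    proof cases
      case 1
      have "norm (partial_x (\<Phi> p) z) = norm (partial_x (\<Phi> p) (r z))"
        using D_alg_partial_phase(1)[OF assms, of p z "- \<lfloor>fst z\<rfloor>"] red[OF per', of "(1, 0)" p z]
        by (simp add: norm_mult)
      then show ?thesis
        using order_trans[OF order_trans[OF le B(3)[OF u r]] BC, of p z "fst z"] 1 by simp
    next
      case 2
      let ?k = "- \<lfloor>fst z\<rfloor>" and ?j = "jb (of_int p)"
      have "norm (partial_y (\<Phi> p) z) =
          norm (partial_y (\<Phi> p) (r z) - 2 * of_real pi * \<i> * of_int (c * ?k * p) * \<Phi> p (r z))"
        using D_alg_partial_phase(2)[OF assms, of p z ?k] red[OF per', of "(0, 1)" p z] red[OF per(1), of p z]
        by (simp add: norm_mult)
      also have "\<dots> \<le> norm (partial_y (\<Phi> p) (r z)) +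
          norm (2 * of_real pi * \<i> * of_int (c * ?k * p) * \<Phi> p (r z))"
        by (rule norm_triangle_ineq4)
      also have "norm (2 * of_real pi * \<i> * of_int (c * ?k * p) * \<Phi> p (r z)) =
          2 * pi * \<bar>of_int c\<bar> * \<bar>of_int \<lfloor>fst z\<rfloor>\<bar> * (\<bar>of_int p\<bar> * norm (\<Phi> p (r z)))"
        by (simp add: norm_mult abs_mult)
      also have "\<dots> \<le> 2 * pi * \<bar>of_int c\<bar> * jb (fst z) * (?j * norm (\<Phi> p (r z)))"
        by (intro mult_mono jb_floor order_refl mult_nonneg_nonneg) (simp_all add: jb_def)
      finally have *: "norm (partial_y (\<Phi> p) z) \<le> norm (partial_y (\<Phi> p) (r z)) +
          2 * pi * \<bar>of_int c\<bar> * jb (fst z) * (?j * norm (\<Phi> p (r z)))"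
        by simp
      have "?j ^ n * norm (partial_y (\<Phi> p) z) \<le> ?j ^ n * (norm (partial_y (\<Phi> p) (r z)) +
          2 * pi * \<bar>of_int c\<bar> * jb (fst z) * (?j * norm (\<Phi> p (r z))))"
        by (rule mult_left_mono[OF *]) simp
      also have "\<dots> = ?j ^ n * norm (partial_y (\<Phi> p) (r z)) +
          2 * pi * \<bar>of_int c\<bar> * jb (fst z) * (?j ^ Suc n * norm (\<Phi> p (r z)))"
        by (simp add: algebra_simps)
      also have "\<dots> \<le> B * jb (fst z) + 2 * pi * \<bar>of_int c\<bar> * jb (fst z) * B"
      proof (intro add_mono mult_left_mono B(2) r)
        have "?j ^ n * norm (partial_y (\<Phi> p) (r z)) \<le> B"
          using order_trans[OF le B(3)[OF u r]] 2 by simp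
        also have "\<dots> = B * 1" by simp
        also have "\<dots> \<le> B * jb (fst z)"
          by (intro mult_left_mono B(1)) simp
        finally show "?j ^ n * norm (partial_y (\<Phi> p) (r z)) \<le> B * jb (fst z)" .
      qed simp
      finally show ?thesis
        using 2 by (simp add: C_def algebra_simps)
    qed
  qed
qed

definition shift :: "real \<Rightarrow> real \<Rightarrow> int \<Rightarrow> real \<times> real" where
  "shift \<mu> \<nu> q = (2 * of_int q * \<mu>, 2 * of_int q * \<nu>)"

lemma act_R_eq:
  "act_R \<mu> \<nu> g \<Phi> = (\<lambda>z. \<Sum>\<^sub>\<infinity>q. g (z + shift \<mu> \<nu> q) * cnj (\<Phi> q (z + shift \<mu> \<nu> q)))"
  by (rule ext) (simp add: act_R_def shift_def case_prod_beta' plus_prod_def)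

text \<open>
  Stated for an arbitrary family \<open>W\<close>, because it is applied to \<open>\<Phi>\<close> and to its first derivatives; the
  decay of \<open>g\<close> absorbs the linear growth in \<open>x\<close>.
\<close>

lemma act_R_loc_summable:
  assumes "g \<in> Xi" "\<And>p z. jb (of_int p) ^ 2 * norm (W p z) \<le> C * jb (fst z)"
  shows "loc_summable (\<lambda>q z. g (z + shift \<mu> \<nu> q) * cnj (W q (z + shift \<mu> \<nu> q)))"
  unfolding loc_summable_def
proof (intro allI impI)
  fix K :: "(real \<times> real) set"
  obtain A where A: "0 \<le> A" "\<And>z. jb (fst z) ^ 1 * norm (g z) \<le> A"
    using Xi_bounded[OF assms(1)] by metis
  have "norm (g z * cnj (W q z)) \<le> (A * \<bar>C\<bar>) * wgt q" for q z
  proof -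
    have C: "jb (of_int q) ^ 2 * norm (W q z) \<le> \<bar>C\<bar> * jb (fst z)"
      by (rule order_trans[OF assms(2)]) (simp add: mult_right_mono)
    have "norm (g z * cnj (W q z)) * jb (of_int q) ^ 2 = norm (g z) * (jb (of_int q) ^ 2 * norm (W q z))"
      by (simp add: norm_mult)
    also have "\<dots> \<le> norm (g z) * (\<bar>C\<bar> * jb (fst z))"
      by (intro mult_left_mono C) simp
    also have "\<dots> = \<bar>C\<bar> * (jb (fst z) ^ 1 * norm (g z))"
      by simp
    also have "\<dots> \<le> \<bar>C\<bar> * A"
      by (intro mult_left_mono A) simp
    also have "\<bar>C\<bar> * A = A * \<bar>C\<bar>"
      by (rule mult.commute)
    finally show ?thesis
      by (rule wgt_boundI)
  qed
  then show "\<exists>C. \<forall>q. \<forall>z\<in>K. norm (g (z + shift \<mu> \<nu> q) * cnj (W q (z + shift \<mu> \<nu> q))) \<le> C * wgt q"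
    by (intro exI[of _ "A * \<bar>C\<bar>"]) simp
qed

lemma loc_summable_add:
  assumes "loc_summable f" "loc_summable g"
  shows "loc_summable (\<lambda>k z. f k z + g k z)"
  unfolding loc_summable_def
proof (intro allI impI)
  fix K :: "(real \<times> real) set" assume K: "compact K"
  obtain A where A: "\<And>k z. z \<in> K \<Longrightarrow> norm (f k z) \<le> A * wgt k"
    using loc_summableD[OF assms(1) K] by metis
  obtain B where B: "\<And>k z. z \<in> K \<Longrightarrow> norm (g k z) \<le> B * wgt k"
    using loc_summableD[OF assms(2) K] by metis
  have "norm (f k z + g k z) \<le> (A + B) * wgt k" if "z \<in> K" for k z
    using norm_triangle_ineq[of "f k z" "g k z"] A[OF that, of k] B[OF that, of k]
    by (simp add: distrib_right)
  then show "\<exists>C. \<forall>k. \<forall>z\<in>K. norm (f k z + g k z) \<le> C * wgt k"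
    by (intro exI[of _ "A + B"]) simp
qed

lemma act_R_term_partial:
  assumes "g \<in> Xi" "\<Phi> \<in> D_alg c \<nu>"
  shows "partial u (\<lambda>z. g (z + a) * cnj (\<Phi> q (z + a))) z =
      partial u g (z + a) * cnj (\<Phi> q (z + a)) + g (z + a) * cnj (partial u (\<Phi> q) (z + a))"
    and "(\<lambda>z. g (z + a) * cnj (\<Phi> q (z + a))) differentiable (at z)"
proof -
  have d: "g differentiable (at w)" "\<Phi> q differentiable (at w)" for w
    using Xi_differentiable[OF assms(1)] derivs_in_differentiable[OF D_alg_derivs[OF assms(2)]] by blast+
  have dg: "(\<lambda>z. g (z + a)) differentiable (at z)" and dP: "(\<lambda>z. \<Phi> q (z + a)) differentiable (at z)"
    by (rule differentiable_shift[OF d(1)], rule differentiable_shift[OF d(2)])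
  show "partial u (\<lambda>z. g (z + a) * cnj (\<Phi> q (z + a))) z =
      partial u g (z + a) * cnj (\<Phi> q (z + a)) + g (z + a) * cnj (partial u (\<Phi> q) (z + a))"
    unfolding partial_mult[OF dg differentiable_cnj[OF dP]] partial_cnj[OF dP]
      partial_shift[OF d(1)] partial_shift[OF d(2)] by (rule refl)
  show "(\<lambda>z. g (z + a) * cnj (\<Phi> q (z + a))) differentiable (at z)"
    by (rule differentiable_mult[OF dg differentiable_cnj[OF dP]])
qed

lemma act_R_summable:
  assumes "g \<in> Xi" "\<Phi> \<in> D_alg c \<nu>"
  shows "loc_summable (\<lambda>q z. g (z + shift \<mu> \<nu> q) * cnj (\<Phi> q (z + shift \<mu> \<nu> q)))"
    and "u \<in> Basis \<Longrightarrow>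
      loc_summable (\<lambda>q. partial u (\<lambda>z. g (z + shift \<mu> \<nu> q) * cnj (\<Phi> q (z + shift \<mu> \<nu> q))))"
proof -
  obtain C where C: "\<And>p z. jb (of_int p) ^ 2 * norm (\<Phi> p z) \<le> C * jb (fst z)"
    "\<And>(u :: real \<times> real) p z. u \<in> Basis \<Longrightarrow> jb (of_int p) ^ 2 * norm (partial u (\<Phi> p) z) \<le> C * jb (fst z)"
    using D_alg_global_bound[OF assms(2), of 2] by metis
  show "loc_summable (\<lambda>q z. g (z + shift \<mu> \<nu> q) * cnj (\<Phi> q (z + shift \<mu> \<nu> q)))"
    by (rule act_R_loc_summable[OF assms(1) C(1)])
  assume u: "u \<in> Basis"
  have eq: "(\<lambda>q. partial u (\<lambda>z. g (z + shift \<mu> \<nu> q) * cnj (\<Phi> q (z + shift \<mu> \<nu> q)))) =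
      (\<lambda>q z. partial u g (z + shift \<mu> \<nu> q) * cnj (\<Phi> q (z + shift \<mu> \<nu> q))
        + g (z + shift \<mu> \<nu> q) * cnj (partial u (\<Phi> q) (z + shift \<mu> \<nu> q)))"
    by (intro ext) (rule act_R_term_partial(1)[OF assms])
  show "loc_summable (\<lambda>q. partial u (\<lambda>z. g (z + shift \<mu> \<nu> q) * cnj (\<Phi> q (z + shift \<mu> \<nu> q))))"
    unfolding eq
    by (rule loc_summable_add[OF act_R_loc_summable[OF Xi_partial[OF assms(1) u] C(1)]
          act_R_loc_summable[OF assms(1) C(2)[OF u]]])
qed

lemma act_R_partial:
  assumes "g \<in> Xi" "\<Phi> \<in> D_alg c \<nu>" "u \<in> Basis"
  shows "partial u (act_R \<mu> \<nu> g \<Phi>) z =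
    (\<Sum>\<^sub>\<infinity>q. partial u (\<lambda>z. g (z + shift \<mu> \<nu> q) * cnj (\<Phi> q (z + shift \<mu> \<nu> q))) z)"
  unfolding act_R_eq
  by (rule partial_infsum(1)[OF act_R_term_partial(2)[OF assms(1,2)] act_R_summable[OF assms(1,2)] assms(3)])

lemma nabla0_eq:
  "nabla0 c \<mu> (a, b, d) \<xi> z = - of_real a * partial_y \<xi> z - of_real b * partial_x \<xi> z
     + (of_real (a * pi * of_int c / (2 * \<mu>) * (fst z)\<^sup>2 + d * pi / \<mu> * fst z) * \<i>) * \<xi> z"
  by (cases z) (simp add: nabla0_def nabla0_X_def nabla0_Y_def nabla0_Z_def algebra_simps)

lemma delta_eq:
  "delta c \<mu> (a, b, d) \<Phi> p z = - of_real a * partial_y (\<Phi> p) z - of_real b * partial_x (\<Phi> p) z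
     + (of_real (a * 2 * pi * of_int (c * p) * (fst z - of_int p * \<mu>) + d * 2 * pi * of_int p) * \<i>) * \<Phi> p z"
  by (cases z) (simp add: delta_def delta_X_def delta_Y_def delta_Z_def algebra_simps)

lemma nabla0_Xi:
  assumes "\<xi> \<in> Xi"
  shows "nabla0 c \<mu> W \<xi> \<in> Xi"
proof -
  obtain a b d where W: "W = (a, b, d)" by (cases W)
  have "(\<lambda>z. - of_real a * partial_y \<xi> z + - of_real b * partial_x \<xi> z
      + (of_real (a * pi * of_int c / (2 * \<mu>)) * \<i> * (of_real (fst z) * (of_real (fst z) * \<xi> z)) +
         of_real (d * pi / \<mu>) * \<i> * (of_real (fst z) * \<xi> z))) \<in> Xi"
    by (intro Xi_add Xi_cmult Xi_x_mult Xi_partial_x Xi_partial_y assms)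
  moreover have "nabla0 c \<mu> W \<xi> = (\<lambda>z. - of_real a * partial_y \<xi> z + - of_real b * partial_x \<xi> z
      + (of_real (a * pi * of_int c / (2 * \<mu>)) * \<i> * (of_real (fst z) * (of_real (fst z) * \<xi> z)) +
         of_real (d * pi / \<mu>) * \<i> * (of_real (fst z) * \<xi> z)))"
    by (rule ext) (simp add: W nabla0_eq power2_eq_square algebra_simps)
  ultimately show ?thesis
    by simp
qed

lemma nabla0_lincomb:
  assumes "\<xi> differentiable (at z)" "\<eta> differentiable (at z)"
  shows "nabla0 c \<mu> W (\<lambda>z. a * \<xi> z + b * \<eta> z) z = a * nabla0 c \<mu> W \<xi> z + b * nabla0 c \<mu> W \<eta> z"
proof -
  obtain r s t where W: "W = (r, s, t)" by (cases W)
  have "partial u (\<lambda>z. a * \<xi> z + b * \<eta> z) z = a * partial u \<xi> z + b * partial u \<eta> z" for u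
    using partial_add[of "\<lambda>z. a * \<xi> z" z "\<lambda>z. b * \<eta> z" u] assms
    by (simp add: partial_cmult)
  then show ?thesis
    by (simp add: W nabla0_eq algebra_simps add_divide_distrib)
qed

lemma nabla0_linear: "linear (\<lambda>W. nabla0 c \<mu> W \<xi> z)"
  by (rule linearI) (auto simp: nabla0_def algebra_simps scaleR_conv_of_real)

text \<open>
  Summand by summand, the identity is \<open>(x + 2q\<mu>)\<^sup>2 - x\<^sup>2 = 4q\<mu>(x + q\<mu>)\<close>: the quadratic phase of
  \<open>\<nabla>\<^sup>0\<^sub>X\<close> changes along the translation by \<open>2q\<mu>\<close> by exactly the multiplier in \<open>\<delta>\<^sub>X\<close>.
\<close>

lemma nabla0_Leibniz:
  assumes \<mu>: "\<mu> \<noteq> 0" and "\<xi> \<in> Xi" "\<Phi> \<in> D_alg c \<nu>"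
  shows "nabla0 c \<mu> W (act_R \<mu> \<nu> \<xi> \<Phi>) z =
    act_R \<mu> \<nu> (nabla0 c \<mu> W \<xi>) \<Phi> z + act_R \<mu> \<nu> \<xi> (delta c \<mu> W \<Phi>) z"
proof -
  obtain a b d where W: "W = (a, b, d)" by (cases W)
  define w where "w q = z + shift \<mu> \<nu> q" for q
  let ?t = "\<lambda>q z. \<xi> (z + shift \<mu> \<nu> q) * cnj (\<Phi> q (z + shift \<mu> \<nu> q))"
  define g where "g = of_real (a * pi * of_int c / (2 * \<mu>) * (fst z)\<^sup>2 + d * pi / \<mu> * fst z) * \<i>"
  define S where "S q = - of_real a * partial_y (?t q) z + (- of_real b * partial_x (?t q) z + g * ?t q z)" for q
  define A where "A q = nabla0 c \<mu> W \<xi> (w q) * cnj (\<Phi> q (w q))" for q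
  define B where "B q = \<xi> (w q) * cnj (delta c \<mu> W \<Phi> q (w q))" for q
  note sm = loc_summable_summable[OF act_R_summable(1)[OF assms(2,3)]]
  note smx = loc_summable_summable[OF act_R_summable(2)[OF assms(2,3) x_Basis]]
  note smy = loc_summable_summable[OF act_R_summable(2)[OF assms(2,3) y_Basis]]
  have sS: "S summable_on UNIV"
    unfolding S_def by (intro summable_on_add summable_on_cmult_right sm smx smy)
  have sA: "A summable_on UNIV"
    unfolding A_def w_def
    by (rule loc_summable_summable[OF act_R_summable(1)[OF nabla0_Xi[OF assms(2)] assms(3)]])
  have SAB: "S q = A q + B q" for q
  proof -
    have fw: "fst (w q) = fst z + 2 * of_int q * \<mu>"
      by (simp add: w_def shift_def)
    show ?thesis
      unfolding S_def A_def B_def g_def W nabla0_eq delta_eq act_R_term_partial(1)[OF assms(2,3)] fw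
      unfolding w_def[symmetric]
      using \<mu> by (simp add: field_simps power2_eq_square)
  qed
  then have "B = (\<lambda>q. S q + (- 1) * A q)"
    by (simp add: fun_eq_iff)
  then have sB: "B summable_on UNIV"
    using summable_on_add[OF sS summable_on_cmult_right[OF sA, of "- 1"]] by simp
  have "nabla0 c \<mu> W (act_R \<mu> \<nu> \<xi> \<Phi>) z = (\<Sum>\<^sub>\<infinity>q. S q)"
  proof -
    have "(\<Sum>\<^sub>\<infinity>q. S q) = - of_real a * (\<Sum>\<^sub>\<infinity>q. partial_y (?t q) z) +
        (- of_real b * (\<Sum>\<^sub>\<infinity>q. partial_x (?t q) z) + g * (\<Sum>\<^sub>\<infinity>q. ?t q z))"
      unfolding S_def
      by (subst infsum_add, intro summable_on_cmult_right smy,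
          intro summable_on_add summable_on_cmult_right sm smx,
          subst infsum_add, intro summable_on_cmult_right smx, intro summable_on_cmult_right sm,
          simp only: infsum_cmult_right')
    also have "\<dots> = nabla0 c \<mu> W (act_R \<mu> \<nu> \<xi> \<Phi>) z"
      unfolding W nabla0_eq act_R_partial[OF assms(2,3) x_Basis] act_R_partial[OF assms(2,3) y_Basis]
      by (simp add: act_R_eq g_def)
    finally show ?thesis ..
  qed
  also have "\<dots> = (\<Sum>\<^sub>\<infinity>q. A q) + (\<Sum>\<^sub>\<infinity>q. B q)"
    unfolding SAB by (rule infsum_add[OF sA sB])
  finally show ?thesis
    by (simp add: act_R_eq A_def B_def w_def)
qed

lemma term_R_partial:
  assumes "\<xi> \<in> Xi" "\<eta> \<in> Xi"
  shows "partial_x (term_R c \<mu> \<nu> \<xi> \<eta> i) z =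
      term_R c \<mu> \<nu> (partial_x \<xi>) \<eta> i z + term_R c \<mu> \<nu> \<xi> (partial_x \<eta>) i z"
    and "partial_y (term_R c \<mu> \<nu> \<xi> \<eta> i) z =
      term_R c \<mu> \<nu> (partial_y \<xi>) \<eta> i z + term_R c \<mu> \<nu> \<xi> (partial_y \<eta>) i z
      - 2 * of_real pi * \<i> * of_int (c * snd i * fst i) * term_R c \<mu> \<nu> \<xi> \<eta> i z"
proof -
  let ?a = "(of_int (snd i) :: real, 0 :: real)"
  let ?b = "(of_int (snd i) - 2 * of_int (fst i) * \<mu>, - (2 * of_int (fst i) * \<nu>))"
  let ?ph = "\<lambda>z. e (of_int (c * snd i * fst i) * (snd z - of_int (fst i) * \<nu>))"
  note d = Xi_differentiable[OF assms(1)] Xi_differentiable[OF assms(2)]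
  have dp: "(\<lambda>z. cnj (?ph z)) differentiable (at z)"
    by (rule differentiable_cnj[OF differentiable_phase])
  have d1: "(\<lambda>z. \<xi> (z + ?a)) differentiable (at z)" and d2: "(\<lambda>z. \<eta> (z + ?b)) differentiable (at z)"
    by (rule differentiable_shift[OF d(1)], rule differentiable_shift[OF d(2)])
  have eq: "term_R c \<mu> \<nu> \<xi> \<eta> i = (\<lambda>z. cnj (?ph z) * \<xi> (z + ?a) * cnj (\<eta> (z + ?b)))"
    by (rule ext) (simp only: term_R_def)
  have *: "partial u (term_R c \<mu> \<nu> \<xi> \<eta> i) z =
      (cnj (partial u ?ph z) * \<xi> (z + ?a) + cnj (?ph z) * partial u \<xi> (z + ?a)) * cnj (\<eta> (z + ?b)) +
      cnj (?ph z) * \<xi> (z + ?a) * cnj (partial u \<eta> (z + ?b))" for u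
    unfolding eq partial_mult[OF differentiable_mult[OF dp d1] differentiable_cnj[OF d2]]
      partial_mult[OF dp d1] partial_cnj[OF d2] partial_cnj[OF differentiable_phase]
      partial_shift[OF d(1)] partial_shift[OF d(2)] by (rule refl)
  show "partial_x (term_R c \<mu> \<nu> \<xi> \<eta> i) z =
      term_R c \<mu> \<nu> (partial_x \<xi>) \<eta> i z + term_R c \<mu> \<nu> \<xi> (partial_x \<eta>) i z"
    unfolding * partial_phase by (simp add: term_R_def algebra_simps)
  show "partial_y (term_R c \<mu> \<nu> \<xi> \<eta> i) z =
      term_R c \<mu> \<nu> (partial_y \<xi>) \<eta> i z + term_R c \<mu> \<nu> \<xi> (partial_y \<eta>) i z
      - 2 * of_real pi * \<i> * of_int (c * snd i * fst i) * term_R c \<mu> \<nu> \<xi> \<eta> i z"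
    unfolding * partial_phase by (simp add: term_R_def algebra_simps)
qed

text \<open>
  The same quadratic identity, now for the arguments \<open>x + k\<close> and \<open>x + k - 2p\<mu>\<close>; the extra
  term \<open>2\<pi>ickp\<close> comes from differentiating the phase of the inner product.
\<close>

lemma nabla0_metric:
  assumes \<mu>: "\<mu> \<noteq> 0" and "\<xi> \<in> Xi" "\<eta> \<in> Xi"
  shows "delta c \<mu> W (inner_R c \<mu> \<nu> \<xi> \<eta>) p z =
    inner_R c \<mu> \<nu> (nabla0 c \<mu> W \<xi>) \<eta> p z + inner_R c \<mu> \<nu> \<xi> (nabla0 c \<mu> W \<eta>) p z"
proof -
  obtain a b d where W: "W = (a, b, d)" by (cases W)
  let ?T = "term_R c \<mu> \<nu>"
  define g where "g = of_real (a * 2 * pi * of_int (c * p) * (fst z - of_int p * \<mu>) + d * 2 * pi * of_int p) * \<i>"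
  define S where "S k = - of_real a * partial_y (?T \<xi> \<eta> (p, k)) z +
      (- of_real b * partial_x (?T \<xi> \<eta> (p, k)) z + g * ?T \<xi> \<eta> (p, k) z)" for k
  note T = term_R_rapid[OF assms(2,3) \<mu>, of c \<nu>]
  have smu: "(\<lambda>k. partial u (?T \<xi> \<eta> (p, k)) z) summable_on UNIV" if "u \<in> Basis" for u
    by (rule loc_summable_summable[OF loc_rapid2_summable[OF derivs_in_base[OF derivs_in_partial[OF T that]]]])
  note sm = inner_R_summable[OF assms(2,3) \<mu>]
  have split: "S k = ?T (nabla0 c \<mu> W \<xi>) \<eta> (p, k) z + ?T \<xi> (nabla0 c \<mu> W \<eta>) (p, k) z" for k
    unfolding S_def term_R_partial[OF assms(2,3)] W g_def
    using \<mu> by (simp add: term_R_def nabla0_eq field_simps power2_eq_square)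
  have "delta c \<mu> W (inner_R c \<mu> \<nu> \<xi> \<eta>) p z = - of_real a * (\<Sum>\<^sub>\<infinity>k. partial_y (?T \<xi> \<eta> (p, k)) z) +
        (- of_real b * (\<Sum>\<^sub>\<infinity>k. partial_x (?T \<xi> \<eta> (p, k)) z) + g * (\<Sum>\<^sub>\<infinity>k. ?T \<xi> \<eta> (p, k) z))"
    unfolding W delta_eq inner_R_partial[OF assms(2,3) \<mu> x_Basis] inner_R_partial[OF assms(2,3) \<mu> y_Basis]
    by (simp add: inner_R_eq g_def)
  also have "\<dots> = (\<Sum>\<^sub>\<infinity>k. S k)"
    unfolding S_def
    by (subst infsum_add, intro summable_on_cmult_right smu y_Basis,
        intro summable_on_add summable_on_cmult_right sm smu x_Basis,
        subst infsum_add, intro summable_on_cmult_right smu x_Basis, intro summable_on_cmult_right sm,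
        simp only: infsum_cmult_right')
  also have "\<dots> = (\<Sum>\<^sub>\<infinity>k. ?T (nabla0 c \<mu> W \<xi>) \<eta> (p, k) z) + (\<Sum>\<^sub>\<infinity>k. ?T \<xi> (nabla0 c \<mu> W \<eta>) (p, k) z)"
    unfolding split
    by (rule infsum_add[OF inner_R_summable[OF nabla0_Xi[OF assms(2)] assms(3) \<mu>]
          inner_R_summable[OF assms(2) nabla0_Xi[OF assms(3)] \<mu>]])
  finally show ?thesis
    by (simp only: inner_R_eq)
qed

theorem nabla0_compatible:
  assumes "\<mu> \<noteq> 0"
  shows "compatible_connection c \<mu> \<nu> (nabla0 c \<mu>)"
  unfolding compatible_connection_def linear_connection_def
proof (intro conjI allI ballI ext)
  show "nabla0 c \<mu> W \<xi> \<in> Xi" if "\<xi> \<in> Xi" for W \<xi>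
    by (rule nabla0_Xi[OF that])
  show "linear (\<lambda>W. nabla0 c \<mu> W \<xi> z)" for \<xi> z
    by (rule nabla0_linear)
  show "nabla0 c \<mu> W (\<lambda>z. a * \<xi> z + b * \<eta> z) z = a * nabla0 c \<mu> W \<xi> z + b * nabla0 c \<mu> W \<eta> z"
    if "\<xi> \<in> Xi" "\<eta> \<in> Xi" for W \<xi> \<eta> a b z
    by (rule nabla0_lincomb[OF Xi_differentiable[OF that(1)] Xi_differentiable[OF that(2)]])
  show "nabla0 c \<mu> W (act_R \<mu> \<nu> \<xi> \<Phi>) z =
      act_R \<mu> \<nu> (nabla0 c \<mu> W \<xi>) \<Phi> z + act_R \<mu> \<nu> \<xi> (delta c \<mu> W \<Phi>) z"
    if "\<xi> \<in> Xi" "\<Phi> \<in> D_alg c \<nu>" for W \<xi> \<Phi> z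
    by (rule nabla0_Leibniz[OF assms that])
  show "delta c \<mu> W (inner_R c \<mu> \<nu> \<xi> \<eta>) p z =
      inner_R c \<mu> \<nu> (nabla0 c \<mu> W \<xi>) \<eta> p z + inner_R c \<mu> \<nu> \<xi> (nabla0 c \<mu> W \<eta>) p z"
    if "\<xi> \<in> Xi" "\<eta> \<in> Xi" for W \<xi> \<eta> p z
    by (rule nabla0_metric[OF assms that])
qed


section \<open>Bump functions\<close>

text \<open>
  The functions \<open>p(1/t) exp(-1/t)\<close>, extended by \<open>0\<close>; as a class they are closed under
  differentiation.
\<close>

definition flat :: "real poly \<Rightarrow> real \<Rightarrow> real" where
  "flat p t = (if 0 < t then poly p (1 / t) * exp (- (1 / t)) else 0)"

text \<open>
  The rate \<open>s\<close> is arbitrary so that the induction can spend half of it on the factor \<open>u\<close>.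
\<close>

lemma poly_le_exp:
  fixes p :: "real poly"
  shows "s > 0 \<Longrightarrow> \<exists>C\<ge>0. \<forall>u\<ge>0. \<bar>poly p u\<bar> \<le> C * exp (s * u)"
proof (induction p arbitrary: s)
  case 0
  then show ?case by (intro exI[of _ 0]) simp
next
  case (pCons a p)
  then have "s / 2 > 0" by simp
  then obtain C where C: "C \<ge> 0" "\<And>u. u \<ge> 0 \<Longrightarrow> \<bar>poly p u\<bar> \<le> C * exp (s / 2 * u)"
    using pCons.IH by blast
  have "\<bar>poly (pCons a p) u\<bar> \<le> (\<bar>a\<bar> + 2 / s * C) * exp (s * u)" if u: "u \<ge> 0" for u
  proof -
    have 1: "1 \<le> exp (s * u)"
      using u pCons.prems by simp
    have "s / 2 * u \<le> exp (s / 2 * u)"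
      using exp_ge_add_one_self[of "s / 2 * u"] by linarith
    then have 2: "u \<le> 2 / s * exp (s / 2 * u)"
      using pCons.prems by (simp add: field_simps)
    have "\<bar>poly (pCons a p) u\<bar> \<le> \<bar>a\<bar> + u * \<bar>poly p u\<bar>"
      using abs_triangle_ineq[of a "u * poly p u"] u by (simp add: abs_mult)
    also have "u * \<bar>poly p u\<bar> \<le> (2 / s * exp (s / 2 * u)) * (C * exp (s / 2 * u))"
      using u 2 C by (intro mult_mono) simp_all
    also have "\<dots> = 2 / s * C * exp (s / 2 * u + s / 2 * u)"
      unfolding exp_add by (simp only: mult_ac)
    also have "s / 2 * u + s / 2 * u = s * u"
      by simp
    also have "\<bar>a\<bar> \<le> \<bar>a\<bar> * exp (s * u)"
      using mult_left_mono[OF 1, of "\<bar>a\<bar>"] by simp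
    finally show ?thesis
      by (simp add: distrib_right)
  qed
  moreover have "0 \<le> \<bar>a\<bar> + 2 / s * C"
    using C(1) pCons.prems by simp
  ultimately show ?case
    by blast
qed

text \<open>
  At \<open>t = 0\<close> the derivative is \<open>0\<close> because \<open>\<bar>flat p h\<bar> \<le> C h\<^sup>2\<close>, which is the bound of a
  polynomial in \<open>1/h\<close> by the exponential.
\<close>

lemma has_derivative_flat:
  "(flat p has_real_derivative flat ([:0, 0, 1:] * (p - pderiv p)) t) (at t)"
proof (cases t "0 :: real" rule: linorder_cases)
  case less
  have "((\<lambda>_. 0) has_real_derivative 0) (at t)"
    by simp
  then have "(flat p has_real_derivative 0) (at t)"
    by (rule has_field_derivative_transform_within_open[of _ _ _ "{..<0}"]) (use less in \<open>simp_all add: flat_def\<close>)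
  then show ?thesis
    using less by (simp add: flat_def)
next
  case greater
  have "((\<lambda>t. poly p (1 / t) * exp (- (1 / t))) has_real_derivative
      (poly ([:0, 0, 1:] * (p - pderiv p)) (1 / t) * exp (- (1 / t)))) (at t)"
    using greater
    by (auto intro!: derivative_eq_intros simp: field_simps power2_eq_square)
  then have "(flat p has_real_derivative
      (poly ([:0, 0, 1:] * (p - pderiv p)) (1 / t) * exp (- (1 / t)))) (at t)"
    by (rule has_field_derivative_transform_within_open[of _ _ _ "{0<..}"]) (use greater in \<open>simp_all add: flat_def\<close>)
  then show ?thesis
    using greater by (simp add: flat_def)
next
  case equal
  obtain C where C: "C \<ge> 0" "\<forall>u\<ge>0. \<bar>poly ([:0, 0, 1:] * p) u\<bar> \<le> C * exp (1 * u)"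
    using poly_le_exp[of 1 "[:0, 0, 1:] * p"] by auto
  have bound: "\<bar>flat p h\<bar> \<le> C * h\<^sup>2" for h
  proof (cases "0 < h")
    case True
    have "\<bar>(1 / h)\<^sup>2 * poly p (1 / h)\<bar> \<le> C * exp (1 / h)"
      using C(2)[rule_format, of "1 / h"] True by (simp add: power2_eq_square mult.assoc)
    then have "(1 / h)\<^sup>2 * \<bar>poly p (1 / h)\<bar> \<le> C * exp (1 / h)"
      by (simp add: abs_mult)
    then have "\<bar>poly p (1 / h)\<bar> \<le> C * exp (1 / h) * h\<^sup>2"
      using True by (simp add: field_simps)
    then have "\<bar>poly p (1 / h)\<bar> * exp (- (1 / h)) \<le> C * exp (1 / h) * h\<^sup>2 * exp (- (1 / h))"
      by (rule mult_right_mono) simp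
    also have "\<dots> = C * h\<^sup>2 * (exp (1 / h) * exp (- (1 / h)))"
      by (simp only: mult_ac)
    also have "exp (1 / h) * exp (- (1 / h)) = 1"
      by (simp add: exp_add[symmetric])
    finally show ?thesis
      using True by (simp add: flat_def abs_mult)
  qed (use C(1) in \<open>simp add: flat_def\<close>)
  have "(flat p has_real_derivative 0) (at 0)"
    unfolding DERIV_def
  proof (rule tendsto_rabs_zero_cancel, rule tendsto_sandwich)
    show "\<forall>\<^sub>F h in at 0. 0 \<le> \<bar>(flat p (0 + h) - flat p 0) / h\<bar>"
      by simp
    show "\<forall>\<^sub>F h in at 0. \<bar>(flat p (0 + h) - flat p 0) / h\<bar> \<le> C * \<bar>h\<bar>"
    proof (rule eventually_at_filter[THEN iffD2], rule always_eventually, intro allI impI)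
      fix h :: real assume "h \<noteq> 0"
      then show "\<bar>(flat p (0 + h) - flat p 0) / h\<bar> \<le> C * \<bar>h\<bar>"
        using bound[of h] by (simp add: flat_def[of p 0] pos_divide_le_eq power2_eq_square abs_mult_self_eq mult.assoc)
    qed
    show "((\<lambda>h. C * \<bar>h\<bar>) \<longlongrightarrow> 0) (at 0)"
      by (auto intro!: tendsto_eq_intros)
  qed simp
  then show ?thesis
    using equal by (simp add: flat_def)
qed

lemma has_derivative_fst_comp:
  assumes "(f has_real_derivative f') (at (a * fst z + b))"
  shows "((\<lambda>z :: real \<times> real. C * of_real (f (a * fst z + b)) :: complex) has_derivative
    (\<lambda>h. C * of_real (f' * (a * fst h)))) (at z)"
proof -
  have "((\<lambda>z. a * fst z + b) has_derivative (\<lambda>h. a * fst h)) (at z)"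
    by (auto intro!: derivative_eq_intros)
  from diff_chain_at[OF this, of f "\<lambda>h. f' * h"] assms
  have "((\<lambda>z. f (a * fst z + b)) has_derivative (\<lambda>h. f' * (a * fst h))) (at z)"
    by (simp add: o_def has_field_derivative_def)
  then show ?thesis
    by (intro has_derivative_mult_right has_derivative_of_real)
qed

lemma smoothI:
  assumes "\<And>z. f differentiable (at z)" "smooth (partial_x f)" "smooth (partial_y f)"
  shows "smooth f"
proof -
  have "derivs_in (\<lambda>_. True) (\<lambda>_ :: unit. f)"
  proof (rule derivs_in_coinduct[where S = "\<lambda>F. F = (\<lambda>_. f) \<or> smooth (F ())"])
    fix F :: "unit \<Rightarrow> fnM" assume "F = (\<lambda>_. f) \<or> smooth (F ())"
    then show "(\<forall>i z. F i differentiable at z) \<and> True \<and>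
        (\<forall>u\<in>Basis. (\<lambda>i. partial u (F i)) = (\<lambda>_. f) \<or> smooth (partial u (F ())))"
    proof
      assume F: "F = (\<lambda>_. f)"
      have "smooth (partial u f)" if "u \<in> Basis" for u
        using that assms(2,3) by (auto simp: Basis_plane)
      then show ?thesis
        unfolding F using assms(1) by blast
    next
      assume F: "smooth (F ())"
      have "smooth (partial u (F ()))" if "u \<in> Basis" for u
        by (rule smooth_partial[OF F that])
      moreover have "F i differentiable at z" for i z
        using smooth_differentiable[OF F] by (cases i) simp
      ultimately show ?thesis
        by blast
    qed
  qed simp
  then show ?thesis
    by (simp add: smooth_iff_derivs_in)
qed

lemma smooth_const: "smooth (\<lambda>_. a)"
  unfolding smooth_iff_derivs_in
proof (rule derivs_in_coinduct[where S = "\<lambda>F. \<exists>a. F = (\<lambda>_ _. a)"])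
  fix F :: "unit \<Rightarrow> fnM" assume "\<exists>a. F = (\<lambda>_ _. a)"
  then obtain a where F: "F = (\<lambda>_ _. a)" ..
  show "(\<forall>i z. F i differentiable at z) \<and> True \<and> (\<forall>u\<in>Basis. \<exists>a. (\<lambda>i. partial u (F i)) = (\<lambda>_ _. a))"
    by (auto simp: F partial_def fun_eq_iff)
qed blast

lemma smooth_flat: "smooth (\<lambda>z. of_real (flat p (a * fst z + b)))"
  unfolding smooth_iff_derivs_in
proof (rule derivs_in_coinduct[where S = "\<lambda>F. \<exists>C p. F = (\<lambda>_ z. C * of_real (flat p (a * fst z + b)))"])
  show "\<exists>C q. (\<lambda>_ z. of_real (flat p (a * fst z + b))) = (\<lambda>_ z. C * of_real (flat q (a * fst z + b)))"
    by (intro exI[of _ 1] exI[of _ p]) simp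
  fix F :: "unit \<Rightarrow> fnM" assume "\<exists>C p. F = (\<lambda>_ z. C * of_real (flat p (a * fst z + b)))"
  then obtain C p where F: "F = (\<lambda>_ z. C * of_real (flat p (a * fst z + b)))"
    by (elim exE)
  define q where "q = [:0, 0, 1:] * (p - pderiv p)"
  have d: "(F i has_derivative (\<lambda>h. C * of_real (flat q (a * fst z + b) * (a * fst h)))) (at z)" for i z
    unfolding F q_def by (rule has_derivative_fst_comp[OF has_derivative_flat])
  have "\<exists>C p. (\<lambda>i. partial u (F i)) = (\<lambda>_ z. C * of_real (flat p (a * fst z + b)))" if "u \<in> Basis" for u
    by (rule exI[of _ "C * of_real (a * fst u)"], rule exI[of _ q], intro ext)
      (simp add: partial_eqI[OF d])
  moreover have "F i differentiable at z" for i z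
    by (rule differentiableI[OF d])
  ultimately show "(\<forall>i z. F i differentiable at z) \<and> True \<and>
      (\<forall>u\<in>Basis. \<exists>C p. (\<lambda>i. partial u (F i)) = (\<lambda>_ z. C * of_real (flat p (a * fst z + b))))"
    by (intro conjI allI ballI TrueI)
qed

text \<open>
  A smooth step is a normalised antiderivative of \<open>exp(-1/t) exp(-1/(1-t))\<close>; integrating avoids
  having to prove smoothness of quotients.
\<close>

lemma smooth_step_exists:
  obtains s :: "real \<Rightarrow> real" where
    "\<And>a b. smooth (\<lambda>z. of_real (s (a * fst z + b)))" "\<And>t. t \<le> 0 \<Longrightarrow> s t = 0" "\<And>t. t \<ge> 1 \<Longrightarrow> s t = 1"
proof -
  define g where "g t = flat 1 t * flat 1 (1 - t)" for t
  have cont: "isCont g t" for t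
  proof -
    have c: "isCont (flat 1) t" for t
      by (rule DERIV_isCont[OF has_derivative_flat])
    show ?thesis
      unfolding g_def by (intro continuous_intros continuous_at_compose[unfolded o_def, OF _ c] isCont_o2[OF _ c] c)
  qed
  obtain F where F: "\<And>t. (F has_real_derivative g t) (at t)"
    using einterval_antiderivative[of "-\<infinity>" "\<infinity>" g] cont
    by (auto simp: has_real_derivative_iff_has_vector_derivative)
  have g0: "g t = 0" if "t \<le> 0 \<or> t \<ge> 1" for t
    using that by (auto simp: g_def flat_def)
  have gpos: "g t > 0" if "0 < t" "t < 1" for t
    using that by (simp add: g_def flat_def)
  have contF: "continuous_on S F" for S
    by (rule DERIV_continuous_on[of _ F g]) (rule has_field_derivative_at_within[OF F])
  have const: "F t = F r" if "t \<le> r" "\<And>x. t < x \<Longrightarrow> x < r \<Longrightarrow> g x = 0" for t r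
  proof (cases "t = r")
    case False
    then have "t < r" using that by simp
    have "DERIV F x :> 0" if "t < x" "x < r" for x
      using F[of x] \<open>\<And>x. t < x \<Longrightarrow> x < r \<Longrightarrow> g x = 0\<close>[OF that] by simp
    from DERIV_isconst_end[OF \<open>t < r\<close> contF this] show ?thesis
      by simp
  qed simp
  have "F 0 < F 1"
    by (rule DERIV_pos_imp_increasing_open[of 0 1 F])
      (use F gpos contF in \<open>auto intro!: exI\<close>)
  define s where "s t = (F t - F 0) / (F 1 - F 0)" for t
  have ds: "(s has_real_derivative g t / (F 1 - F 0)) (at t)" for t
    unfolding s_def using \<open>F 0 < F 1\<close> by (auto intro!: derivative_eq_intros F)
  show ?thesis
  proof (rule that[of s])
    show "s t = 0" if "t \<le> 0" for t
      using const[of t 0] g0 that by (simp add: s_def)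
    show "s t = 1" if "t \<ge> 1" for t
      using const[of 1 t] g0 that \<open>F 0 < F 1\<close> by (simp add: s_def)
    fix a b
    let ?f = "\<lambda>z :: real \<times> real. of_real (s (a * fst z + b)) :: complex"
    have d: "(?f has_derivative (\<lambda>h. of_real (g (a * fst z + b) / (F 1 - F 0) * (a * fst h)))) (at z)" for z
      using has_derivative_fst_comp[OF ds, where a = a and b = b and z = z and C = 1] by simp
    show "smooth ?f"
    proof (rule smoothI)
      show "?f differentiable (at z)" for z
        by (rule differentiableI[OF d])
      have "smooth (\<lambda>z. of_real (a / (F 1 - F 0)) *
          (of_real (flat 1 (a * fst z + b)) * of_real (flat 1 ((- a) * fst z + (1 - b)))))"
        by (intro smooth_cmult smooth_mult smooth_flat)
      moreover have "partial_x ?f = (\<lambda>z. of_real (a / (F 1 - F 0)) *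
          (of_real (flat 1 (a * fst z + b)) * of_real (flat 1 ((- a) * fst z + (1 - b)))))"
      proof
        fix z :: "real \<times> real"
        have arg: "1 - (a * fst z + b) = (- a) * fst z + (1 - b)" by simp
        have "g (a * fst z + b) = flat 1 (a * fst z + b) * flat 1 ((- a) * fst z + (1 - b))"
          unfolding g_def arg by (rule refl)
        then show "partial_x ?f z = of_real (a / (F 1 - F 0)) *
          (of_real (flat 1 (a * fst z + b)) * of_real (flat 1 ((- a) * fst z + (1 - b))))"
          unfolding partial_eqI[OF d] by simp
      qed
      ultimately show "smooth (partial_x ?f)"
        by (simp only:)
      have "partial_y ?f = (\<lambda>_. 0)"
        by (rule ext) (simp add: partial_eqI[OF d])
      then show "smooth (partial_y ?f)"
        by (simp only: smooth_const)
    qed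
  qed
qed

definition step :: "real \<Rightarrow> real" where
  "step = (SOME s. (\<forall>a b. smooth (\<lambda>z. of_real (s (a * fst z + b)))) \<and> (\<forall>t\<le>0. s t = 0) \<and> (\<forall>t\<ge>1. s t = 1))"

lemma step:
  "smooth (\<lambda>z. of_real (step (a * fst z + b)))" "t \<le> 0 \<Longrightarrow> step t = 0" "t \<ge> 1 \<Longrightarrow> step t = 1"
proof -
  have "\<exists>s. (\<forall>a b. smooth (\<lambda>z. of_real (s (a * fst z + b)))) \<and> (\<forall>t\<le>0. s t = 0) \<and> (\<forall>t\<ge>1. s t = (1 :: real))"
    using smooth_step_exists by metis
  from someI_ex[OF this, folded step_def]
  show "smooth (\<lambda>z. of_real (step (a * fst z + b)))" "t \<le> 0 \<Longrightarrow> step t = 0" "t \<ge> 1 \<Longrightarrow> step t = 1"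
    by blast+
qed

text \<open>
  The function \<open>hat h x\<^sub>0\<close> is supported in \<open>[x\<^sub>0, x\<^sub>0 + 2h]\<close>, and its translates by multiples of \<open>h\<close> telescope to
  \<open>1\<close>; \<open>plateau h x\<^sub>0\<close> is \<open>1\<close> there and supported in \<open>[x\<^sub>0 - h, x\<^sub>0 + 3h]\<close>.
\<close>

definition hat :: "real \<Rightarrow> real \<Rightarrow> fnM" where
  "hat h x0 z = of_real (step ((fst z - x0) / h) - step ((fst z - x0) / h - 1))"

definition plateau :: "real \<Rightarrow> real \<Rightarrow> fnM" where
  "plateau h x0 z = of_real (step ((fst z - x0) / h + 1) - step ((fst z - x0) / h - 2))"

lemma partial_eq_0:
  assumes "open S" "z \<in> S" "\<And>w. w \<in> S \<Longrightarrow> f w = 0"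
  shows "partial u f z = 0"
proof -
  have "((\<lambda>_. 0) has_derivative (\<lambda>_. 0)) (at z)" by simp
  then have "(f has_derivative (\<lambda>_. 0)) (at z)"
    by (rule has_derivative_transform_within_open[OF _ assms(1,2)]) (simp add: assms(3))
  then show ?thesis
    by (rule partial_eqI)
qed

text \<open>
  Independence of \<open>y\<close> reduces the Schwartz bounds to a compact interval in \<open>x\<close>, and is
  inherited by all derivatives.
\<close>

lemma compactly_supported_Xi:
  assumes "smooth f" "\<And>x y. f (x, y) = f (x, 0)" "\<And>z. R < \<bar>fst z\<bar> \<Longrightarrow> f z = 0"
  shows "f \<in> Xi"
proof -
  let ?S = "\<lambda>F :: unit \<Rightarrow> fnM. smooth (F ()) \<and> (\<forall>x y. F () (x, y) = F () (x, 0)) \<and> (\<forall>z. R < \<bar>fst z\<bar> \<longrightarrow> F () z = 0)"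
  have "derivs_in schwartz (\<lambda>_ :: unit. f)"
  proof (rule derivs_in_coinduct[where S = ?S])
    show "?S (\<lambda>_. f)"
      using assms by simp
    fix F :: "unit \<Rightarrow> fnM" assume "?S F"
    then have F: "smooth (F ())" "\<And>x y. F () (x, y) = F () (x, 0)" "\<And>z. R < \<bar>fst z\<bar> \<Longrightarrow> F () z = 0"
      by blast+
    have d: "F i differentiable (at z)" for i z
      using smooth_differentiable[OF F(1)] by (cases i) simp
    have P: "?S (\<lambda>i. partial u (F i))" if u: "u \<in> Basis" for u
    proof (intro conjI allI impI)
      show "smooth (partial u (F ()))"
        by (rule smooth_partial[OF F(1) u])
      fix x y
      have *: "(\<lambda>z. F () (z + (0, y))) = F ()"
      proof
        fix z :: "real \<times> real"
        obtain a b where z: "z = (a, b)" by (cases z)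
        show "F () (z + (0, y)) = F () z"
          using F(2)[of a "b + y"] F(2)[of a b] by (simp add: z)
      qed
      have "partial u (F ()) (x, 0) = partial u (\<lambda>z. F () (z + (0, y))) (x, 0)"
        by (simp only: *)
      also have "\<dots> = partial u (F ()) ((x, 0) + (0, y))"
        by (rule partial_shift[OF d])
      finally show "partial u (F ()) (x, y) = partial u (F ()) (x, 0)"
        by simp
    next
      fix z :: "real \<times> real" assume z: "R < \<bar>fst z\<bar>"
      show "partial u (F ()) z = 0"
      proof (rule partial_eq_0[of "{z. R < \<bar>fst z\<bar>}"])
        show "open {z :: real \<times> real. R < \<bar>fst z\<bar>}"
          by (intro open_Collect_less continuous_intros)
      qed (use z F(3) in auto)
    qed
    have "schwartz F"
      unfolding schwartz_def
    proof
      fix n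
      have "continuous_on {-R..R} (\<lambda>x. of_real (jb x ^ n) * F () (x, 0))"
        unfolding jb_def
        by (intro continuous_intros continuous_on_slices(2) smooth_continuous F(1))
      then have "compact ((\<lambda>x. of_real (jb x ^ n) * F () (x, 0)) ` {-R..R})"
        by (rule compact_continuous_image) simp
      then obtain C where C: "\<And>x. x \<in> {-R..R} \<Longrightarrow> norm (of_real (jb x ^ n) * F () (x, 0)) \<le> C"
        by (force dest: compact_imp_bounded simp: bounded_iff)
      have "jb (fst z) ^ n * norm (F () z) \<le> max 0 C" for z
      proof (cases "R < \<bar>fst z\<bar>")
        case True
        then show ?thesis
          using F(3) by simp
      next
        case False
        have "F () z = F () (fst z, 0)"
          using F(2)[of "fst z" "snd z"] by simp
        moreover have "fst z \<in> {-R..R}"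
          using False by auto
        ultimately show ?thesis
          using C[of "fst z"] by (simp add: norm_mult norm_power le_max_iff_disj)
      qed
      then show "\<exists>C. \<forall>z. jb (fst z) ^ n * norm (F () z) \<le> C"
        by (intro exI[of _ "max 0 C"]) simp
    qed
    then show "(\<forall>i z. F i differentiable (at z)) \<and> schwartz F \<and> (\<forall>u\<in>Basis. ?S (\<lambda>i. partial u (F i)))"
      by (intro conjI[OF _ conjI] allI ballI d P)
  qed
  moreover have "periodic_y f"
    unfolding periodic_y_def
  proof (intro allI)
    fix x y
    show "f (x, y + 1) = f (x, y)"
      using assms(2)[of x "y + 1"] assms(2)[of x y] by simp
  qed
  ultimately show ?thesis
    by (simp add: Xi_iff)
qed

lemma smooth_step_diff: "smooth (\<lambda>z. of_real (step ((fst z - x0) / h + r) - step ((fst z - x0) / h + t)))"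
proof -
  have *: "(x - x0) / h + r = (1 / h) * x + (r - x0 / h)" for x r
    by (simp add: diff_divide_distrib)
  have "smooth (\<lambda>z. of_real (step ((1 / h) * fst z + (r - x0 / h))) + (- 1) * of_real (step ((1 / h) * fst z + (t - x0 / h))))"
    by (intro smooth_add smooth_cmult step)
  then show ?thesis
    by (simp add: *)
qed

lemma hat_eq_0: "h > 0 \<Longrightarrow> fst z \<le> x0 \<or> x0 + 2 * h \<le> fst z \<Longrightarrow> hat h x0 z = 0"
  by (auto simp: hat_def step(2,3) field_simps divide_nonpos_pos)

lemma plateau_eq_0: "h > 0 \<Longrightarrow> fst z \<le> x0 - h \<or> x0 + 3 * h \<le> fst z \<Longrightarrow> plateau h x0 z = 0"
  by (auto simp: plateau_def step(2,3) field_simps)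

lemma plateau_eq_1: "h > 0 \<Longrightarrow> x0 \<le> fst z \<Longrightarrow> fst z \<le> x0 + 2 * h \<Longrightarrow> plateau h x0 z = 1"
  by (simp add: plateau_def step(2,3) field_simps)

lemma hat_Xi: "h > 0 \<Longrightarrow> hat h x0 \<in> Xi"
proof (rule compactly_supported_Xi)
  show "smooth (hat h x0)"
    using smooth_step_diff[of x0 h 0 "- 1"] unfolding hat_def by simp
  show "hat h x0 z = 0" if "h > 0" "\<bar>x0\<bar> + 2 * h < \<bar>fst z\<bar>" for z
    using that by (intro hat_eq_0) auto
qed (simp add: hat_def)

lemma plateau_Xi: "h > 0 \<Longrightarrow> plateau h x0 \<in> Xi"
proof (rule compactly_supported_Xi)
  show "smooth (plateau h x0)"
    using smooth_step_diff[of x0 h 1 "- 2"] unfolding plateau_def by simp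
  show "plateau h x0 z = 0" if "h > 0" "\<bar>x0\<bar> + 3 * h < \<bar>fst z\<bar>" for z
    using that by (intro plateau_eq_0) auto
qed (simp add: plateau_def)

lemma sum_hat:
  assumes "h > 0"
  shows "((\<lambda>m :: int. hat h (of_int m * h) z) has_sum 1) UNIV"
proof -
  define t where "t = fst z / h"
  define f where "f = \<lfloor>t\<rfloor>"
  have f: "of_int f \<le> t" "t < of_int f + 1"
    unfolding f_def by linarith+
  have eq: "hat h (of_int m * h) z = of_real (step (t - of_int m) - step (t - of_int m - 1))" for m
    using assms by (simp add: hat_def t_def diff_divide_distrib)
  have "hat h (of_int m * h) z = 0" if "m \<notin> {f - 1, f}" for m
  proof -
    from that consider "m \<le> f - 2" | "f + 1 \<le> m"
      by force
    then show ?thesis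
    proof cases
      case 1
      then have "of_int m \<le> (of_int f - 2 :: real)" by linarith
      then show ?thesis using f by (simp add: eq step)
    next
      case 2
      then have "of_int f + 1 \<le> (of_int m :: real)" by linarith
      then show ?thesis using f by (simp add: eq step)
    qed
  qed
  moreover have "(\<Sum>m\<in>{f - 1, f}. hat h (of_int m * h) z) = 1"
    using f by (simp add: eq step)
  ultimately show ?thesis
    using has_sum_finite_neutralI[of "{f - 1, f}" UNIV "\<lambda>m. hat h (of_int m * h) z" 1] by simp
qed


section \<open>Endomorphisms of the bimodule are elements of \<open>E\<close>\<close>

lemma E_alg_derivs: "\<Psi> \<in> E_alg c \<mu> \<nu> \<Longrightarrow> derivs_in (loc_rapid (\<lambda>p. jb (of_int p))) \<Psi>"
  by (simp add: E_alg_iff)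

lemma E_alg_smooth: "\<Psi> \<in> E_alg c \<mu> \<nu> \<Longrightarrow> smooth (\<Psi> p)"
  by (rule derivs_in_smooth[OF E_alg_derivs])

lemma E_alg_periodic: "\<Psi> \<in> E_alg c \<mu> \<nu> \<Longrightarrow> periodic_y (\<Psi> p)"
  by (simp add: E_alg_iff)

lemma E_alg_equivariant:
  "\<Psi> \<in> E_alg c \<mu> \<nu> \<Longrightarrow> e (of_int (c * p * k) * (y - of_int k * \<nu>))
     * \<Psi> p (x - 2 * of_int k * \<mu>, y - 2 * of_int k * \<nu>) = \<Psi> p (x, y)"
  unfolding E_alg_iff by blast

lemma E_alg_add:
  assumes "\<Phi> \<in> E_alg c \<mu> \<nu>" "\<Psi> \<in> E_alg c \<mu> \<nu>"
  shows "(\<lambda>p z. \<Phi> p z + \<Psi> p z) \<in> E_alg c \<mu> \<nu>"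
  unfolding E_alg_iff
proof (intro conjI allI)
  show "derivs_in (loc_rapid (\<lambda>p. jb (of_int p))) (\<lambda>p z. \<Phi> p z + \<Psi> p z)"
    by (rule derivs_in_rapid_add[OF _ E_alg_derivs[OF assms(1)] E_alg_derivs[OF assms(2)]]) simp
  show "periodic_y (\<lambda>z. \<Phi> p z + \<Psi> p z)" for p
    using E_alg_periodic[OF assms(1), of p] E_alg_periodic[OF assms(2), of p]
    by (simp add: periodic_y_def)
  show "e (of_int (c * p * k) * (y - of_int k * \<nu>)) *
      (\<Phi> p (x - 2 * of_int k * \<mu>, y - 2 * of_int k * \<nu>) + \<Psi> p (x - 2 * of_int k * \<mu>, y - 2 * of_int k * \<nu>)) =
      \<Phi> p (x, y) + \<Psi> p (x, y)" for k p x y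
    by (simp only: distrib_left E_alg_equivariant[OF assms(1)] E_alg_equivariant[OF assms(2)])
qed

lemma E_alg_cmult:
  assumes "\<Phi> \<in> E_alg c \<mu> \<nu>"
  shows "(\<lambda>p z. a * \<Phi> p z) \<in> E_alg c \<mu> \<nu>"
  unfolding E_alg_iff
proof (intro conjI allI)
  show "derivs_in (loc_rapid (\<lambda>p. jb (of_int p))) (\<lambda>p z. a * \<Phi> p z)"
    by (rule derivs_in_rapid_cmult[OF _ E_alg_derivs[OF assms(1)]]) simp
  show "periodic_y (\<lambda>z. a * \<Phi> p z)" for p
    using E_alg_periodic[OF assms(1), of p] by (simp add: periodic_y_def)
  show "e (of_int (c * p * k) * (y - of_int k * \<nu>)) *
      (a * \<Phi> p (x - 2 * of_int k * \<mu>, y - 2 * of_int k * \<nu>)) = a * \<Phi> p (x, y)" for k p x y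
    using E_alg_equivariant[OF assms(1), of p k y x] by (simp add: mult.left_commute)
qed

lemma Id_E_in_E_alg: "Id_E \<in> E_alg c \<mu> \<nu>"
  unfolding E_alg_iff
proof (intro conjI allI)
  have "derivs_in (loc_rapid (\<lambda>p. jb (of_int p))) (\<lambda>p (_ :: real \<times> real). if p = 0 then 1 else 0)"
  proof (rule derivs_in_coinduct[where S = "\<lambda>F. \<exists>b. F = (\<lambda>p _. if p = (0 :: int) then b else 0)"])
    fix F :: fnMZ assume "\<exists>b. F = (\<lambda>p _. if p = 0 then b else 0)"
    then obtain b where F: "F = (\<lambda>p _. if p = 0 then b else 0)" ..
    have "\<exists>b. (\<lambda>i. partial u (F i)) = (\<lambda>p _. if p = 0 then b else 0)" for u
      by (rule exI[of _ 0]) (simp add: F partial_def fun_eq_iff)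
    moreover have "loc_rapid (\<lambda>p. jb (of_int p)) F"
    proof (rule loc_rapidI)
      fix K :: "(real \<times> real) set" and n
      show "\<exists>C. \<forall>i. \<forall>z\<in>K. jb (of_int i) ^ n * norm (F i z) \<le> C"
        by (rule exI[of _ "norm b"]) (simp add: F jb_def)
    qed
    ultimately show "(\<forall>i z. F i differentiable (at z)) \<and> loc_rapid (\<lambda>p. jb (of_int p)) F \<and>
        (\<forall>u\<in>Basis. \<exists>b. (\<lambda>i. partial u (F i)) = (\<lambda>p _. if p = 0 then b else 0))"
      by (simp add: F)
  qed blast
  then show "derivs_in (loc_rapid (\<lambda>p. jb (of_int p))) Id_E"
    by (simp only: Id_E_def[abs_def])
  show "periodic_y (Id_E p)" for p
    by (simp add: periodic_y_def Id_E_def)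
  show "e (of_int (c * p * k) * (y - of_int k * \<nu>)) *
      Id_E p (x - 2 * of_int k * \<mu>, y - 2 * of_int k * \<nu>) = Id_E p (x, y)" for k p x y
    by (simp add: Id_E_def e_def)
qed

subsection \<open>A fundamental domain\<close>

definition E_square :: "real \<Rightarrow> (real \<times> real) set" where
  "E_square \<mu> = cbox (- (2 * \<bar>\<mu>\<bar>), 0) (2 * \<bar>\<mu>\<bar>, 1)"

lemma compact_E_square: "compact (E_square \<mu>)"
  by (simp add: E_square_def)

lemma E_square_reduce:
  assumes "\<mu> \<noteq> 0"
  obtains k m :: int where "(x - 2 * of_int k * \<mu>, y - 2 * of_int k * \<nu> - of_int m) \<in> E_square \<mu>"
proof -
  define k where "k = \<lfloor>x / (2 * \<mu>)\<rfloor>"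
  define m where "m = \<lfloor>y - 2 * of_int k * \<nu>\<rfloor>"
  have "x / (2 * \<mu>) - of_int k \<in> {0..1}"
    unfolding k_def by (rule floor_in_unit)
  moreover have "x - 2 * of_int k * \<mu> = 2 * \<mu> * (x / (2 * \<mu>) - of_int k)"
    using assms by (simp add: field_simps)
  ultimately have "\<bar>x - 2 * of_int k * \<mu>\<bar> \<le> 2 * \<bar>\<mu>\<bar> * 1"
    by (simp only: abs_mult) (rule mult_mono, simp_all)
  then have "(x - 2 * of_int k * \<mu>, y - 2 * of_int k * \<nu> - of_int m) \<in> E_square \<mu>"
    using floor_in_unit[of "y - 2 * of_int k * \<nu>"]
    by (simp add: E_square_def cbox_Pair_eq m_def abs_le_iff)
  then show ?thesis
    by (rule that)
qed

text \<open>
  The phases have modulus one, so \<open>\<bar>\<Psi>\<bar>\<close> is a function on a torus and its bounds on a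
  fundamental domain are global.
\<close>

lemma E_alg_global_bound:
  assumes \<mu>: "\<mu> \<noteq> 0" and \<Psi>: "\<Psi> \<in> E_alg c \<mu> \<nu>"
  obtains C where "0 \<le> C" "\<And>p z. jb (of_int p) ^ n * norm (\<Psi> p z) \<le> C"
proof -
  obtain C where C: "0 \<le> C" "\<And>p z. z \<in> E_square \<mu> \<Longrightarrow> jb (of_int p) ^ n * norm (\<Psi> p z) \<le> C"
    using loc_rapidE[OF derivs_in_base[OF E_alg_derivs[OF \<Psi>]] compact_E_square] by metis
  show ?thesis
  proof (rule that[OF C(1)])
    fix p and z :: "real \<times> real"
    obtain x y where z: "z = (x, y)" by (cases z)
    obtain k m where km: "(x - 2 * of_int k * \<mu>, y - 2 * of_int k * \<nu> - of_int m) \<in> E_square \<mu>"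
      by (rule E_square_reduce[OF \<mu>])
    have "norm (\<Psi> p z) = norm (\<Psi> p (x - 2 * of_int k * \<mu>, y - 2 * of_int k * \<nu>))"
      unfolding z E_alg_equivariant[OF \<Psi>, of p k y x, symmetric] by (simp add: norm_mult)
    also have "\<dots> = norm (\<Psi> p (x - 2 * of_int k * \<mu>, y - 2 * of_int k * \<nu> - of_int m))"
      using periodic_y_int[OF E_alg_periodic[OF \<Psi>], of p "x - 2 * of_int k * \<mu>" "y - 2 * of_int k * \<nu>" "- m"]
      by simp
    finally show "jb (of_int p) ^ n * norm (\<Psi> p z) \<le> C"
      using C(2)[OF km, of p] by simp
  qed
qed

text \<open>
  In degree zero there is no phase: the coefficient and all its derivatives live on a torus, so
  multiplication by it preserves the Schwartz space.
\<close>

lemma E_alg_0_slow: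
  assumes \<mu>: "\<mu> \<noteq> 0" and \<Psi>: "\<Psi> \<in> E_alg c \<mu> \<nu>"
  shows "derivs_in slow (\<lambda>_. \<Psi> 0)"
proof -
  let ?S = "\<lambda>F :: unit \<Rightarrow> fnM. smooth (F ()) \<and> periodic_y (F ()) \<and>
    (\<forall>k z. F () (z + (- (2 * of_int k * \<mu>), - (2 * of_int k * \<nu>))) = F () z)"
  show ?thesis
  proof (rule derivs_in_coinduct[where S = ?S])
    have "\<Psi> 0 (z + (- (2 * of_int k * \<mu>), - (2 * of_int k * \<nu>))) = \<Psi> 0 z" for k z
      using E_alg_equivariant[OF \<Psi>, of 0 k "snd z" "fst z"] by (cases z) (simp add: e_def)
    then show "?S (\<lambda>_. \<Psi> 0)"
      using E_alg_smooth[OF \<Psi>] E_alg_periodic[OF \<Psi>] by blast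
    fix F :: "unit \<Rightarrow> fnM" assume "?S F"
    then have F: "smooth (F ())" "periodic_y (F ())"
      "\<And>k z. F () (z + (- (2 * of_int k * \<mu>), - (2 * of_int k * \<nu>))) = F () z"
      by blast+
    have d: "F i differentiable (at z)" for i z
      using smooth_differentiable[OF F(1)] by (cases i) simp
    have P: "?S (\<lambda>i. partial u (F i))" if u: "u \<in> Basis" for u
    proof (intro conjI allI)
      show "smooth (partial u (F ()))" "periodic_y (partial u (F ()))"
        by (rule smooth_partial[OF F(1) u], rule periodic_partial[OF F(1,2)])
      fix k z
      let ?a = "(- (2 * of_int k * \<mu>), - (2 * of_int k * \<nu>))"
      have "partial u (F ()) (z + ?a) = partial u (\<lambda>z. F () (z + ?a)) z"
        by (rule partial_shift[OF d, symmetric])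
      also have "(\<lambda>z. F () (z + ?a)) = F ()"
        by (rule ext) (rule F(3))
      finally show "partial u (F ()) (z + ?a) = partial u (F ()) z" .
    qed
    have "compact (F () ` E_square \<mu>)"
      by (rule compact_continuous_image[OF smooth_continuous[OF F(1)] compact_E_square])
    then obtain C where C: "\<And>z. z \<in> E_square \<mu> \<Longrightarrow> norm (F () z) \<le> C"
      by (force dest: compact_imp_bounded simp: bounded_iff)
    have "norm (F () z) \<le> C * jb (fst z) ^ 0" for z
    proof -
      obtain x y where z: "z = (x, y)" by (cases z)
      obtain k m where km: "(x - 2 * of_int k * \<mu>, y - 2 * of_int k * \<nu> - of_int m) \<in> E_square \<mu>"
        by (rule E_square_reduce[OF \<mu>])
      have "F () z = F () (x - 2 * of_int k * \<mu>, y - 2 * of_int k * \<nu>)"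
        using F(3)[of z k] by (simp add: z)
      also have "\<dots> = F () (x - 2 * of_int k * \<mu>, y - 2 * of_int k * \<nu> - of_int m)"
        using periodic_y_int[OF F(2), of "x - 2 * of_int k * \<mu>" "y - 2 * of_int k * \<nu>" "- m"] by simp
      finally show ?thesis
        using C[OF km] by simp
    qed
    then have "slow F"
      unfolding slow_def by (intro exI[of _ 0] exI[of _ C] allI)
    then show "(\<forall>i z. F i differentiable (at z)) \<and> slow F \<and> (\<forall>u\<in>Basis. ?S (\<lambda>i. partial u (F i)))"
      by (intro conjI[OF _ conjI] allI ballI d P)
  qed
qed


subsection \<open>The left action\<close>

lemma act_L_eq: "act_L \<Psi> f = (\<lambda>z. \<Sum>\<^sub>\<infinity>q. cnj (\<Psi> q z) * f (z + (of_int q, 0)))"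
  by (rule ext) (simp add: act_L_def case_prod_beta' plus_prod_def)

lemma act_L_loc_summable:
  assumes "loc_rapid (\<lambda>p. jb (of_int p)) \<Psi>" "f \<in> Xi"
  shows "loc_summable (\<lambda>q z. cnj (\<Psi> q z) * f (z + (of_int q, 0)))"
  unfolding loc_summable_def
proof (intro allI impI)
  fix K :: "(real \<times> real) set" assume K: "compact K"
  obtain A where A: "0 \<le> A" "\<And>q z. z \<in> K \<Longrightarrow> jb (of_int q) ^ 2 * norm (\<Psi> q z) \<le> A"
    using loc_rapidE[OF assms(1) K] by metis
  obtain B where B: "0 \<le> B" "\<And>z. jb (fst z) ^ 0 * norm (f z) \<le> B"
    using Xi_bounded[OF assms(2)] by metis
  have "norm (cnj (\<Psi> q z) * f (z + (of_int q, 0))) \<le> (A * B) * wgt q" if "z \<in> K" for q z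
  proof -
    have "norm (cnj (\<Psi> q z) * f (z + (of_int q, 0))) * jb (of_int q) ^ 2 =
        (jb (of_int q) ^ 2 * norm (\<Psi> q z)) * (jb (fst (z + (of_int q, 0))) ^ 0 * norm (f (z + (of_int q, 0))))"
      by (simp add: norm_mult)
    also have "\<dots> \<le> A * B"
      by (intro mult_mono A B that) simp_all
    finally show ?thesis
      by (rule wgt_boundI)
  qed
  then show "\<exists>C. \<forall>q. \<forall>z\<in>K. norm (cnj (\<Psi> q z) * f (z + (of_int q, 0))) \<le> C * wgt q"
    by (intro exI[of _ "A * B"]) simp
qed

lemma act_L_summable:
  assumes "\<Psi> \<in> E_alg c \<mu> \<nu>" "f \<in> Xi"
  shows "(\<lambda>q. cnj (\<Psi> q z) * f (z + (of_int q, 0))) summable_on UNIV"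
  by (rule loc_summable_summable[OF act_L_loc_summable[OF derivs_in_base[OF E_alg_derivs[OF assms(1)]] assms(2)]])

lemma act_L_lincomb:
  assumes "\<Phi> \<in> E_alg c \<mu> \<nu>" "\<Psi> \<in> E_alg c \<mu> \<nu>" "f \<in> Xi"
  shows "act_L (\<lambda>p z. a * \<Phi> p z + b * \<Psi> p z) f z = cnj a * act_L \<Phi> f z + cnj b * act_L \<Psi> f z"
proof -
  have "act_L (\<lambda>p z. a * \<Phi> p z + b * \<Psi> p z) f z =
      (\<Sum>\<^sub>\<infinity>q. cnj a * (cnj (\<Phi> q z) * f (z + (of_int q, 0))) + cnj b * (cnj (\<Psi> q z) * f (z + (of_int q, 0))))"
    by (simp add: act_L_eq algebra_simps)
  also have "\<dots> = cnj a * act_L \<Phi> f z + cnj b * act_L \<Psi> f z"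
    unfolding act_L_eq infsum_cmult_right'[symmetric]
    by (rule infsum_add) (intro summable_on_cmult_right act_L_summable[OF assms(1,3)],
        intro summable_on_cmult_right act_L_summable[OF assms(2,3)])
  finally show ?thesis .
qed

lemma infsum_single:
  assumes "\<And>k. k \<noteq> k0 \<Longrightarrow> f k = (0 :: complex)"
  shows "(\<Sum>\<^sub>\<infinity>k. f k) = f k0"
proof -
  have "(\<Sum>\<^sub>\<infinity>k. f k) = (\<Sum>\<^sub>\<infinity>k\<in>{k0}. f k)"
    by (rule infsum_cong_neutral) (use assms in auto)
  then show ?thesis by simp
qed

lemma act_L_Id: "act_L (\<lambda>p z. a * Id_E p z) f z = cnj a * f z"
proof -
  have "act_L (\<lambda>p z. a * Id_E p z) f z = cnj (a * Id_E 0 z) * f (z + (of_int 0, 0))"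
    unfolding act_L_eq by (rule infsum_single) (simp add: Id_E_def)
  then show ?thesis
    by (simp add: Id_E_def zero_prod_def[symmetric])
qed

text \<open>A bump concentrated near a point separates the Fourier coefficients of an element of \<open>E\<close>.\<close>

definition bump :: "real \<Rightarrow> fnM" where
  "bump x0 = plateau (1 / 4) (x0 - 1 / 4)"

lemma bump_Xi: "bump x0 \<in> Xi"
  unfolding bump_def by (rule plateau_Xi) simp

lemma bump_eq:
  assumes "fst z = x0 + of_int q"
  shows "bump x0 z = (if q = 0 then 1 else 0)"
proof (cases "q = 0")
  case True
  then show ?thesis
    using assms by (simp add: bump_def plateau_eq_1)
next
  case False
  then have "of_int q \<ge> (1 :: real) \<or> of_int q \<le> (- 1 :: real)"
    by linarith
  then have "bump x0 z = 0"
    unfolding bump_def using assms by (intro plateau_eq_0) auto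
  then show ?thesis
    using False by simp
qed

lemma act_L_bump:
  "act_L \<Psi> (bump (x + of_int q)) (x, y) = cnj (\<Psi> q (x, y))"
proof -
  have "act_L \<Psi> (bump (x + of_int q)) (x, y) =
      cnj (\<Psi> q (x, y)) * bump (x + of_int q) ((x, y) + (of_int q, 0))"
    unfolding act_L_eq
  proof (rule infsum_single)
    fix k assume "k \<noteq> q"
    have "bump (x + of_int q) ((x, y) + (of_int k, 0)) = 0"
      using bump_eq[of "(x, y) + (of_int k, 0)" "x + of_int q" "k - q"] \<open>k \<noteq> q\<close> by simp
    then show "cnj (\<Psi> k (x, y)) * bump (x + of_int q) ((x, y) + (of_int k, 0)) = 0"
      by simp
  qed
  also have "bump (x + of_int q) ((x, y) + (of_int q, 0)) = 1"
    using bump_eq[of "(x, y) + (of_int q, 0)" "x + of_int q" 0] by simp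
  finally show ?thesis by simp
qed

lemma act_L_inject:
  assumes "\<And>\<xi>. \<xi> \<in> Xi \<Longrightarrow> act_L \<Phi> \<xi> = act_L \<Psi> \<xi>"
  shows "\<Phi> = \<Psi>"
proof (intro ext)
  fix q and z :: "real \<times> real"
  obtain x y where z: "z = (x, y)" by (cases z)
  have "cnj (\<Phi> q (x, y)) = cnj (\<Psi> q (x, y))"
    unfolding act_L_bump[symmetric] by (simp only: assms[OF bump_Xi])
  then show "\<Phi> q z = \<Psi> q z"
    by (simp add: z)
qed

text \<open>The bimodule identity \<open>\<langle>f,g\<rangle>\<^sub>L\<cdot>h = f\<cdot>\<langle>g,h\<rangle>\<^sub>R\<close> interchanges the two summations.\<close>

lemma bimodule_identity:
  assumes \<mu>: "\<mu> \<noteq> 0" and "f \<in> Xi" "g \<in> Xi" "h \<in> Xi"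
  shows "act_L (inner_L c \<mu> \<nu> f g) h = act_R \<mu> \<nu> f (inner_R c \<mu> \<nu> g h)"
proof
  fix z :: "real \<times> real"
  obtain x y where z: "z = (x, y)" by (cases z)
  define t where "t q k = f (z + shift \<mu> \<nu> q) * e (of_int (c * k * q) * (y + of_int q * \<nu>)) *
      cnj (g (z + shift \<mu> \<nu> q + (of_int k, 0))) * h (z + (of_int k, 0))" for q k
  have L: "cnj (term_L c \<mu> \<nu> f g (k, - q) z) * h (z + (of_int k, 0)) = t q k" for q k
  proof -
    have "cnj (e (of_int (c * k * - q) * (y - of_int (- q) * \<nu>))) = e (of_int (c * k * q) * (y + of_int q * \<nu>))"
      by (simp add: e_minus[symmetric])
    moreover have "z + (- (2 * of_int (- q) * \<mu>), - (2 * of_int (- q) * \<nu>)) = z + shift \<mu> \<nu> q"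
      "z + (of_int k - 2 * of_int (- q) * \<mu>, - (2 * of_int (- q) * \<nu>)) = z + shift \<mu> \<nu> q + (of_int k, 0)"
      by (simp_all add: z shift_def)
    ultimately show ?thesis
      unfolding t_def term_L_def fst_conv snd_conv by (simp add: z mult_ac)
  qed
  have R: "f (z + shift \<mu> \<nu> q) * cnj (term_R c \<mu> \<nu> g h (q, k) (z + shift \<mu> \<nu> q)) = t q k" for q k
  proof -
    have "e (of_int (c * k * q) * (snd (z + shift \<mu> \<nu> q) - of_int q * \<nu>)) = e (of_int (c * k * q) * (y + of_int q * \<nu>))"
      by (simp add: z shift_def algebra_simps)
    moreover have "z + shift \<mu> \<nu> q + (of_int k - 2 * of_int q * \<mu>, - (2 * of_int q * \<nu>)) = z + (of_int k, 0)"
      by (simp add: z shift_def)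
    ultimately show ?thesis
      unfolding t_def term_R_def fst_conv snd_conv by (simp only: complex_cnj_mult complex_cnj_cnj mult_ac)
  qed
  have sm: "(\<lambda>(q, k). t q k) summable_on UNIV \<times> UNIV"
  proof -
    have F: "loc_rapid (\<lambda>q. jb (fst (shift \<mu> \<nu> q))) (\<lambda>q z. f (z + shift \<mu> \<nu> q))"
      by (rule derivs_in_base[OF Xi_shift_rapid[OF assms(2)]])
    have H: "loc_rapid (\<lambda>k :: int. jb (fst (of_int k :: real, 0 :: real))) (\<lambda>k z. h (z + (of_int k, 0)))"
      by (rule derivs_in_base[OF Xi_shift_rapid[OF assms(4)]])
    obtain A where A: "0 \<le> A" "\<And>q. jb (fst (shift \<mu> \<nu> q)) ^ 2 * norm (f (z + shift \<mu> \<nu> q)) \<le> A"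
      using loc_rapidE[OF F compact_sing[of z]] by (metis singletonI)
    obtain B where B: "0 \<le> B" "\<And>k. jb (of_int k) ^ 2 * norm (h (z + (of_int k, 0))) \<le> B"
      using loc_rapidE[OF H compact_sing[of z]] by (metis singletonI fst_conv)
    obtain G where G: "0 \<le> G" "\<And>z. jb (fst z) ^ 0 * norm (g z) \<le> G"
      using Xi_bounded[OF assms(3)] by metis
    let ?m = "(1 + 1 / \<bar>2 * \<mu>\<bar>) ^ 2"
    have f: "norm (f (z + shift \<mu> \<nu> q)) \<le> ?m * A * wgt q" for q
    proof -
      have "jb (of_int q) \<le> (1 + 1 / \<bar>2 * \<mu>\<bar>) * jb (fst (shift \<mu> \<nu> q))"
        using jb_scale[of "2 * \<mu>" "of_int q"] \<mu> by (simp add: shift_def mult_ac)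
      then have "jb (of_int q) ^ 2 \<le> ((1 + 1 / \<bar>2 * \<mu>\<bar>) * jb (fst (shift \<mu> \<nu> q))) ^ 2"
        by (rule power_mono) simp
      then have "jb (of_int q) ^ 2 * norm (f (z + shift \<mu> \<nu> q)) \<le>
          (?m * jb (fst (shift \<mu> \<nu> q)) ^ 2) * norm (f (z + shift \<mu> \<nu> q))"
        unfolding power_mult_distrib by (rule mult_right_mono) simp
      also have "\<dots> \<le> ?m * A"
        unfolding mult.assoc by (rule mult_left_mono[OF A(2)]) simp
      finally have "norm (f (z + shift \<mu> \<nu> q)) * jb (of_int q) ^ 2 \<le> ?m * A"
        by (simp only: mult.commute)
      then show ?thesis
        by (rule wgt_boundI)
    qed
    have hb: "norm (h (z + (of_int k, 0))) \<le> B * wgt k" for k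
      by (rule wgt_boundI) (use B(2)[of k] in \<open>simp only: mult.commute\<close>)
    have "(\<lambda>i. norm (case i of (q, k) \<Rightarrow> t q k)) summable_on UNIV \<times> UNIV"
    proof (rule summable_on_comparison_test)
      have "(\<lambda>i. wgt (fst i) * wgt (snd i)) summable_on UNIV \<times> UNIV"
      proof (rule summable_on_SigmaI)
        show "((\<lambda>k. wgt (fst (q, k)) * wgt (snd (q, k))) has_sum (wgt q * (\<Sum>\<^sub>\<infinity>k. wgt k))) UNIV" for q
          using has_sum_cmult_right[OF has_sum_infsum[OF summable_wgt], of "wgt q"] by simp
        show "(\<lambda>q. wgt q * (\<Sum>\<^sub>\<infinity>k. wgt k)) summable_on UNIV"
          by (rule summable_on_cmult_left[OF summable_wgt])
      qed simp
      then show "(\<lambda>i. (?m * A * G * B) * (wgt (fst i) * wgt (snd i))) summable_on UNIV \<times> UNIV"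
        by (rule summable_on_cmult_right)
      fix i :: "int \<times> int"
      obtain q k where i: "i = (q, k)" by (cases i)
      have "norm (t q k) = norm (f (z + shift \<mu> \<nu> q)) * norm (g (z + shift \<mu> \<nu> q + (of_int k, 0))) * norm (h (z + (of_int k, 0)))"
        unfolding t_def by (simp add: norm_mult)
      also have "\<dots> \<le> (?m * A * wgt q) * G * (B * wgt k)"
        using G(2)[of "z + shift \<mu> \<nu> q + (of_int k, 0)"] A(1) G(1)
        by (intro mult_mono f hb) (simp_all add: mult_nonneg_nonneg)
      finally show "norm (case i of (q, k) \<Rightarrow> t q k) \<le> (?m * A * G * B) * (wgt (fst i) * wgt (snd i))"
        by (simp add: i mult_ac)
    qed simp
    then show ?thesis
      by (rule abs_summable_summable)
  qed
  have "act_L (inner_L c \<mu> \<nu> f g) h z = (\<Sum>\<^sub>\<infinity>k. \<Sum>\<^sub>\<infinity>q. t q k)"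
  proof -
    have "cnj (inner_L c \<mu> \<nu> f g k z) * h (z + (of_int k, 0)) = (\<Sum>\<^sub>\<infinity>q. t q k)" for k
    proof -
      have "inner_L c \<mu> \<nu> f g k z = (\<Sum>\<^sub>\<infinity>q. term_L c \<mu> \<nu> f g (k, - q) z)"
        unfolding inner_L_eq using infsum_minus_int[of "\<lambda>q. term_L c \<mu> \<nu> f g (k, q) z"] by simp
      then show ?thesis
        by (simp only: infsum_cnj[symmetric] infsum_cmult_left'[symmetric] L)
    qed
    then show ?thesis
      by (simp only: act_L_eq)
  qed
  also have "\<dots> = (\<Sum>\<^sub>\<infinity>q. \<Sum>\<^sub>\<infinity>k. t q k)"
    by (rule infsum_swap_banach[OF sm, symmetric])
  also have "\<dots> = act_R \<mu> \<nu> f (inner_R c \<mu> \<nu> g h) z"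
    unfolding act_R_eq inner_R_eq infsum_cnj[symmetric] infsum_cmult_right'[symmetric] R by (rule refl)
  finally show "act_L (inner_L c \<mu> \<nu> f g) h z = act_R \<mu> \<nu> f (inner_R c \<mu> \<nu> g h) z" .
qed


subsection \<open>A finite frame\<close>

text \<open>
  If the supports are shorter than \<open>1\<close>, then \<open>\<langle>plateau,hat\<rangle>\<^sub>L\<close> is concentrated in degree \<open>0\<close>, and it
  periodises \<open>hat\<close>. Dividing the period \<open>2\<bar>\<mu>\<bar>\<close> into \<open>N\<close> steps of length \<open>h\<close> turns the telescoping
  identity for \<open>hat\<close> into \<open>\<Sum>\<^sub>j \<langle>plateau\<^sub>j,hat\<^sub>j\<rangle>\<^sub>L = Id\<^sub>E\<close>.
\<close>

lemma inner_L_plateau_hat: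
  assumes h: "h > 0" "3 * h \<le> 1"
  shows "inner_L c \<mu> \<nu> (plateau h x0) (hat h x0) p z =
    (if p = 0 then \<Sum>\<^sub>\<infinity>k. hat h x0 (z + (- (2 * of_int k * \<mu>), - (2 * of_int k * \<nu>))) else 0)"
proof -
  have T: "term_L c \<mu> \<nu> (plateau h x0) (hat h x0) (p, k) z =
      (if p = 0 then hat h x0 (z + (- (2 * of_int k * \<mu>), - (2 * of_int k * \<nu>))) else 0)" for k
  proof -
    let ?w = "z + (- (2 * of_int k * \<mu>), - (2 * of_int k * \<nu>))"
    let ?w' = "z + (of_int p - 2 * of_int k * \<mu>, - (2 * of_int k * \<nu>))"
    have w': "fst ?w' = fst ?w + of_int p"
      by simp
    have eq: "term_L c \<mu> \<nu> (plateau h x0) (hat h x0) (p, k) z =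
        e (of_int (c * p * k) * (snd z - of_int k * \<nu>)) * cnj (plateau h x0 ?w) * hat h x0 ?w'"
      by (simp only: term_L_def fst_conv snd_conv)
    show ?thesis
    proof (cases "p = 0")
      case True
      have "cnj (plateau h x0 ?w) * hat h x0 ?w = hat h x0 ?w"
      proof (cases "x0 \<le> fst ?w \<and> fst ?w \<le> x0 + 2 * h")
        case True
        then show ?thesis using plateau_eq_1[OF h(1), of x0 ?w] by simp
      next
        case False
        then have "hat h x0 ?w = 0"
          by (intro hat_eq_0 h) auto
        then show ?thesis by simp
      qed
      then show ?thesis
        unfolding eq using True by (simp add: e_def)
    next
      case False
      then have p: "of_int p \<ge> (1 :: real) \<or> of_int p \<le> (- 1 :: real)"
        by linarith
      have "plateau h x0 ?w = 0 \<or> hat h x0 ?w' = 0"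
      proof (cases "fst ?w \<le> x0 - h \<or> x0 + 3 * h \<le> fst ?w")
        case True
        then show ?thesis using plateau_eq_0[OF h(1)] by blast
      next
        case False
        then have "fst ?w' \<le> x0 \<or> x0 + 2 * h \<le> fst ?w'"
          using p h unfolding w' by linarith
        then show ?thesis using hat_eq_0[OF h(1)] by blast
      qed
      then show ?thesis
        using False by (auto simp: eq)
    qed
  qed
  show ?thesis
    unfolding inner_L_eq T by simp
qed

lemma partition_of_unity:
  assumes \<mu>: "\<mu> \<noteq> 0" and h: "h > 0" "real N * h = 2 * \<bar>\<mu>\<bar>"
  shows "(\<Sum>j<N. \<Sum>\<^sub>\<infinity>k. hat h (real j * h) (z + (- (2 * of_int k * \<mu>), b k))) = 1"
proof -
  define H where "H m = hat h (of_int m * h) z" for m :: int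
  have N: "N > 0"
    using \<mu> h by (cases N) auto
  have eq: "hat h (real j * h) (z + (- (2 * of_int k * \<mu>), b k)) = H (int j + int N * (if \<mu> > 0 then k else - k))" for j k
  proof -
    have "2 * of_int k * \<mu> = of_int (int N * (if \<mu> > 0 then k else - k)) * h"
    proof -
      have "of_int (int N * (if \<mu> > 0 then k else - k)) * h = of_int (if \<mu> > 0 then k else - k) * (real N * h)"
        by simp
      also have "\<dots> = 2 * of_int k * \<mu>"
        unfolding h(2) by simp
      finally show ?thesis ..
    qed
    then have "fst (z + (- (2 * of_int k * \<mu>), b k)) - real j * h =
        fst z - of_int (int j + int N * (if \<mu> > 0 then k else - k)) * h"
      by (simp only: fst_add fst_conv of_int_add of_int_of_nat_eq distrib_right)
    then show ?thesis
      by (simp only: H_def hat_def)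
  qed
  have inner: "(\<Sum>\<^sub>\<infinity>k. H (int j + int N * (if \<mu> > 0 then k else - k))) = (\<Sum>\<^sub>\<infinity>k. H (int j + int N * k))" for j
    using infsum_minus_int[of "\<lambda>k. H (int j + int N * k)"] by (cases "\<mu> > 0") simp_all
  have bij: "bij_betw (\<lambda>i. int (fst i) + int N * snd i) ({..<N} \<times> UNIV) UNIV"
  proof (rule bij_betw_byWitness[where f' = "\<lambda>m. (nat (m mod int N), m div int N)"])
    show "\<forall>a\<in>{..<N} \<times> UNIV. (nat ((int (fst a) + int N * snd a) mod int N), (int (fst a) + int N * snd a) div int N) = a"
      using N by auto
    show "\<forall>a'\<in>UNIV. int (fst (nat (a' mod int N), a' div int N)) + int N * snd (nat (a' mod int N), a' div int N) = a'"
      using N by simp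
    show "(\<lambda>m. (nat (m mod int N), m div int N)) ` UNIV \<subseteq> {..<N} \<times> UNIV"
      using N by (auto simp: nat_less_iff)
  qed simp
  have "(H has_sum 1) UNIV"
    unfolding H_def by (rule sum_hat[OF h(1)])
  then have hs: "((\<lambda>i. H (int (fst i) + int N * snd i)) has_sum 1) ({..<N} \<times> UNIV)"
    using has_sum_reindex_bij_betw[OF bij, of H 1] by simp
  have "(\<Sum>\<^sub>\<infinity>j\<in>{..<N}. \<Sum>\<^sub>\<infinity>k. H (int j + int N * k)) = (\<Sum>\<^sub>\<infinity>i\<in>{..<N} \<times> UNIV. H (int (fst i) + int N * snd i))"
    using infsum_Sigma'_banach[of "\<lambda>j k. H (int j + int N * k)" "{..<N}" "\<lambda>_. UNIV"] has_sum_imp_summable[OF hs]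
    by (simp add: case_prod_beta')
  also have "\<dots> = 1"
    by (rule infsumI[OF hs])
  finally show ?thesis
    unfolding eq inner by simp
qed

lemma frame_size:
  assumes "\<mu> \<noteq> 0"
  obtains N :: nat and h :: real where "h > 0" "3 * h \<le> 1" "real N * h = 2 * \<bar>\<mu>\<bar>"
proof -
  \<comment> \<open>With \<open>h = 2\<bar>\<mu>\<bar>/N\<close>, the condition \<open>3h \<le> 1\<close> reads \<open>6\<bar>\<mu>\<bar> \<le> N\<close>.\<close>
  obtain N :: nat where N: "6 * \<bar>\<mu>\<bar> < real N"
    using reals_Archimedean2 by blast
  then have "0 < real N" by (smt (verit) abs_ge_zero)
  show ?thesis
    by (rule that[of "2 * \<bar>\<mu>\<bar> / real N" N]) (use N \<open>0 < real N\<close> assms in \<open>auto simp: field_simps\<close>)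
qed

lemma frame_identity:
  assumes "\<mu> \<noteq> 0" "h > 0" "3 * h \<le> 1" "real N * h = 2 * \<bar>\<mu>\<bar>"
  shows "(\<Sum>j<N. inner_L c \<mu> \<nu> (plateau h (real j * h)) (hat h (real j * h)) p z) = Id_E p z"
  unfolding inner_L_plateau_hat[OF assms(2,3)]
  using partition_of_unity[OF assms(1,2,4), of z "\<lambda>k. - (2 * of_int k * \<nu>)"] by (simp add: Id_E_def)

lemma E_alg_sum:
  fixes n :: nat
  assumes "\<And>j. j < n \<Longrightarrow> F j \<in> E_alg c \<mu> \<nu>"
  shows "(\<lambda>p z. \<Sum>j<n. F j p z) \<in> E_alg c \<mu> \<nu>"
  using assms
proof (induction n)
  case 0
  then show ?case
    using E_alg_cmult[OF Id_E_in_E_alg, of 0] by simp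
next
  case (Suc n)
  then have "(\<lambda>p z. (\<Sum>j<n. F j p z) + F n p z) \<in> E_alg c \<mu> \<nu>"
    by (intro E_alg_add) simp_all
  then show ?case by simp
qed

lemma act_L_sum:
  fixes n :: nat
  assumes "\<And>j. j < n \<Longrightarrow> F j \<in> E_alg c \<mu> \<nu>" "f \<in> Xi"
  shows "act_L (\<lambda>p z. \<Sum>j<n. F j p z) f z = (\<Sum>j<n. act_L (F j) f z)"
  using assms(1)
proof (induction n)
  case 0
  show ?case by (simp add: act_L_eq)
next
  case (Suc n)
  have E: "(\<lambda>p z. \<Sum>j<n. F j p z) \<in> E_alg c \<mu> \<nu>" "F n \<in> E_alg c \<mu> \<nu>"
    using Suc.prems by (auto intro: E_alg_sum)
  have "act_L (\<lambda>p z. 1 * (\<Sum>j<n. F j p z) + 1 * F n p z) f z =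
      cnj 1 * act_L (\<lambda>p z. \<Sum>j<n. F j p z) f z + cnj 1 * act_L (F n) f z"
    by (rule act_L_lincomb[OF E assms(2)])
  then show ?case
    using Suc by simp
qed

lemma additive_sum:
  fixes n :: nat and T :: "fnM \<Rightarrow> fnM"
  assumes add: "\<And>\<xi> \<eta>. \<xi> \<in> Xi \<Longrightarrow> \<eta> \<in> Xi \<Longrightarrow> T (\<lambda>z. \<xi> z + \<eta> z) = (\<lambda>z. T \<xi> z + T \<eta> z)"
    and F: "\<And>j. j < n \<Longrightarrow> F j \<in> Xi"
  shows "(\<lambda>z. \<Sum>j<n. F j z) \<in> Xi \<and> T (\<lambda>z. \<Sum>j<n. F j z) = (\<lambda>z. \<Sum>j<n. T (F j) z)"
  using F
proof (induction n)
  case 0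
  have "T (\<lambda>z. 0) z = 0" for z
    using fun_cong[OF add[OF Xi_zero Xi_zero], of z] by simp
  then show ?case
    using Xi_zero by simp
next
  case (Suc n)
  then have IH: "(\<lambda>z. \<Sum>j<n. F j z) \<in> Xi" "T (\<lambda>z. \<Sum>j<n. F j z) = (\<lambda>z. \<Sum>j<n. T (F j) z)"
    by simp_all
  have n: "F n \<in> Xi"
    using Suc.prems by simp
  show ?case
    using Xi_add[OF IH(1) n] add[OF IH(1) n] by (simp add: IH(2))
qed

text \<open>
  Expanding \<open>\<xi> = \<Sum>\<^sub>j f\<^sub>j\<cdot>\<langle>g\<^sub>j,\<xi>\<rangle>\<^sub>R\<close> in the frame, a \<open>D\<close>-linear \<open>T\<close> sends \<open>\<xi>\<close> to
  \<open>\<Sum>\<^sub>j T f\<^sub>j\<cdot>\<langle>g\<^sub>j,\<xi>\<rangle>\<^sub>R = (\<Sum>\<^sub>j \<langle>T f\<^sub>j,g\<^sub>j\<rangle>\<^sub>L)\<cdot>\<xi>\<close>.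
\<close>

theorem D_linear_is_act_L:
  assumes \<mu>: "\<mu> \<noteq> 0"
    and T: "\<And>\<xi>. \<xi> \<in> Xi \<Longrightarrow> T \<xi> \<in> Xi"
    and add: "\<And>\<xi> \<eta>. \<xi> \<in> Xi \<Longrightarrow> \<eta> \<in> Xi \<Longrightarrow> T (\<lambda>z. \<xi> z + \<eta> z) = (\<lambda>z. T \<xi> z + T \<eta> z)"
    and lin: "\<And>\<xi> \<Phi>. \<xi> \<in> Xi \<Longrightarrow> \<Phi> \<in> D_alg c \<nu> \<Longrightarrow> T (act_R \<mu> \<nu> \<xi> \<Phi>) = act_R \<mu> \<nu> (T \<xi>) \<Phi>"
  shows "\<exists>\<Psi>\<in>E_alg c \<mu> \<nu>. \<forall>\<xi>\<in>Xi. act_L \<Psi> \<xi> = T \<xi>"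
proof -
  obtain N h where h: "h > 0" "3 * h \<le> 1" "real N * h = 2 * \<bar>\<mu>\<bar>"
    by (rule frame_size[OF \<mu>])
  define f g where "f j = plateau h (real j * h)" and "g j = hat h (real j * h)" for j :: nat
  have fX: "f j \<in> Xi" and gX: "g j \<in> Xi" for j
    unfolding f_def g_def by (rule plateau_Xi[OF h(1)], rule hat_Xi[OF h(1)])
  define \<Psi> where "\<Psi> p z = (\<Sum>j<N. inner_L c \<mu> \<nu> (T (f j)) (g j) p z)" for p z
  have E: "inner_L c \<mu> \<nu> (T (f j)) (g j) \<in> E_alg c \<mu> \<nu>" for j
    by (rule inner_L_in_E_alg[OF T[OF fX] gX \<mu>])
  have "act_L \<Psi> \<xi> = T \<xi>" if \<xi>: "\<xi> \<in> Xi" for \<xi>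
  proof -
    let ?u = "\<lambda>j. act_R \<mu> \<nu> (f j) (inner_R c \<mu> \<nu> (g j) \<xi>)"
    have u: "?u j = (\<lambda>z. cnj (inner_L c \<mu> \<nu> (f j) (g j) 0 z) * \<xi> z)" for j
    proof
      fix z
      have "act_L (inner_L c \<mu> \<nu> (f j) (g j)) \<xi> z =
          cnj (inner_L c \<mu> \<nu> (f j) (g j) 0 z) * \<xi> (z + (of_int 0, 0))"
        unfolding act_L_eq
        by (rule infsum_single) (simp add: f_def g_def inner_L_plateau_hat[OF h(1,2)])
      then show "?u j z = cnj (inner_L c \<mu> \<nu> (f j) (g j) 0 z) * \<xi> z"
        by (simp add: bimodule_identity[OF \<mu> fX gX \<xi>] zero_prod_def[symmetric])
    qed
    have uX: "?u j \<in> Xi" for j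
    proof -
      have I: "inner_L c \<mu> \<nu> (f j) (g j) \<in> E_alg c \<mu> \<nu>"
        by (rule inner_L_in_E_alg[OF fX gX \<mu>])
      have "slow (\<lambda>i z. cnj (U i z))" if "slow U" for U
        using that by (simp add: slow_def)
      then have "derivs_in slow (\<lambda>_ z. cnj (inner_L c \<mu> \<nu> (f j) (g j) 0 z))"
        by (rule derivs_in_cnj[OF E_alg_0_slow[OF \<mu> I]])
      then show ?thesis
        unfolding u using E_alg_periodic[OF I] \<xi>
        by (intro Xi_slow_mult) (simp_all add: periodic_y_def)
    qed
    have sum_u: "(\<lambda>z. \<Sum>j<N. ?u j z) = \<xi>"
    proof
      fix z
      have "(\<Sum>j<N. ?u j z) = cnj (\<Sum>j<N. inner_L c \<mu> \<nu> (f j) (g j) 0 z) * \<xi> z"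
        by (simp only: u cnj_sum sum_distrib_right)
      also have "(\<Sum>j<N. inner_L c \<mu> \<nu> (f j) (g j) 0 z) = 1"
        unfolding f_def g_def frame_identity[OF \<mu> h] by (simp add: Id_E_def)
      finally show "(\<Sum>j<N. ?u j z) = \<xi> z" by simp
    qed
    have Tu: "T (?u j) = act_L (inner_L c \<mu> \<nu> (T (f j)) (g j)) \<xi>" for j
      using lin[OF fX inner_R_in_D_alg[OF gX \<xi> \<mu>], of j] bimodule_identity[OF \<mu> T[OF fX] gX \<xi>] by simp
    have "T \<xi> = T (\<lambda>z. \<Sum>j<N. ?u j z)"
      by (simp only: sum_u)
    also have "\<dots> = (\<lambda>z. \<Sum>j<N. T (?u j) z)"
      using additive_sum[of T N ?u, OF add uX] by blast
    also have "\<dots> = act_L \<Psi> \<xi>"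
    proof
      fix z
      show "(\<Sum>j<N. T (?u j) z) = act_L \<Psi> \<xi> z"
        using act_L_sum[of N "\<lambda>j. inner_L c \<mu> \<nu> (T (f j)) (g j)" c \<mu> \<nu> \<xi> z, OF E \<xi>]
        by (simp add: Tu \<Psi>_def[abs_def])
    qed
    finally show ?thesis by simp
  qed
  moreover have "\<Psi> \<in> E_alg c \<mu> \<nu>"
    unfolding \<Psi>_def[abs_def] by (rule E_alg_sum[OF E])
  ultimately show ?thesis by blast
qed


section \<open>The trace\<close>

text \<open>
  Integration over a fundamental domain of the lattice generated by \<open>(2\<mu>,2\<nu>)\<close> and \<open>(0,1)\<close>.
\<close>

definition tr :: "real \<Rightarrow> fnM \<Rightarrow> complex" where
  "tr \<mu> H = integral (cbox (0, 0) (2 * \<bar>\<mu>\<bar>, 1)) H"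

definition slice :: "fnM \<Rightarrow> real \<Rightarrow> complex" where
  "slice H x = integral {0..1} (\<lambda>y. H (x, y))"

lemma continuous_slice:
  assumes "continuous_on UNIV H"
  shows "continuous_on UNIV (slice H)"
proof -
  have "continuous_on (UNIV \<times> cbox 0 1) (\<lambda>(x, t). H (x, t))"
    using continuous_on_subset[OF assms] by simp
  from integral_continuous_on_param[OF this] show ?thesis
    by (simp add: slice_def[abs_def])
qed

lemma box_integral:
  assumes "continuous_on UNIV H"
  shows "integral (cbox (0, 0) (L, 1)) H = integral {0..L} (slice H)"
  using integral_prod_continuous[OF continuous_on_subset[OF assms], of 0 0 L 1]
  by (simp add: slice_def[abs_def])

lemma continuous_antiderivative:
  fixes g :: "real \<Rightarrow> complex"
  assumes "continuous_on UNIV g"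
  shows "\<exists>A. \<forall>t. (A has_vector_derivative g t) (at t)"
proof -
  have "isCont g t" for t
    using assms by (simp add: continuous_on_eq_continuous_at)
  then show ?thesis
    using einterval_antiderivative[of "-\<infinity>" "\<infinity>" g] by simp
qed

lemma integral_antiderivative_shift:
  fixes A g :: "real \<Rightarrow> complex"
  assumes A: "\<And>t. (A has_vector_derivative g t) (at t)" and "0 \<le> L"
  shows "integral {0..L} (\<lambda>t. g (t + a)) = A (L + a) - A a"
proof -
  have d: "((\<lambda>t. A (t + a)) has_vector_derivative g (t + a)) (at t within {0..L})" for t
  proof -
    have "((\<lambda>t. t + a) has_vector_derivative 1) (at t)"
      by (auto intro!: derivative_eq_intros)
    from vector_diff_chain_at[OF this A] have "((\<lambda>t. A (t + a)) has_vector_derivative g (t + a)) (at t)"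
      by (simp add: o_def)
    then show ?thesis
      by (rule has_vector_derivative_at_within)
  qed
  have "((\<lambda>t. g (t + a)) has_integral (A (L + a) - A (0 + a))) {0..L}"
    by (rule fundamental_theorem_of_calculus[where f = "\<lambda>t. A (t + a)", OF assms(2)]) (rule d)
  then show ?thesis
    by (simp only: integral_unique add_0)
qed

lemma integral_periodic_shift:
  fixes g :: "real \<Rightarrow> complex"
  assumes c: "continuous_on UNIV g" and per: "\<And>t. g (t + L) = g t" and L: "0 \<le> L"
  shows "integral {0..L} (\<lambda>t. g (t + a)) = integral {0..L} g"
proof -
  obtain A where A': "\<forall>t. (A has_vector_derivative g t) (at t)"
    using continuous_antiderivative[OF c] by (rule exE)
  note A = A'[rule_format]
  \<comment> \<open>The integral over a period as a function of its starting point; its derivative vanishes.\<close>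
  define F where "F a = A (L + a) - A a" for a
  have "(F has_derivative (\<lambda>h. 0)) (at t)" for t
  proof -
    have "((\<lambda>t. L + t) has_vector_derivative 1) (at t)"
      by (auto intro!: derivative_eq_intros)
    from vector_diff_chain_at[OF this A] have "((\<lambda>t. A (L + t)) has_vector_derivative g (t + L)) (at t)"
      by (simp add: o_def add.commute)
    from has_vector_derivative_diff[OF this A[of t]] have "(F has_vector_derivative 0) (at t)"
      unfolding F_def[abs_def] per by simp
    then show ?thesis
      by (simp add: has_vector_derivative_def)
  qed
  then have "F a = F 0"
    by (intro has_derivative_zero_unique[of UNIV]) auto
  then show ?thesis
    using integral_antiderivative_shift[OF A L, of a] integral_antiderivative_shift[OF A L, of 0]
    by (simp add: F_def)
qed

definition lattice_invariant :: "real \<Rightarrow> real \<Rightarrow> fnM \<Rightarrow> bool" where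
  "lattice_invariant \<mu> \<nu> H \<longleftrightarrow> (\<forall>x y. H (x, y + 1) = H (x, y)) \<and>
     (\<forall>x y. H (x - 2 * \<mu>, y - 2 * \<nu>) = H (x, y))"

lemma slice_shift:
  assumes "continuous_on UNIV H" "\<And>x y. H (x, y + 1) = H (x, y)"
  shows "integral {0..1} (\<lambda>y. H (x, y + r)) = slice H x"
  unfolding slice_def
  by (rule integral_periodic_shift[OF continuous_on_slices(1)[OF assms(1)]]) (simp_all add: assms(2))

text \<open>
  Averaging over \<open>y\<close> removes the shear \<open>2\<nu>\<close>, which reduces lattice invariance to periodicity in one
  variable.
\<close>

lemma slice_periodic:
  assumes "continuous_on UNIV H" "lattice_invariant \<mu> \<nu> H"
  shows "slice H (x + 2 * \<bar>\<mu>\<bar>) = slice H x"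
proof -
  have per: "\<And>x y. H (x, y + 1) = H (x, y)" and inv: "\<And>x y. H (x - 2 * \<mu>, y - 2 * \<nu>) = H (x, y)"
    using assms(2) by (simp_all add: lattice_invariant_def)
  have "slice H x = slice H (x - 2 * \<mu>)" for x
  proof -
    have "slice H x = integral {0..1} (\<lambda>y. H (x - 2 * \<mu>, y + - (2 * \<nu>)))"
      unfolding slice_def using inv by simp
    also have "\<dots> = slice H (x - 2 * \<mu>)"
      by (rule slice_shift[OF assms(1) per])
    finally show ?thesis .
  qed
  from this[of x] this[of "x + 2 * \<mu>"] show ?thesis
    by (cases "0 \<le> \<mu>") simp_all
qed

lemma tr_shift:
  assumes "continuous_on UNIV H" "lattice_invariant \<mu> \<nu> H"
  shows "tr \<mu> (\<lambda>z. H (z + (a, 0))) = tr \<mu> H"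
proof -
  have c: "continuous_on UNIV (\<lambda>z. H (z + (a, 0)))"
    by (rule continuous_on_compose2[OF assms(1)]) (auto intro!: continuous_intros)
  have "slice (\<lambda>z. H (z + (a, 0))) = (\<lambda>x. slice H (x + a))"
    by (rule ext) (simp add: slice_def)
  then show ?thesis
    unfolding tr_def box_integral[OF c] box_integral[OF assms(1)]
    using integral_periodic_shift[OF continuous_slice[OF assms(1)] slice_periodic[OF assms]] by simp
qed

lemma tr_partial_y:
  assumes "smooth H" "periodic_y H"
  shows "tr \<mu> (partial_y H) = 0"
proof -
  have 0: "slice (partial_y H) x = 0" for x
  proof -
    have "((\<lambda>y. partial_y H (x, y)) has_integral (H (x, 1) - H (x, 0))) {0..1}"
      by (rule fundamental_theorem_of_calculus[where f = "\<lambda>y. H (x, y)"])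
        (simp, rule has_vector_derivative_at_within[OF partial_y_vector_derivative[OF smooth_differentiable[OF assms(1)]]])
    moreover have "H (x, 1) = H (x, 0)"
      using assms(2)[unfolded periodic_y_def, rule_format, of x 0] by simp
    ultimately show ?thesis
      by (simp add: slice_def integral_unique)
  qed
  then show ?thesis
    unfolding tr_def box_integral[OF smooth_continuous[OF smooth_partial_y[OF assms(1)]]]
    by (simp only: 0[abs_def] integral_0)
qed

lemma tr_partial_x:
  assumes "smooth H" "lattice_invariant \<mu> \<nu> H"
  shows "tr \<mu> (partial_x H) = 0"
proof -
  note ch = smooth_continuous[OF smooth_partial_x[OF assms(1)]]
  have d: "(slice H has_vector_derivative slice (partial_x H) x) (at x)" for x
  proof -
    have "((\<lambda>x. integral (cbox 0 1) (\<lambda>y. H (x, y))) has_vector_derivative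
        integral (cbox 0 1) (\<lambda>y. partial_x H (x, y))) (at x)"
    proof (rule leibniz_rule_vector_derivative[where U = UNIV])
      show "((\<lambda>x. H (x, t)) has_vector_derivative partial_x H (x, t)) (at x)" for x t
        by (rule partial_x_vector_derivative[OF smooth_differentiable[OF assms(1)]])
      show "(\<lambda>y. H (x, y)) integrable_on cbox 0 1" for x
        by (intro integrable_continuous continuous_on_slices(1)[OF smooth_continuous[OF assms(1)]])
      show "continuous_on (UNIV \<times> cbox 0 1) (\<lambda>(x, t). partial_x H (x, t))"
        using ch by simp
    qed simp_all
    then show ?thesis
      by (simp add: slice_def[abs_def])
  qed
  have "integral {0..2 * \<bar>\<mu>\<bar>} (slice (partial_x H)) = slice H (0 + 2 * \<bar>\<mu>\<bar>) - slice H 0"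
    using integral_antiderivative_shift[OF d, of "2 * \<bar>\<mu>\<bar>" 0] by simp
  then show ?thesis
    unfolding tr_def box_integral[OF ch]
    using slice_periodic[OF smooth_continuous[OF assms(1)] assms(2), of 0] by simp
qed

lemma tr_lincomb:
  assumes "continuous_on UNIV F" "continuous_on UNIV G"
  shows "tr \<mu> (\<lambda>z. a * F z + b * G z) = a * tr \<mu> F + b * tr \<mu> G"
proof -
  have "F integrable_on cbox (0, 0) (2 * \<bar>\<mu>\<bar>, 1)" "G integrable_on cbox (0, 0) (2 * \<bar>\<mu>\<bar>, 1)"
    by (rule integrable_continuous[OF continuous_on_subset[OF assms(1) subset_UNIV]],
        rule integrable_continuous[OF continuous_on_subset[OF assms(2) subset_UNIV]])
  then have "((\<lambda>z. a * F z + b * G z) has_integral (a * tr \<mu> F + b * tr \<mu> G)) (cbox (0, 0) (2 * \<bar>\<mu>\<bar>, 1))"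
    unfolding tr_def
    by (intro has_integral_add has_integral_mult_right[OF integrable_integral])
  then show ?thesis
    unfolding tr_def by (rule integral_unique)
qed

lemma tr_const: "tr \<mu> (\<lambda>_. a) = 2 * of_real \<bar>\<mu>\<bar> * a"
  by (simp add: tr_def content_Pair scaleR_conv_of_real)

lemma tr_cnj: "tr \<mu> (\<lambda>z. cnj (F z)) = cnj (tr \<mu> F)"
  unfolding tr_def by (rule integral_cnj[symmetric])


subsection \<open>Integrating series\<close>

lemma has_sum_box_integral:
  assumes "loc_summable F" "\<And>k. continuous_on UNIV (F k)"
  shows "((\<lambda>k. integral (cbox a b) (F k)) has_sum integral (cbox a b) (\<lambda>z. \<Sum>\<^sub>\<infinity>k. F k z)) UNIV"
proof -
  have F: "continuous_on (cbox a b) (F k)" for k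
    by (rule continuous_on_subset[OF assms(2)]) simp
  have cs: "continuous_on (cbox a b) (\<lambda>z. \<Sum>k\<in>X. F k z)" for X
    by (rule continuous_on_sum) (rule F)
  obtain I J where I: "\<And>X. ((\<lambda>z. \<Sum>k\<in>X. F k z) has_integral I X) (cbox a b)"
    and J: "((\<lambda>z. \<Sum>\<^sub>\<infinity>k. F k z) has_integral J) (cbox a b)"
    and lim: "(I \<longlongrightarrow> J) (finite_subsets_at_top UNIV)"
    by (rule uniform_limit_integral_cbox[OF loc_summable_uniform_limit[OF assms(1) compact_cbox[of a b]] cs
          finite_subsets_at_top_neq_bot]) (rule that)
  have "I X = (\<Sum>k\<in>X. integral (cbox a b) (F k))" if "finite X" for X
  proof -
    have "((\<lambda>z. \<Sum>k\<in>X. F k z) has_integral (\<Sum>k\<in>X. integral (cbox a b) (F k))) (cbox a b)"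
      by (rule has_integral_sum[OF that]) (rule integrable_integral[OF integrable_continuous[OF F]])
    with I[of X] show ?thesis
      by (rule has_integral_unique)
  qed
  then have "\<forall>\<^sub>F X in finite_subsets_at_top UNIV. I X = (\<Sum>k\<in>X. integral (cbox a b) (F k))"
    by (rule eventually_finite_subsets_at_top_weakI)
  then have "((\<lambda>X. \<Sum>k\<in>X. integral (cbox a b) (F k)) \<longlongrightarrow> J) (finite_subsets_at_top UNIV)"
    by (rule tendsto_cong[THEN iffD1]) (rule lim)
  then show ?thesis
    unfolding has_sum_def by (simp only: integral_unique[OF J])
qed

lemma tr_infsum:
  assumes "loc_summable F" "\<And>k. continuous_on UNIV (F k)"
  shows "tr \<mu> (\<lambda>z. \<Sum>\<^sub>\<infinity>k. F k z) = (\<Sum>\<^sub>\<infinity>k. tr \<mu> (F k))"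
  unfolding tr_def using infsumI[OF has_sum_box_integral[OF assms]] by simp


subsection \<open>Unfolding\<close>

lemma antiderivative_arctan_bound:
  fixes A g :: "real \<Rightarrow> complex"
  assumes A: "\<And>t. (A has_vector_derivative g t) (at t)" and g: "continuous_on UNIV g"
    and bound: "\<And>t. norm (g t) \<le> C / (1 + t\<^sup>2)"
  shows "norm (A t - A s) \<le> C * \<bar>arctan t - arctan s\<bar>"
proof -
  have *: "norm (A t - A s) \<le> C * (arctan t - arctan s)" if "s \<le> t" for s t
  proof -
    have 1: "(g has_integral (A t - A s)) {s..t}"
      by (rule fundamental_theorem_of_calculus[OF that]) (rule has_vector_derivative_at_within[OF A])
    have "((\<lambda>t. C * arctan t) has_vector_derivative C / (1 + t\<^sup>2)) (at t within {s..t'})" for t t'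
      unfolding has_real_derivative_iff_has_vector_derivative[symmetric]
      by (auto intro!: derivative_eq_intros simp: divide_inverse)
    then have 2: "((\<lambda>t. C / (1 + t\<^sup>2)) has_integral (C * arctan t - C * arctan s)) {s..t}"
      by (intro fundamental_theorem_of_calculus[where f = "\<lambda>t. C * arctan t", OF that])
    have "norm (integral {s..t} g) \<le> integral {s..t} (\<lambda>t. C / (1 + t\<^sup>2))"
      by (rule integral_norm_bound_integral) (use 1 2 bound in \<open>auto simp: integrable_on_def\<close>)
    then show ?thesis
      using 1 2 by (simp add: integral_unique right_diff_distrib)
  qed
  show ?thesis
  proof (cases "s \<le> t")
    case True
    then show ?thesis
      using *[OF True] by (simp add: arctan_monotone')
  next
    case False
    then have "t \<le> s" by simp
    then show ?thesis
      using *[OF \<open>t \<le> s\<close>] by (simp add: arctan_monotone' norm_minus_commute abs_minus_commute)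
  qed
qed

lemma telescope_int:
  fixes a :: "int \<Rightarrow> complex"
  shows "(\<Sum>k\<in>{- int n..int n}. a (k + 1) - a k) = a (int n + 1) - a (- int n)"
proof (induction n)
  case (Suc n)
  have "{- int (Suc n)..int (Suc n)} = insert (- int (Suc n)) (insert (int (Suc n)) {- int n..int n})"
    by auto
  then show ?case
    using Suc by (simp add: algebra_simps)
qed simp

text \<open>
  Both sums are limits of symmetric partial sums, which telescope to increments of an antiderivative
  over intervals exhausting \<open>\<real>\<close>; the comparison with \<open>arctan\<close> shows that the increments have the
  same limit.
\<close>

lemma unfolding_sums:
  fixes A :: "real \<Rightarrow> complex"
  assumes arctan: "\<And>s t. norm (A t - A s) \<le> C * \<bar>arctan t - arctan s\<bar>" and L: "L > 0"
    and S: "((\<lambda>k :: int. A (of_int (k + 1) * L) - A (of_int k * L)) has_sum S) UNIV"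
    and T: "((\<lambda>k :: int. A (of_int (k + 1)) - A (of_int k)) has_sum T) UNIV"
  shows "S = T"
proof -
  have "(\<lambda>n. \<Sum>k\<in>{- int n..int n}. A (of_int (k + 1) * L) - A (of_int k * L)) \<longlonglongrightarrow> S"
    by (rule filterlim_compose[OF S[unfolded has_sum_def] symmetric_intervals_at_top])
  then have S': "(\<lambda>n. A (of_int (int n + 1) * L) - A (of_int (- int n) * L)) \<longlonglongrightarrow> S"
    using telescope_int[of "\<lambda>k. A (of_int k * L)"] by (simp only:)
  have "(\<lambda>n. \<Sum>k\<in>{- int n..int n}. A (of_int (k + 1)) - A (of_int k)) \<longlonglongrightarrow> T"
    by (rule filterlim_compose[OF T[unfolded has_sum_def] symmetric_intervals_at_top])
  then have T': "(\<lambda>n. A (of_int (int n + 1)) - A (of_int (- int n))) \<longlonglongrightarrow> T"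
    using telescope_int[of "\<lambda>k. A (of_int k)"] by (simp only:)
  let ?d = "\<lambda>n. C * \<bar>arctan (of_int (int n + 1) * L) - arctan (of_int (int n + 1))\<bar> +
    C * \<bar>arctan (of_int (- int n) * L) - arctan (of_int (- int n))\<bar>"
  have n1: "filterlim (\<lambda>n. real n + 1) at_top sequentially"
    by (rule filterlim_at_top_mono[OF filterlim_real_sequentially]) simp
  have up: "filterlim (\<lambda>n. of_int (int n + 1) * r :: real) at_top sequentially" if "r > 0" for r
    using filterlim_tendsto_pos_mult_at_top[OF tendsto_const that n1] by (simp add: mult.commute)
  have up0: "filterlim (\<lambda>n. of_int (int n) * r :: real) at_top sequentially" if "r > 0" for r
    using filterlim_tendsto_pos_mult_at_top[OF tendsto_const that filterlim_real_sequentially]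
    by (simp add: mult.commute)
  have down: "filterlim (\<lambda>n. of_int (- int n) * r :: real) at_bot sequentially" if "r > 0" for r
    using up0[OF that] by (simp add: filterlim_uminus_at_bot)
  have "?d \<longlonglongrightarrow> C * \<bar>pi / 2 - pi / 2\<bar> + C * \<bar>- (pi / 2) - - (pi / 2)\<bar>"
    using up[OF L] up[of 1] down[OF L] down[of 1]
    by (intro tendsto_intros filterlim_compose[OF tendsto_arctan_at_top] filterlim_compose[OF tendsto_arctan_at_bot])
      simp_all
  then have d0: "?d \<longlonglongrightarrow> 0" by simp
  have "(\<lambda>n. (A (of_int (int n + 1) * L) - A (of_int (- int n) * L)) -
      (A (of_int (int n + 1)) - A (of_int (- int n)))) \<longlonglongrightarrow> 0"
  proof (rule tendsto_norm_zero_cancel, rule tendsto_sandwich[OF _ _ tendsto_const d0])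
    show "\<forall>\<^sub>F n in sequentially. norm ((A (of_int (int n + 1) * L) - A (of_int (- int n) * L)) -
      (A (of_int (int n + 1)) - A (of_int (- int n)))) \<le> ?d n"
    proof (rule always_eventually, intro allI)
      fix n
      let ?a = "A (of_int (int n + 1) * L)" and ?b = "A (of_int (- int n) * L)"
        and ?c = "A (of_int (int n + 1))" and ?e = "A (of_int (- int n))"
      have "norm ((?a - ?b) - (?c - ?e)) = norm ((?a - ?c) - (?b - ?e))"
        by (simp add: algebra_simps)
      also have "\<dots> \<le> norm (?a - ?c) + norm (?b - ?e)"
        by (rule norm_triangle_ineq4)
      also have "\<dots> \<le> ?d n"
        by (intro add_mono arctan)
      finally show "norm ((?a - ?b) - (?c - ?e)) \<le> ?d n" .
    qed
  qed simp
  moreover have "(\<lambda>n. (A (of_int (int n + 1) * L) - A (of_int (- int n) * L)) -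
      (A (of_int (int n + 1)) - A (of_int (- int n)))) \<longlonglongrightarrow> S - T"
    by (rule tendsto_diff[OF S' T'])
  ultimately have "S - T = 0"
    using LIMSEQ_unique by blast
  then show ?thesis by simp
qed

text \<open>
  Both sides integrate \<open>\<xi>\<close>-bar times \<open>\<eta>\<close> over \<open>\<real> \<times> [0,1]\<close>, cut into strips of width \<open>2\<bar>\<mu>\<bar>\<close> on the
  left and of width \<open>1\<close> on the right.
\<close>

theorem tr_inner_L:
  assumes \<mu>: "\<mu> \<noteq> 0" and "\<xi> \<in> Xi" "\<eta> \<in> Xi"
  shows "tr \<mu> (inner_L c \<mu> \<nu> \<xi> \<eta> 0) = trace_D (inner_R c \<mu> \<nu> \<eta> \<xi>)"
proof -
  define P where "P z = cnj (\<xi> z) * \<eta> z" for z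
  have cP: "continuous_on UNIV P"
    unfolding P_def[abs_def] by (intro continuous_intros smooth_continuous Xi_smooth assms)
  have perP: "P (x, y + 1) = P (x, y)" for x y
    using Xi_periodic[OF assms(2), of x y] Xi_periodic[OF assms(3), of x y] by (simp add: P_def)
  have cPs: "continuous_on UNIV (\<lambda>z. P (z + a))" for a
    by (rule continuous_on_compose2[OF cP]) (auto intro!: continuous_intros)
  define \<phi> where "\<phi> = slice P"
  have c\<phi>: "continuous_on UNIV \<phi>"
    unfolding \<phi>_def by (rule continuous_slice[OF cP])
  obtain A where A': "\<forall>t. (A has_vector_derivative \<phi> t) (at t)"
    using continuous_antiderivative[OF c\<phi>] by (rule exE)
  note A = A'[rule_format]
  have box: "integral (cbox (0, 0) (L, 1)) (\<lambda>z. P (z + (s, r))) = A (L + s) - A s" if "0 \<le> L" for L s r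
  proof -
    have "slice (\<lambda>z. P (z + (s, r))) = (\<lambda>x. \<phi> (x + s))"
      unfolding \<phi>_def using slice_shift[OF cP perP] by (simp add: slice_def[of "\<lambda>z. P (z + (s, r))"] fun_eq_iff)
    then show ?thesis
      unfolding box_integral[OF cPs] using integral_antiderivative_shift[OF A that] by simp
  qed
  let ?L = "2 * \<bar>\<mu>\<bar>"
  have TL: "term_L c \<mu> \<nu> \<xi> \<eta> (0, k) = (\<lambda>z. P (z + (- (2 * of_int k * \<mu>), - (2 * of_int k * \<nu>))))" for k
    by (rule ext) (simp add: term_L_def P_def e_def)
  have TR: "term_R c \<mu> \<nu> \<eta> \<xi> (0, k) = (\<lambda>z. P (z + (of_int k, 0)))" for k
    by (rule ext) (simp add: term_R_def P_def e_def mult.commute)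
  have "((\<lambda>k. integral (cbox (0, 0) (?L, 1)) (term_L c \<mu> \<nu> \<xi> \<eta> (0, k))) has_sum
      integral (cbox (0, 0) (?L, 1)) (\<lambda>z. \<Sum>\<^sub>\<infinity>k. term_L c \<mu> \<nu> \<xi> \<eta> (0, k) z)) UNIV"
    by (rule has_sum_box_integral[OF loc_rapid2_summable[OF derivs_in_base[OF term_L_rapid[OF assms(2,3) \<mu>]]]])
      (simp only: TL cPs)
  then have hL: "((\<lambda>k. A (?L + - (2 * of_int k * \<mu>)) - A (- (2 * of_int k * \<mu>))) has_sum
      tr \<mu> (inner_L c \<mu> \<nu> \<xi> \<eta> 0)) UNIV"
    by (simp only: TL box[OF mult_nonneg_nonneg[OF zero_le_numeral abs_ge_zero]] tr_def inner_L_eq)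
  have hR: "((\<lambda>k. A (of_int (k + 1)) - A (of_int k)) has_sum trace_D (inner_R c \<mu> \<nu> \<eta> \<xi>)) UNIV"
  proof -
    have "((\<lambda>k. integral (cbox (0, 0) (1, 1)) (term_R c \<mu> \<nu> \<eta> \<xi> (0, k))) has_sum
        integral (cbox (0, 0) (1, 1)) (\<lambda>z. \<Sum>\<^sub>\<infinity>k. term_R c \<mu> \<nu> \<eta> \<xi> (0, k) z)) UNIV"
      by (rule has_sum_box_integral[OF loc_rapid2_summable[OF derivs_in_base[OF term_R_rapid[OF assms(3,2) \<mu>]]]])
        (simp only: TR cPs)
    then show ?thesis
      by (simp only: TR box[OF zero_le_one] trace_D_def inner_R_eq of_int_add of_int_1 add.commute)
  qed
  have hL': "((\<lambda>k. A (of_int (k + 1) * ?L) - A (of_int k * ?L)) has_sum tr \<mu> (inner_L c \<mu> \<nu> \<xi> \<eta> 0)) UNIV"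
  proof (cases "\<mu> > 0")
    case True
    let ?a = "\<lambda>k :: int. A (?L + - (2 * of_int k * \<mu>)) - A (- (2 * of_int k * \<mu>))"
    have bij: "bij_betw uminus (UNIV :: int set) UNIV"
      by (rule bij_betw_byWitness[where f' = uminus]) simp_all
    have "((\<lambda>k. ?a (- k)) has_sum tr \<mu> (inner_L c \<mu> \<nu> \<xi> \<eta> 0)) UNIV"
      by (rule has_sum_reindex_bij_betw[OF bij, THEN iffD2]) (rule hL)
    moreover have "?a (- k) = A (of_int (k + 1) * ?L) - A (of_int k * ?L)" for k
      using True by (simp add: algebra_simps)
    ultimately show ?thesis
      by (simp only:)
  next
    case False
    have "A (?L + - (2 * of_int k * \<mu>)) - A (- (2 * of_int k * \<mu>)) =
        A (of_int (k + 1) * ?L) - A (of_int k * ?L)" for k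
      using False by (simp add: algebra_simps)
    then show ?thesis
      using hL by (simp only:)
  qed
  obtain B where B: "0 \<le> B" "\<And>z. jb (fst z) ^ 2 * norm (\<xi> z) \<le> B"
    using Xi_bounded[OF assms(2)] by metis
  obtain B' where B': "0 \<le> B'" "\<And>z. jb (fst z) ^ 0 * norm (\<eta> z) \<le> B'"
    using Xi_bounded[OF assms(3)] by metis
  have "norm (\<phi> t) \<le> (B * B') / (1 + t\<^sup>2)" for t
  proof -
    have P: "norm (P (t, y)) \<le> (B * B') / (1 + t\<^sup>2)" for y
    proof -
      have "(1 + t\<^sup>2) * norm (P (t, y)) \<le> jb t ^ 2 * norm (P (t, y))"
        by (intro mult_right_mono) (simp_all add: jb_def power2_eq_square algebra_simps)
      also have "\<dots> = (jb (fst (t, y)) ^ 2 * norm (\<xi> (t, y))) * (jb (fst (t, y)) ^ 0 * norm (\<eta> (t, y)))"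
        by (simp add: P_def norm_mult)
      also have "\<dots> \<le> B * B'"
        by (intro mult_mono B B') simp_all
      finally have "(1 + t\<^sup>2) * norm (P (t, y)) \<le> B * B'" .
      moreover have "0 < 1 + t\<^sup>2"
        by (simp add: add_pos_nonneg)
      ultimately show ?thesis
        by (simp add: pos_le_divide_eq mult.commute)
    qed
    have "norm (integral {0..1} (\<lambda>y. P (t, y))) \<le> integral {0..1} (\<lambda>y :: real. (B * B') / (1 + t\<^sup>2))"
      by (rule integral_norm_bound_integral) (auto intro!: P integrable_continuous_interval continuous_on_slices(1)[OF cP])
    then show ?thesis
      by (simp add: \<phi>_def slice_def)
  qed
  from antiderivative_arctan_bound[OF A c\<phi> this]
  have "norm (A t - A s) \<le> (B * B') * \<bar>arctan t - arctan s\<bar>" for s t .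
  then show ?thesis
    by (rule unfolding_sums[OF _ _ hL' hR]) (use \<mu> in simp)
qed

theorem induced_trace_tr:
  assumes "\<mu> \<noteq> 0"
  shows "induced_trace c \<mu> \<nu> (\<lambda>\<Psi>. tr \<mu> (\<Psi> 0))"
  unfolding induced_trace_def
proof (intro conjI ballI allI)
  show "tr \<mu> (\<lambda>z. a * \<Phi> 0 z + b * \<Psi> 0 z) = a * tr \<mu> (\<Phi> 0) + b * tr \<mu> (\<Psi> 0)"
    if "\<Phi> \<in> E_alg c \<mu> \<nu>" "\<Psi> \<in> E_alg c \<mu> \<nu>" for \<Phi> \<Psi> a b
    by (intro tr_lincomb smooth_continuous E_alg_smooth[OF that(1)] E_alg_smooth[OF that(2)])
  show "tr \<mu> (inner_L c \<mu> \<nu> \<xi> \<eta> 0) = trace_D (inner_R c \<mu> \<nu> \<eta> \<xi>)" if "\<xi> \<in> Xi" "\<eta> \<in> Xi" for \<xi> \<eta>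
    by (rule tr_inner_L[OF assms that])
qed

lemma induced_trace_lincomb:
  assumes "induced_trace c \<mu> \<nu> t" "\<Phi> \<in> E_alg c \<mu> \<nu>" "\<Psi> \<in> E_alg c \<mu> \<nu>"
  shows "t (\<lambda>p z. a * \<Phi> p z + b * \<Psi> p z) = a * t \<Phi> + b * t \<Psi>"
  using assms(1)[unfolded induced_trace_def, THEN conjunct1] assms(2,3) by simp

lemma induced_trace_sum:
  fixes n :: nat
  assumes t: "induced_trace c \<mu> \<nu> t" and F: "\<And>j. j < n \<Longrightarrow> F j \<in> E_alg c \<mu> \<nu>"
  shows "t (\<lambda>p z. \<Sum>j<n. F j p z) = (\<Sum>j<n. t (F j))"
  using F
proof (induction n)
  case 0
  have "t (\<lambda>p z. 0 * Id_E p z + 0 * Id_E p z) = 0 * t Id_E + 0 * t Id_E"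
    by (rule induced_trace_lincomb[OF t Id_E_in_E_alg Id_E_in_E_alg])
  then show ?case by simp
next
  case (Suc n)
  have E: "(\<lambda>p z. \<Sum>j<n. F j p z) \<in> E_alg c \<mu> \<nu>" "F n \<in> E_alg c \<mu> \<nu>"
    using Suc.prems by (auto intro: E_alg_sum)
  have "t (\<lambda>p z. 1 * (\<Sum>j<n. F j p z) + 1 * F n p z) = 1 * t (\<lambda>p z. \<Sum>j<n. F j p z) + 1 * t (F n)"
    by (rule induced_trace_lincomb[OF t E])
  then show ?case
    using Suc by simp
qed

text \<open>
  An induced trace is prescribed on the left inner products, so by the frame identity all induced
  traces agree on \<open>Id\<^sub>E\<close>.
\<close>

lemma trace_E_scalar:
  assumes \<mu>: "\<mu> \<noteq> 0"
  shows "trace_E c \<mu> \<nu> (\<lambda>p z. a * Id_E p z) = 2 * of_real \<bar>\<mu>\<bar> * a"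
proof -
  have t: "induced_trace c \<mu> \<nu> (trace_E c \<mu> \<nu>)"
    unfolding trace_E_def 
    by (rule someI[where P = "induced_trace c \<mu> \<nu>"]) (rule induced_trace_tr[OF \<mu>])
  obtain N h where h: "h > 0" "3 * h \<le> 1" "real N * h = 2 * \<bar>\<mu>\<bar>"
    by (rule frame_size[OF \<mu>])
  let ?F = "\<lambda>j. inner_L c \<mu> \<nu> (plateau h (real j * h)) (hat h (real j * h))"
  let ?R = "\<lambda>j. inner_R c \<mu> \<nu> (hat h (real j * h)) (plateau h (real j * h))"
  have E: "?F j \<in> E_alg c \<mu> \<nu>" for j
    by (rule inner_L_in_E_alg[OF plateau_Xi[OF h(1)] hat_Xi[OF h(1)] \<mu>])
  have "t Id_E = (\<Sum>j<N. trace_D (?R j))" if t: "induced_trace c \<mu> \<nu> t" for t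
  proof -
    have "Id_E = (\<lambda>p z. \<Sum>j<N. ?F j p z)"
      by (intro ext) (rule frame_identity[OF \<mu> h, symmetric])
    then have "t Id_E = (\<Sum>j<N. t (?F j))"
      using induced_trace_sum[OF t, of N ?F] E by simp
    also have "\<dots> = (\<Sum>j<N. trace_D (?R j))"
      using t plateau_Xi[OF h(1)] hat_Xi[OF h(1)] unfolding induced_trace_def by simp
    finally show ?thesis .
  qed
  from this[OF t] this[OF induced_trace_tr[OF \<mu>]] have "trace_E c \<mu> \<nu> Id_E = tr \<mu> (Id_E 0)"
    by simp
  also have "Id_E 0 = (\<lambda>_. 1)"
    by (simp add: Id_E_def fun_eq_iff)
  also have "tr \<mu> (\<lambda>_. 1) = 2 * of_real \<bar>\<mu>\<bar>"
    by (simp add: tr_const)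
  finally have "trace_E c \<mu> \<nu> Id_E = 2 * of_real \<bar>\<mu>\<bar>" .
  moreover have "trace_E c \<mu> \<nu> (\<lambda>p z. a * Id_E p z + 0 * Id_E p z) = a * trace_E c \<mu> \<nu> Id_E + 0 * trace_E c \<mu> \<nu> Id_E"
    by (rule induced_trace_lincomb[OF t Id_E_in_E_alg Id_E_in_E_alg])
  ultimately show ?thesis
    by simp
qed


section \<open>Curvature of compatible connections\<close>

definition quad_phase :: "int \<Rightarrow> real \<Rightarrow> heis \<Rightarrow> real \<Rightarrow> real" where
  "quad_phase c \<mu> = (\<lambda>(a, b, d) x. a * pi * of_int c / (2 * \<mu>) * x\<^sup>2 + d * pi / \<mu> * x)"

lemma nabla0_quad_phase:
  "nabla0 c \<mu> (a, b, d) \<xi> z = - of_real a * partial_y \<xi> z - of_real b * partial_x \<xi> z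
     + of_real (quad_phase c \<mu> (a, b, d) (fst z)) * \<i> * \<xi> z"
  by (simp add: nabla0_eq quad_phase_def)

text \<open>The derivation \<open>[\<nabla>\<^sup>0\<^sub>W, \<cdot>]\<close> of \<open>E\<close>, for operators acting by \<open>act_L\<close>.\<close>

definition hat_delta :: "int \<Rightarrow> real \<Rightarrow> heis \<Rightarrow> fnMZ \<Rightarrow> fnMZ" where
  "hat_delta c \<mu> = (\<lambda>(a, b, d) \<Psi> q z. - of_real a * partial_y (\<Psi> q) z - of_real b * partial_x (\<Psi> q) z
     + of_real (quad_phase c \<mu> (a, b, d) (fst z + of_int q) - quad_phase c \<mu> (a, b, d) (fst z)) * \<i> * \<Psi> q z)"

lemma quad_phase_diff:
  "quad_phase c \<mu> (a, b, d) (x + of_int q) - quad_phase c \<mu> (a, b, d) x =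
    (a * pi * of_int c / \<mu>) * of_int q * x + ((a * pi * of_int c / (2 * \<mu>)) * (of_int q)\<^sup>2 + d * pi / \<mu> * of_int q)"
  by (simp add: quad_phase_def power2_eq_square algebra_simps add_divide_distrib)

text \<open>
  On a compact set an affine function of \<open>x\<close> is bounded by its coefficients.
\<close>

lemma moderate_affine:
  assumes a: "\<And>q. norm (a q) \<le> A * jb (of_int q) ^ 2" and b: "\<And>q. norm (b q) \<le> A * jb (of_int q) ^ 2"
  shows "derivs_in (loc_moderate (\<lambda>q. jb (of_int q))) (\<lambda>q z. a q * of_real (fst z) + b q)"
proof (rule derivs_in_affine)
  fix c d :: "int \<Rightarrow> complex"
  assume cd: "\<And>i. c i = a i \<or> c i = 0" "\<And>i. d i = b i \<or> d i = a i \<or> d i = 0"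
  have A: "0 \<le> A"
    using order_trans[OF norm_ge_zero a[of 0]] by (simp add: jb_def)
  have c: "norm (c q) \<le> A * jb (of_int q) ^ 2" for q
    using cd(1)[of q] a[of q] A by auto
  have d: "norm (d q) \<le> A * jb (of_int q) ^ 2" for q
    using cd(2)[of q] a[of q] b[of q] A by auto
  show "loc_moderate (\<lambda>q. jb (of_int q)) (\<lambda>q z. c q * of_real (fst z) + d q)"
    unfolding loc_moderate_def
  proof (intro allI impI)
    fix K :: "(real \<times> real) set" assume "compact K"
    then obtain M where M: "0 \<le> M" "\<And>z. z \<in> K \<Longrightarrow> \<bar>fst z\<bar> \<le> M"
      using compact_fst_bound by metis
    have "norm (c q * of_real (fst z) + d q) \<le> (A * (M + 1)) * jb (of_int q) ^ 2" if "z \<in> K" for q z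
    proof -
      have "norm (c q * of_real (fst z) + d q) \<le> norm (c q) * \<bar>fst z\<bar> + norm (d q)"
        by (rule order_trans[OF norm_triangle_ineq]) (simp add: norm_mult)
      also have "\<dots> \<le> (A * jb (of_int q) ^ 2) * M + A * jb (of_int q) ^ 2"
        by (intro add_mono mult_mono c d M that) (simp_all add: A)
      finally show ?thesis
        by (simp add: algebra_simps)
    qed
    then show "\<exists>n C. \<forall>q. \<forall>z\<in>K. norm (c q * of_real (fst z) + d q) \<le> C * jb (of_int q) ^ n"
      by (intro exI[of _ 2] exI[of _ "A * (M + 1)"]) simp
  qed
qed

text \<open>
  Differentiating the equivariance condition; in the \<open>y\<close>-direction the derivative of the phase appears.
\<close>

lemma E_alg_partial_equivariant:
  assumes "\<Psi> \<in> E_alg c \<mu> \<nu>"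
  defines "ph \<equiv> \<lambda>k q y. e (of_int (c * q * k) * (y - of_int k * \<nu>))"
  shows "ph k q y * partial_x (\<Psi> q) (x - 2 * of_int k * \<mu>, y - 2 * of_int k * \<nu>) = partial_x (\<Psi> q) (x, y)"
    and "ph k q y * partial_y (\<Psi> q) (x - 2 * of_int k * \<mu>, y - 2 * of_int k * \<nu>) =
      partial_y (\<Psi> q) (x, y) - 2 * of_real pi * \<i> * of_int (c * q * k) * \<Psi> q (x, y)"
proof -
  let ?a = "(- (2 * of_int k * \<mu>), - (2 * of_int k * \<nu>))"
  let ?ph = "\<lambda>z. e (of_int (c * q * k) * (snd z - of_int k * \<nu>))"
  have d: "\<Psi> q differentiable (at w)" for w
    by (rule smooth_differentiable[OF E_alg_smooth[OF assms(1)]])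
  have eq: "\<Psi> q = (\<lambda>z. ?ph z * \<Psi> q (z + ?a))"
  proof
    fix z :: "real \<times> real"
    show "\<Psi> q z = ?ph z * \<Psi> q (z + ?a)"
      using E_alg_equivariant[OF assms(1), of q k "snd z" "fst z"] by (cases z) simp
  qed
  have *: "partial u (\<Psi> q) (x, y) = partial u ?ph (x, y) * \<Psi> q ((x, y) + ?a) +
      ?ph (x, y) * partial u (\<Psi> q) ((x, y) + ?a)" for u
  proof -
    have "partial u (\<Psi> q) (x, y) = partial u (\<lambda>z. ?ph z * \<Psi> q (z + ?a)) (x, y)"
      using eq by simp
    also have "\<dots> = partial u ?ph (x, y) * \<Psi> q ((x, y) + ?a) + ?ph (x, y) * partial u (\<lambda>z. \<Psi> q (z + ?a)) (x, y)"
      by (rule partial_mult[OF differentiable_phase differentiable_shift[OF d]])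
    also have "partial u (\<lambda>z. \<Psi> q (z + ?a)) (x, y) = partial u (\<Psi> q) ((x, y) + ?a)"
      by (rule partial_shift[OF d])
    finally show ?thesis .
  qed
  show "ph k q y * partial_x (\<Psi> q) (x - 2 * of_int k * \<mu>, y - 2 * of_int k * \<nu>) = partial_x (\<Psi> q) (x, y)"
    using *[of "(1, 0)"] unfolding partial_phase by (simp add: ph_def)
  have "\<Psi> q (x, y) = ph k q y * \<Psi> q (x - 2 * of_int k * \<mu>, y - 2 * of_int k * \<nu>)"
    using fun_cong[OF eq, of "(x, y)"] by (simp add: ph_def)
  then show "ph k q y * partial_y (\<Psi> q) (x - 2 * of_int k * \<mu>, y - 2 * of_int k * \<nu>) =
      partial_y (\<Psi> q) (x, y) - 2 * of_real pi * \<i> * of_int (c * q * k) * \<Psi> q (x, y)"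
    using *[of "(0, 1)"] unfolding partial_phase by (simp add: ph_def mult_ac)
qed

text \<open>
  For equivariance, the term that \<open>\<partial>/\<partial>y\<close> produces from the phase cancels against the change of
  \<open>\<gamma>(x + q) - \<gamma>(x)\<close> under \<open>x \<mapsto> x - 2k\<mu>\<close>, where \<open>\<gamma>\<close> is the quadratic phase of \<open>\<nabla>\<^sup>0\<close>.
\<close>

lemma hat_delta_in_E_alg:
  assumes \<mu>: "\<mu> \<noteq> 0" and \<Psi>: "\<Psi> \<in> E_alg c \<mu> \<nu>"
  shows "hat_delta c \<mu> W \<Psi> \<in> E_alg c \<mu> \<nu>"
proof -
  obtain a b d where W: "W = (a, b, d)" by (cases W)
  let ?\<rho> = "\<lambda>q. jb (of_int q)"
  note D = E_alg_derivs[OF \<Psi>]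
  define A where "A q = of_real ((a * pi * of_int c / \<mu>) * of_int q) * \<i>" for q :: int
  define B where "B q = of_real ((a * pi * of_int c / (2 * \<mu>)) * (of_int q)\<^sup>2 + d * pi / \<mu> * of_int q) * \<i>" for q :: int
  have eq: "hat_delta c \<mu> W \<Psi> = (\<lambda>q z. (- of_real a) * partial_y (\<Psi> q) z +
      ((- of_real b) * partial_x (\<Psi> q) z + (A q * of_real (fst z) + B q) * \<Psi> q z))"
    unfolding W hat_delta_def prod.case quad_phase_diff
    by (intro ext) (simp add: A_def B_def algebra_simps)
  note cm = derivs_in_rapid_cmult[of ?\<rho>, OF jb_ge_1]
  have 1: "derivs_in (loc_rapid ?\<rho>) (\<lambda>q z. (- of_real a) * partial_y (\<Psi> q) z)"
    by (rule cm[OF derivs_in_partial[OF D y_Basis]])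
  have 2: "derivs_in (loc_rapid ?\<rho>) (\<lambda>q z. (- of_real b) * partial_x (\<Psi> q) z)"
    by (rule cm[OF derivs_in_partial[OF D x_Basis]])
  define C where "C = \<bar>a * pi * of_int c / \<mu>\<bar> + (\<bar>a * pi * of_int c / (2 * \<mu>)\<bar> + \<bar>d * pi / \<mu>\<bar>)"
  have q1: "\<bar>of_int q :: real\<bar> \<le> ?\<rho> q ^ 2" and q2: "(of_int q :: real)\<^sup>2 \<le> ?\<rho> q ^ 2" for q
  proof -
    have "\<bar>of_int q :: real\<bar> \<le> ?\<rho> q" by (simp add: jb_def)
    also have "\<dots> = ?\<rho> q ^ 1" by simp
    also have "\<dots> \<le> ?\<rho> q ^ 2" by (rule power_increasing) simp_all
    finally show "\<bar>of_int q :: real\<bar> \<le> ?\<rho> q ^ 2" .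
    have "\<bar>of_int q :: real\<bar> ^ 2 \<le> ?\<rho> q ^ 2"
      by (rule power_mono) (simp_all add: jb_def)
    then show "(of_int q :: real)\<^sup>2 \<le> ?\<rho> q ^ 2" by simp
  qed
  have AB: "norm (A q) \<le> C * ?\<rho> q ^ 2" "norm (B q) \<le> C * ?\<rho> q ^ 2" for q
  proof -
    have "norm (A q) = \<bar>a * pi * of_int c / \<mu>\<bar> * \<bar>of_int q\<bar>"
      by (simp only: A_def norm_mult norm_of_real norm_ii mult_1_right abs_mult)
    also have "\<dots> \<le> C * ?\<rho> q ^ 2"
      by (intro mult_mono q1) (simp_all add: C_def)
    finally show "norm (A q) \<le> C * ?\<rho> q ^ 2" .
    have "norm (B q) = \<bar>(a * pi * of_int c / (2 * \<mu>)) * (of_int q)\<^sup>2 + d * pi / \<mu> * of_int q\<bar>"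
      by (simp only: B_def norm_mult norm_of_real norm_ii mult_1_right)
    also have "\<dots> \<le> \<bar>a * pi * of_int c / (2 * \<mu>)\<bar> * (of_int q)\<^sup>2 + \<bar>d * pi / \<mu>\<bar> * \<bar>of_int q\<bar>"
      by (rule order_trans[OF abs_triangle_ineq]) (simp only: abs_mult abs_power2)
    also have "\<dots> \<le> \<bar>a * pi * of_int c / (2 * \<mu>)\<bar> * ?\<rho> q ^ 2 + \<bar>d * pi / \<mu>\<bar> * ?\<rho> q ^ 2"
      by (intro add_mono mult_left_mono q1 q2) simp_all
    also have "\<dots> = (\<bar>a * pi * of_int c / (2 * \<mu>)\<bar> + \<bar>d * pi / \<mu>\<bar>) * ?\<rho> q ^ 2"
      by (simp only: distrib_right)
    also have "\<dots> \<le> C * ?\<rho> q ^ 2"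
      by (intro mult_right_mono) (simp_all add: C_def)
    finally show "norm (B q) \<le> C * ?\<rho> q ^ 2" .
  qed
  have 3: "derivs_in (loc_rapid ?\<rho>) (\<lambda>q z. (A q * of_real (fst z) + B q) * \<Psi> q z)"
    by (rule derivs_in_moderate_mult_rapid[OF jb_ge_1 moderate_affine[OF AB] D])
  show ?thesis
    unfolding E_alg_iff
  proof (intro conjI allI)
    show "derivs_in (loc_rapid ?\<rho>) (hat_delta c \<mu> W \<Psi>)"
      unfolding eq by (intro derivs_in_rapid_add 1 2 3) simp_all
    show "periodic_y (hat_delta c \<mu> W \<Psi> q)" for q
      using E_alg_periodic[OF \<Psi>, of q] periodic_partial[OF E_alg_smooth[OF \<Psi>] E_alg_periodic[OF \<Psi>], of _ q]
      by (simp add: W hat_delta_def periodic_y_def)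
    fix k q x y
    let ?ph = "e (of_int (c * q * k) * (y - of_int k * \<nu>))"
    let ?w = "(x - 2 * of_int k * \<mu>, y - 2 * of_int k * \<nu>)"
    let ?g = "\<lambda>x. quad_phase c \<mu> (a, b, d) (x + of_int q) - quad_phase c \<mu> (a, b, d) x"
    have g: "?g (x - 2 * of_int k * \<mu>) = ?g x - 2 * pi * a * of_int (c * q * k)"
      unfolding quad_phase_diff using \<mu> by (simp add: field_simps)
    have "?ph * hat_delta c \<mu> W \<Psi> q ?w = - of_real a * (?ph * partial_y (\<Psi> q) ?w) -
        of_real b * (?ph * partial_x (\<Psi> q) ?w) + of_real (?g (x - 2 * of_int k * \<mu>)) * \<i> * (?ph * \<Psi> q ?w)"
      by (simp add: W hat_delta_def algebra_simps)
    also have "\<dots> = hat_delta c \<mu> W \<Psi> q (x, y)"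
      unfolding E_alg_partial_equivariant[OF \<Psi>] E_alg_equivariant[OF \<Psi>] g
      by (simp add: W hat_delta_def algebra_simps)
    finally show "?ph * hat_delta c \<mu> W \<Psi> q ?w = hat_delta c \<mu> W \<Psi> q (x, y)" .
  qed
qed

lemma act_L_partial:
  assumes \<Psi>: "\<Psi> \<in> E_alg c \<mu> \<nu>" and "f \<in> Xi" and u: "u \<in> Basis"
  shows "partial u (act_L \<Psi> f) z = (\<Sum>\<^sub>\<infinity>q. cnj (partial u (\<Psi> q) z) * f (z + (of_int q, 0))
      + cnj (\<Psi> q z) * partial u f (z + (of_int q, 0)))"
    and "(\<lambda>q. cnj (partial u (\<Psi> q) z) * f (z + (of_int q, 0))
      + cnj (\<Psi> q z) * partial u f (z + (of_int q, 0))) summable_on UNIV"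
proof -
  let ?t = "\<lambda>q z. cnj (\<Psi> q z) * f (z + (of_int q, 0))"
  have dP: "\<Psi> q differentiable (at w)" for q w
    by (rule smooth_differentiable[OF E_alg_smooth[OF \<Psi>]])
  note df = Xi_differentiable[OF assms(2)]
  have p: "partial u (?t q) z = cnj (partial u (\<Psi> q) z) * f (z + (of_int q, 0)) + cnj (\<Psi> q z) * partial u f (z + (of_int q, 0))"
    for u q z
    unfolding partial_mult[OF differentiable_cnj[OF dP] differentiable_shift[OF df]] partial_cnj[OF dP] partial_shift[OF df]
    by (rule refl)
  have ls: "loc_summable (\<lambda>q. partial u (?t q))" if "u \<in> Basis" for u
  proof -
    have "(\<lambda>q. partial u (?t q)) = (\<lambda>q z. cnj (partial u (\<Psi> q) z) * f (z + (of_int q, 0)) +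
        cnj (\<Psi> q z) * partial u f (z + (of_int q, 0)))"
      by (intro ext) (rule p)
    then show ?thesis
      using loc_summable_add[OF act_L_loc_summable[OF derivs_in_base[OF derivs_in_partial[OF E_alg_derivs[OF \<Psi>] that]] assms(2)]
          act_L_loc_summable[OF derivs_in_base[OF E_alg_derivs[OF \<Psi>]] Xi_partial[OF assms(2) that]]]
      by (simp only:)
  qed
  have "partial u (act_L \<Psi> f) z = (\<Sum>\<^sub>\<infinity>q. partial u (?t q) z)"
    unfolding act_L_eq
    by (rule partial_infsum(1)[OF _ act_L_loc_summable[OF derivs_in_base[OF E_alg_derivs[OF \<Psi>]] assms(2)] ls u])
      (rule differentiable_mult[OF differentiable_cnj[OF dP] differentiable_shift[OF df]])
  then show "partial u (act_L \<Psi> f) z = (\<Sum>\<^sub>\<infinity>q. cnj (partial u (\<Psi> q) z) * f (z + (of_int q, 0))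
      + cnj (\<Psi> q z) * partial u f (z + (of_int q, 0)))"
    by (simp only: p)
  show "(\<lambda>q. cnj (partial u (\<Psi> q) z) * f (z + (of_int q, 0))
      + cnj (\<Psi> q z) * partial u f (z + (of_int q, 0))) summable_on UNIV"
    using loc_summable_summable[OF ls[OF u], of z] by (simp only: p)
qed

lemma nabla0_act_L:
  assumes \<mu>: "\<mu> \<noteq> 0" and \<Psi>: "\<Psi> \<in> E_alg c \<mu> \<nu>" and f: "f \<in> Xi"
  shows "nabla0 c \<mu> W (act_L \<Psi> f) z = act_L (hat_delta c \<mu> W \<Psi>) f z + act_L \<Psi> (nabla0 c \<mu> W f) z"
proof -
  obtain a b d where W: "W = (a, b, d)" by (cases W)
  let ?w = "\<lambda>q :: int. z + (of_int q, 0)"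
  define X where "X q = cnj (partial_x (\<Psi> q) z) * f (?w q) + cnj (\<Psi> q z) * partial_x f (?w q)" for q
  define Y where "Y q = cnj (partial_y (\<Psi> q) z) * f (?w q) + cnj (\<Psi> q z) * partial_y f (?w q)" for q
  define Z where "Z q = cnj (\<Psi> q z) * f (?w q)" for q
  let ?g = "of_real (quad_phase c \<mu> (a, b, d) (fst z)) * \<i>"
  have sX: "X summable_on UNIV" and sY: "Y summable_on UNIV" and sZ: "Z summable_on UNIV"
    unfolding X_def Y_def Z_def
    by (rule act_L_partial(2)[OF \<Psi> f x_Basis], rule act_L_partial(2)[OF \<Psi> f y_Basis], rule act_L_summable[OF \<Psi> f])
  have "nabla0 c \<mu> W (act_L \<Psi> f) z = - of_real a * (\<Sum>\<^sub>\<infinity>q. Y q) + (- of_real b * (\<Sum>\<^sub>\<infinity>q. X q) + ?g * (\<Sum>\<^sub>\<infinity>q. Z q))"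
    unfolding W nabla0_quad_phase act_L_partial(1)[OF \<Psi> f x_Basis] act_L_partial(1)[OF \<Psi> f y_Basis]
    by (simp add: X_def Y_def Z_def act_L_eq)
  also have "\<dots> = (\<Sum>\<^sub>\<infinity>q. - of_real a * Y q + (- of_real b * X q + ?g * Z q))"
    by (subst infsum_add, intro summable_on_cmult_right sY,
        intro summable_on_add summable_on_cmult_right sX sZ,
        subst infsum_add, intro summable_on_cmult_right sX, intro summable_on_cmult_right sZ,
        simp only: infsum_cmult_right')
  also have "\<dots> = (\<Sum>\<^sub>\<infinity>q. cnj (hat_delta c \<mu> W \<Psi> q z) * f (?w q) + cnj (\<Psi> q z) * nabla0 c \<mu> W f (?w q))"
  proof (rule infsum_cong)
    fix q
    have w: "fst (?w q) = fst z + of_int q" by simp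
    show "- of_real a * Y q + (- of_real b * X q + ?g * Z q) =
        cnj (hat_delta c \<mu> W \<Psi> q z) * f (?w q) + cnj (\<Psi> q z) * nabla0 c \<mu> W f (?w q)"
      unfolding X_def Y_def Z_def W nabla0_quad_phase hat_delta_def prod.case w
      by (simp add: algebra_simps)
  qed
  also have "\<dots> = act_L (hat_delta c \<mu> W \<Psi>) f z + act_L \<Psi> (nabla0 c \<mu> W f) z"
    unfolding act_L_eq
    by (rule infsum_add[OF act_L_summable[OF hat_delta_in_E_alg[OF \<mu> \<Psi>] f] act_L_summable[OF \<Psi> nabla0_Xi[OF f]]])
  finally show ?thesis .
qed


subsection \<open>Vanishing traces\<close>

lemma E_alg_0_invariant:
  assumes "\<Psi> \<in> E_alg c \<mu> \<nu>"
  shows "lattice_invariant \<mu> \<nu> (\<Psi> 0)"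
  using E_alg_equivariant[OF assms, of 0 1] E_alg_periodic[OF assms, of 0]
  by (simp add: lattice_invariant_def periodic_y_def e_def)

lemma tr_hat_delta:
  assumes \<Psi>: "\<Psi> \<in> E_alg c \<mu> \<nu>"
  shows "tr \<mu> (hat_delta c \<mu> W \<Psi> 0) = 0"
proof -
  obtain a b d where W: "W = (a, b, d)" by (cases W)
  have "hat_delta c \<mu> W \<Psi> 0 = (\<lambda>z. - of_real a * partial_y (\<Psi> 0) z + - of_real b * partial_x (\<Psi> 0) z)"
    by (rule ext) (simp add: W hat_delta_def)
  then show ?thesis
    using tr_lincomb[OF smooth_continuous[OF smooth_partial_y[OF E_alg_smooth[OF \<Psi>]]]
        smooth_continuous[OF smooth_partial_x[OF E_alg_smooth[OF \<Psi>]]], of \<mu> "- of_real a" 0 "- of_real b" 0]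
      tr_partial_y[OF E_alg_smooth[OF \<Psi>] E_alg_periodic[OF \<Psi>]]
      tr_partial_x[OF E_alg_smooth[OF \<Psi>] E_alg_0_invariant[OF \<Psi>]]
    by simp
qed

text \<open>
  Evaluating on a bump reads off the degree-zero coefficient of the convolution product.
\<close>

lemma composite_coefficient:
  assumes "\<And>\<xi>. \<xi> \<in> Xi \<Longrightarrow> act_L \<Omega> \<xi> = act_L \<Phi> (act_L \<Psi> \<xi>)"
  shows "\<Omega> 0 z = (\<Sum>\<^sub>\<infinity>q. \<Phi> q z * \<Psi> (- q) (z + (of_int q, 0)))"
proof -
  obtain x y where z: "z = (x, y)" by (cases z)
  have "cnj (\<Omega> 0 z) = act_L \<Omega> (bump x) z"
    using act_L_bump[of \<Omega> x 0 y] by (simp add: z)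
  also have "\<dots> = act_L \<Phi> (act_L \<Psi> (bump x)) z"
    by (simp only: assms[OF bump_Xi])
  also have "\<dots> = (\<Sum>\<^sub>\<infinity>q. cnj (\<Phi> q z) * cnj (\<Psi> (- q) (z + (of_int q, 0))))"
  proof -
    have "act_L \<Psi> (bump x) (z + (of_int q, 0)) = cnj (\<Psi> (- q) (z + (of_int q, 0)))" for q
      using act_L_bump[of \<Psi> "x + of_int q" "- q" y] by (simp add: z)
    then show ?thesis
      by (simp only: act_L_eq[of \<Phi>])
  qed
  also have "\<dots> = cnj (\<Sum>\<^sub>\<infinity>q. \<Phi> q z * \<Psi> (- q) (z + (of_int q, 0)))"
    by (simp only: infsum_cnj[symmetric] complex_cnj_mult)
  finally show ?thesis
    by simp
qed

text \<open>
  The degree-zero coefficients of \<open>\<Phi>\<Psi>\<close> and \<open>\<Psi>\<Phi>\<close> are series whose summands differ by translations in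
  \<open>x\<close>, and the trace is translation invariant.
\<close>

lemma tr_composite_commute:
  assumes \<mu>: "\<mu> \<noteq> 0" and \<Phi>: "\<Phi> \<in> E_alg c \<mu> \<nu>" and \<Psi>: "\<Psi> \<in> E_alg c \<mu> \<nu>"
    and 1: "\<And>\<xi>. \<xi> \<in> Xi \<Longrightarrow> act_L \<Omega> \<xi> = act_L \<Phi> (act_L \<Psi> \<xi>)"
    and 2: "\<And>\<xi>. \<xi> \<in> Xi \<Longrightarrow> act_L \<Omega>' \<xi> = act_L \<Psi> (act_L \<Phi> \<xi>)"
  shows "tr \<mu> (\<Omega> 0) = tr \<mu> (\<Omega>' 0)"
proof -
  define H where "H q z = \<Phi> q z * \<Psi> (- q) (z + (of_int q, 0))" for q z
  have cH: "continuous_on UNIV (H q)" for q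
    unfolding H_def[abs_def]
    by (intro smooth_continuous smooth_mult smooth_shift E_alg_smooth[OF \<Phi>] E_alg_smooth[OF \<Psi>])
  have inv: "lattice_invariant \<mu> \<nu> (H q)" for q
    unfolding lattice_invariant_def
  proof (intro conjI allI)
    fix x y
    show "H q (x, y + 1) = H q (x, y)"
      using E_alg_periodic[OF \<Phi>, of q] E_alg_periodic[OF \<Psi>, of "- q"]
      by (simp add: H_def periodic_y_def)
    let ?ph = "e (of_int (c * q * 1) * (y - of_int 1 * \<nu>))"
    have "\<Phi> q (x, y) = ?ph * \<Phi> q (x - 2 * \<mu>, y - 2 * \<nu>)"
      using E_alg_equivariant[OF \<Phi>, of q 1 y x] by simp
    moreover have "\<Psi> (- q) (x + of_int q, y) = cnj ?ph * \<Psi> (- q) (x - 2 * \<mu> + of_int q, y - 2 * \<nu>)"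
      using E_alg_equivariant[OF \<Psi>, of "- q" 1 y "x + of_int q"] by (simp add: e_minus[symmetric] algebra_simps)
    ultimately have "H q (x, y) = (?ph * cnj ?ph) * H q (x - 2 * \<mu>, y - 2 * \<nu>)"
      by (simp add: H_def)
    then show "H q (x - 2 * \<mu>, y - 2 * \<nu>) = H q (x, y)"
      by (simp only: e_cnj mult_1_left)
  qed
  obtain A where A: "0 \<le> A" "\<And>p z. jb (of_int p) ^ 2 * norm (\<Phi> p z) \<le> A"
    using E_alg_global_bound[OF \<mu> \<Phi>] by metis
  obtain B where B: "0 \<le> B" "\<And>p z. jb (of_int p) ^ 0 * norm (\<Psi> p z) \<le> B"
    using E_alg_global_bound[OF \<mu> \<Psi>] by metis
  have bound: "norm (H q z) \<le> (A * B) * wgt q" for q z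
  proof -
    have "norm (H q z) * jb (of_int q) ^ 2 =
        (jb (of_int q) ^ 2 * norm (\<Phi> q z)) * (jb (of_int (- q)) ^ 0 * norm (\<Psi> (- q) (z + (of_int q, 0))))"
      by (simp add: H_def norm_mult)
    also have "\<dots> \<le> A * B"
      by (intro mult_mono A B) simp_all
    finally show ?thesis
      by (rule wgt_boundI)
  qed
  have ls: "loc_summable (\<lambda>q z. H q (z + a q))" for a
    unfolding loc_summable_def using bound by blast
  have "tr \<mu> (\<Omega> 0) = tr \<mu> (\<lambda>z. \<Sum>\<^sub>\<infinity>q. H q z)"
  proof -
    have "\<Omega> 0 z = (\<Sum>\<^sub>\<infinity>q. H q z)" for z
      unfolding H_def by (rule composite_coefficient) (rule 1)
    then have "\<Omega> 0 = (\<lambda>z. \<Sum>\<^sub>\<infinity>q. H q z)"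
      by (rule ext)
    then show ?thesis
      by (simp only:)
  qed
  also have "\<dots> = (\<Sum>\<^sub>\<infinity>q. tr \<mu> (H q))"
    by (rule tr_infsum[OF _ cH]) (use ls[of "\<lambda>_. 0"] in simp)
  also have "\<dots> = (\<Sum>\<^sub>\<infinity>q. tr \<mu> (\<lambda>z. H q (z + (- of_int q, 0))))"
    by (simp only: tr_shift[OF cH inv])
  also have "\<dots> = tr \<mu> (\<lambda>z. \<Sum>\<^sub>\<infinity>q. H q (z + (- of_int q, 0)))"
    by (rule tr_infsum[OF ls, symmetric]) (rule continuous_on_compose2[OF cH], auto intro!: continuous_intros)
  also have "(\<lambda>z. \<Sum>\<^sub>\<infinity>q. H q (z + (- of_int q, 0))) = \<Omega>' 0"
  proof
    fix z
    have "(\<Sum>\<^sub>\<infinity>q. H q (z + (- of_int q, 0))) = (\<Sum>\<^sub>\<infinity>q. H (- q) (z + (- of_int (- q), 0)))"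
      by (rule infsum_minus_int[symmetric])
    also have "\<dots> = (\<Sum>\<^sub>\<infinity>q. \<Psi> q z * \<Phi> (- q) (z + (of_int q, 0)))"
      by (rule infsum_cong) (cases z, simp add: H_def mult.commute)
    finally show "(\<Sum>\<^sub>\<infinity>q. H q (z + (- of_int q, 0))) = \<Omega>' 0 z"
      using composite_coefficient[of \<Omega>' \<Psi> \<Phi> z] 2 by simp
  qed
  finally show ?thesis .
qed


section \<open>Compatible connections with constant curvature\<close>

lemma
  assumes "compatible_connection c \<mu> \<nu> nab"
  shows connection_Xi: "\<xi> \<in> Xi \<Longrightarrow> nab W \<xi> \<in> Xi"
    and connection_linear: "\<xi> \<in> Xi \<Longrightarrow> linear (\<lambda>W. nab W \<xi> z)"
    and connection_lincomb: "\<xi> \<in> Xi \<Longrightarrow> \<eta> \<in> Xi \<Longrightarrow>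
      nab W (\<lambda>z. a * \<xi> z + b * \<eta> z) = (\<lambda>z. a * nab W \<xi> z + b * nab W \<eta> z)"
    and connection_Leibniz: "\<xi> \<in> Xi \<Longrightarrow> \<Phi> \<in> D_alg c \<nu> \<Longrightarrow> nab W (act_R \<mu> \<nu> \<xi> \<Phi>) =
      (\<lambda>z. act_R \<mu> \<nu> (nab W \<xi>) \<Phi> z + act_R \<mu> \<nu> \<xi> (delta c \<mu> W \<Phi>) z)"
    and connection_metric: "\<xi> \<in> Xi \<Longrightarrow> \<eta> \<in> Xi \<Longrightarrow> delta c \<mu> W (inner_R c \<mu> \<nu> \<xi> \<eta>) =
      (\<lambda>p z. inner_R c \<mu> \<nu> (nab W \<xi>) \<eta> p z + inner_R c \<mu> \<nu> \<xi> (nab W \<eta>) p z)"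
proof -
  note con = assms[unfolded compatible_connection_def linear_connection_def]
  note lin = con[THEN conjunct1]
  show "\<xi> \<in> Xi \<Longrightarrow> nab W \<xi> \<in> Xi"
    by (rule lin[THEN conjunct1, rule_format])
  show "\<xi> \<in> Xi \<Longrightarrow> linear (\<lambda>W. nab W \<xi> z)"
    by (rule lin[THEN conjunct2, THEN conjunct1, rule_format])
  show "\<xi> \<in> Xi \<Longrightarrow> \<eta> \<in> Xi \<Longrightarrow>
      nab W (\<lambda>z. a * \<xi> z + b * \<eta> z) = (\<lambda>z. a * nab W \<xi> z + b * nab W \<eta> z)"
    by (rule lin[THEN conjunct2, THEN conjunct2, THEN conjunct1, rule_format])
  show "\<xi> \<in> Xi \<Longrightarrow> \<Phi> \<in> D_alg c \<nu> \<Longrightarrow> nab W (act_R \<mu> \<nu> \<xi> \<Phi>) =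
      (\<lambda>z. act_R \<mu> \<nu> (nab W \<xi>) \<Phi> z + act_R \<mu> \<nu> \<xi> (delta c \<mu> W \<Phi>) z)"
    by (rule lin[THEN conjunct2, THEN conjunct2, THEN conjunct2, rule_format])
  show "\<xi> \<in> Xi \<Longrightarrow> \<eta> \<in> Xi \<Longrightarrow> delta c \<mu> W (inner_R c \<mu> \<nu> \<xi> \<eta>) =
      (\<lambda>p z. inner_R c \<mu> \<nu> (nab W \<xi>) \<eta> p z + inner_R c \<mu> \<nu> \<xi> (nab W \<eta>) p z)"
    by (rule con[THEN conjunct2, rule_format])
qed

lemma act_R_diff:
  assumes "\<xi> \<in> Xi" "\<eta> \<in> Xi" "\<Phi> \<in> D_alg c \<nu>"
  shows "act_R \<mu> \<nu> (\<lambda>z. \<xi> z - \<eta> z) \<Phi> z = act_R \<mu> \<nu> \<xi> \<Phi> z - act_R \<mu> \<nu> \<eta> \<Phi> z"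
proof -
  let ?t = "\<lambda>\<zeta> q. \<zeta> (z + shift \<mu> \<nu> q) * cnj (\<Phi> q (z + shift \<mu> \<nu> q))"
  have s: "?t \<xi> summable_on UNIV" and t: "?t \<eta> summable_on UNIV"
    by (rule loc_summable_summable[OF act_R_summable(1)[OF assms(1,3)]],
        rule loc_summable_summable[OF act_R_summable(1)[OF assms(2,3)]])
  have "act_R \<mu> \<nu> (\<lambda>z. \<xi> z - \<eta> z) \<Phi> z = (\<Sum>\<^sub>\<infinity>q. ?t \<xi> q + (- 1) * ?t \<eta> q)"
    by (simp add: act_R_eq left_diff_distrib)
  also have "\<dots> = (\<Sum>\<^sub>\<infinity>q. ?t \<xi> q) + (- 1) * (\<Sum>\<^sub>\<infinity>q. ?t \<eta> q)"
    unfolding infsum_cmult_right'[symmetric] by (rule infsum_add[OF s summable_on_cmult_right[OF t]])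
  finally show ?thesis
    by (simp add: act_R_eq)
qed

text \<open>
  The difference \<open>G\<^sub>W\<close> of two connections; the derivation terms of the Leibniz rules cancel, so it is
  \<open>D\<close>-linear.
\<close>

definition potential :: "int \<Rightarrow> real \<Rightarrow> (heis \<Rightarrow> fnM \<Rightarrow> fnM) \<Rightarrow> heis \<Rightarrow> fnM \<Rightarrow> fnM" where
  "potential c \<mu> nab W \<xi> = (\<lambda>z. nab W \<xi> z - nabla0 c \<mu> W \<xi> z)"

context
  fixes c :: int and \<mu> \<nu> :: real and nab :: "heis \<Rightarrow> fnM \<Rightarrow> fnM"
  assumes \<mu>: "\<mu> \<noteq> 0" and nab: "compatible_connection c \<mu> \<nu> nab"
begin

abbreviation "G \<equiv> potential c \<mu> nab"

lemma potential_Xi: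
  assumes "\<xi> \<in> Xi"
  shows "G W \<xi> \<in> Xi"
  using Xi_add[OF connection_Xi[OF nab assms, of W] Xi_cmult[OF nabla0_Xi[OF assms, of c \<mu> W], of "- 1"]]
  by (simp add: potential_def)

lemma potential_add:
  assumes "\<xi> \<in> Xi" "\<eta> \<in> Xi"
  shows "G W (\<lambda>z. \<xi> z + \<eta> z) = (\<lambda>z. G W \<xi> z + G W \<eta> z)"
proof
  fix z
  have "nab W (\<lambda>z. \<xi> z + \<eta> z) z = nab W \<xi> z + nab W \<eta> z"
    using connection_lincomb[OF nab assms, of W 1 1] by simp
  moreover have "nabla0 c \<mu> W (\<lambda>z. \<xi> z + \<eta> z) z = nabla0 c \<mu> W \<xi> z + nabla0 c \<mu> W \<eta> z"
    using nabla0_lincomb[OF Xi_differentiable[OF assms(1)] Xi_differentiable[OF assms(2)],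
        where c = c and \<mu> = \<mu> and W = W and z = z and a = 1 and b = 1] by simp
  ultimately show "G W (\<lambda>z. \<xi> z + \<eta> z) z = G W \<xi> z + G W \<eta> z"
    by (simp add: potential_def)
qed

lemma potential_D_linear:
  assumes "\<xi> \<in> Xi" "\<Phi> \<in> D_alg c \<nu>"
  shows "G W (act_R \<mu> \<nu> \<xi> \<Phi>) = act_R \<mu> \<nu> (G W \<xi>) \<Phi>"
proof
  fix z
  show "G W (act_R \<mu> \<nu> \<xi> \<Phi>) z = act_R \<mu> \<nu> (G W \<xi>) \<Phi> z"
    using act_R_diff[OF connection_Xi[OF nab assms(1)] nabla0_Xi[OF assms(1)] assms(2), of \<mu> W c \<mu> W z]
    by (simp add: potential_def connection_Leibniz[OF nab assms] nabla0_Leibniz[OF \<mu> assms])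
qed

lemma potential_in_E:
  "\<exists>\<Psi>\<in>E_alg c \<mu> \<nu>. \<forall>\<xi>\<in>Xi. act_L \<Psi> \<xi> = G W \<xi>"
  by (rule D_linear_is_act_L[OF \<mu>]) (rule potential_Xi potential_add potential_D_linear, assumption+)+

lemma potential_composite_in_E:
  "\<exists>\<Psi>\<in>E_alg c \<mu> \<nu>. \<forall>\<xi>\<in>Xi. act_L \<Psi> \<xi> = G W (G W' \<xi>)"
proof (rule D_linear_is_act_L[OF \<mu>])
  show "G W (G W' \<xi>) \<in> Xi" if "\<xi> \<in> Xi" for \<xi>
    by (rule potential_Xi[OF potential_Xi[OF that]])
  show "G W (G W' (\<lambda>z. \<xi> z + \<eta> z)) = (\<lambda>z. G W (G W' \<xi>) z + G W (G W' \<eta>) z)" if "\<xi> \<in> Xi" "\<eta> \<in> Xi" for \<xi> \<eta>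
    unfolding potential_add[OF that] by (rule potential_add[OF potential_Xi[OF that(1)] potential_Xi[OF that(2)]])
  show "G W (G W' (act_R \<mu> \<nu> \<xi> \<Phi>)) = act_R \<mu> \<nu> (G W (G W' \<xi>)) \<Phi>" if "\<xi> \<in> Xi" "\<Phi> \<in> D_alg c \<nu>" for \<xi> \<Phi>
    unfolding potential_D_linear[OF that] by (rule potential_D_linear[OF potential_Xi[OF that(1)] that(2)])
qed

end

text \<open>These commutation rules are what the curvature of \<open>\<nabla>\<^sup>0\<close> is computed from: only the
  affine and quadratic multipliers contribute.\<close>

lemma nabla0_partial:
  assumes "\<mu> \<noteq> 0" "\<xi> \<in> Xi"
  shows "partial_x (nabla0 c \<mu> (a, b, d) \<xi>) z = nabla0 c \<mu> (a, b, d) (partial_x \<xi>) z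
      + of_real (a * pi * of_int c / \<mu> * fst z + d * pi / \<mu>) * \<i> * \<xi> z"
    and "partial_y (nabla0 c \<mu> (a, b, d) \<xi>) z = nabla0 c \<mu> (a, b, d) (partial_y \<xi>) z"
proof -
  let ?g = "\<lambda>z :: real \<times> real. of_real (quad_phase c \<mu> (a, b, d) (fst z)) * \<i> :: complex"
  note sm = Xi_smooth[OF assms(2)]
  have d: "\<xi> differentiable (at w)" "partial_x \<xi> differentiable (at w)" "partial_y \<xi> differentiable (at w)" for w
    by (intro smooth_differentiable smooth_partial_x smooth_partial_y sm)+
  have g: "(?g has_derivative (\<lambda>h. of_real ((a * pi * of_int c / \<mu> * fst z + d * pi / \<mu>) * fst h) * \<i>)) (at z)"
    unfolding quad_phase_def prod.case
    using assms(1)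
    by (auto intro!: derivative_eq_intros simp: power2_eq_square algebra_simps add_divide_distrib)
  have eq: "nabla0 c \<mu> (a, b, d) \<xi> = (\<lambda>z. - of_real a * partial_y \<xi> z + (- of_real b * partial_x \<xi> z + ?g z * \<xi> z))"
    by (rule ext) (simp add: nabla0_quad_phase)
  have *: "partial u (nabla0 c \<mu> (a, b, d) \<xi>) z = - of_real a * partial u (partial_y \<xi>) z +
      (- of_real b * partial u (partial_x \<xi>) z + (of_real ((a * pi * of_int c / \<mu> * fst z + d * pi / \<mu>) * fst u) * \<i> * \<xi> z + ?g z * partial u \<xi> z))"
    for u
  proof -
    have dg: "?g differentiable (at z)"
      by (rule differentiableI[OF g])
    have da: "(\<lambda>z. - of_real a * partial_y \<xi> z) differentiable (at z)"
      "(\<lambda>z. - of_real b * partial_x \<xi> z) differentiable (at z)" "(\<lambda>z. ?g z * \<xi> z) differentiable (at z)"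
      by (intro differentiable_mult differentiable_const d dg)+
    show ?thesis
      unfolding eq partial_add[OF da(1) differentiable_add[OF da(2,3)]] partial_add[OF da(2,3)]
        partial_cmult[OF d(2)] partial_cmult[OF d(3)] partial_mult[OF dg d(1)] partial_eqI[OF g]
      by (rule refl)
  qed
  show "partial_x (nabla0 c \<mu> (a, b, d) \<xi>) z = nabla0 c \<mu> (a, b, d) (partial_x \<xi>) z
      + of_real (a * pi * of_int c / \<mu> * fst z + d * pi / \<mu>) * \<i> * \<xi> z"
    unfolding * nabla0_quad_phase by (simp add: smooth_mixed_partials[OF sm])
  show "partial_y (nabla0 c \<mu> (a, b, d) \<xi>) z = nabla0 c \<mu> (a, b, d) (partial_y \<xi>) z"
    unfolding * nabla0_quad_phase by (simp add: smooth_mixed_partials[OF sm])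
qed

lemma curvature_op_nabla0:
  assumes \<mu>: "\<mu> \<noteq> 0" and "\<xi> \<in> Xi"
  shows "curvature_op c (nabla0 c \<mu>) (a, b, d) (a', b', d') \<xi> z =
    - (of_real ((b * d' - b' * d) * pi / \<mu>) * \<i>) * \<xi> z"
proof -
  have N: "nabla0 c \<mu> (a, b, d) (nabla0 c \<mu> W \<xi>) z = - of_real a * partial_y (nabla0 c \<mu> W \<xi>) z
      - of_real b * partial_x (nabla0 c \<mu> W \<xi>) z + of_real (quad_phase c \<mu> (a, b, d) (fst z)) * \<i> * nabla0 c \<mu> W \<xi> z"
    for a b d W
    by (rule nabla0_quad_phase)
  have m: "partial_x (partial_y \<xi>) z = partial_y (partial_x \<xi>) z"
    by (simp add: smooth_mixed_partials[OF Xi_smooth[OF assms(2)]])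
  show ?thesis
    unfolding curvature_op_def bracket_def prod.case N nabla0_partial[OF \<mu> assms(2)]
    unfolding nabla0_quad_phase m quad_phase_def prod.case
    using \<mu> by (simp add: field_simps power2_eq_square)
qed

context
  fixes c :: int and \<mu> \<nu> :: real and nab :: "heis \<Rightarrow> fnM \<Rightarrow> fnM"
  assumes \<mu>: "\<mu> \<noteq> 0" and nab: "compatible_connection c \<mu> \<nu> nab"
begin

text \<open>
  Writing \<open>\<nabla> = \<nabla>\<^sup>0 + G\<close>, the curvature is
  \<open>\<Theta>\<^sup>0 + [\<nabla>\<^sup>0\<^sub>W, G\<^bsub>W'\<^esub>] - [\<nabla>\<^sup>0\<^bsub>W'\<^esub>, G\<^sub>W] + [G\<^sub>W, G\<^bsub>W'\<^esub>] - G\<^bsub>[W,W']\<^esub>\<close>,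
  and each term is an element of \<open>E\<close>. All of them except \<open>\<Theta>\<^sup>0\<close> and \<open>G\<^bsub>[W,W']\<^esub>\<close> have trace zero.
\<close>

lemma curvature_element:
  fixes a b d a' b' d' :: real
  defines "W \<equiv> (a, b, d)" and "W' \<equiv> (a', b', d')"
  obtains \<Theta> \<Psi> where "\<Theta> \<in> E_alg c \<mu> \<nu>" "\<And>\<xi>. \<xi> \<in> Xi \<Longrightarrow> act_L \<Theta> \<xi> = curvature_op c nab W W' \<xi>"
    and "\<Psi> \<in> E_alg c \<mu> \<nu>" "\<And>\<xi>. \<xi> \<in> Xi \<Longrightarrow> act_L \<Psi> \<xi> = potential c \<mu> nab (bracket c W W') \<xi>"
    and "tr \<mu> (\<Theta> 0) = 2 * of_real \<bar>\<mu>\<bar> * (of_real ((b * d' - b' * d) * pi / \<mu>) * \<i>) - tr \<mu> (\<Psi> 0)"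
proof -
  let ?G = "potential c \<mu> nab"
  note ex = potential_in_E[OF \<mu> nab] and exc = potential_composite_in_E[OF \<mu> nab]
  obtain P where P: "P \<in> E_alg c \<mu> \<nu>" "\<forall>\<xi>\<in>Xi. act_L P \<xi> = ?G W \<xi>"
    using ex[of W] by (rule bexE)
  obtain P' where P': "P' \<in> E_alg c \<mu> \<nu>" "\<forall>\<xi>\<in>Xi. act_L P' \<xi> = ?G W' \<xi>"
    using ex[of W'] by (rule bexE)
  obtain B where B: "B \<in> E_alg c \<mu> \<nu>" "\<forall>\<xi>\<in>Xi. act_L B \<xi> = ?G (bracket c W W') \<xi>"
    using ex[of "bracket c W W'"] by (rule bexE)
  obtain Q where Q: "Q \<in> E_alg c \<mu> \<nu>" "\<forall>\<xi>\<in>Xi. act_L Q \<xi> = ?G W (?G W' \<xi>)"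
    using exc[of W W'] by (rule bexE)
  obtain Q' where Q': "Q' \<in> E_alg c \<mu> \<nu>" "\<forall>\<xi>\<in>Xi. act_L Q' \<xi> = ?G W' (?G W \<xi>)"
    using exc[of W' W] by (rule bexE)
  define \<theta> where "\<theta> = of_real ((b * d' - b' * d) * pi / \<mu>) * \<i>"
  note hP = hat_delta_in_E_alg[OF \<mu> P(1), of W'] and hP' = hat_delta_in_E_alg[OF \<mu> P'(1), of W]
  define T1 where "T1 = (\<lambda>p z. 1 * hat_delta c \<mu> W P' p z + (- 1) * hat_delta c \<mu> W' P p z)"
  define T2 where "T2 = (\<lambda>p z. 1 * Q p z + (- 1) * Q' p z)"
  define T3 where "T3 = (\<lambda>p z. \<theta> * Id_E p z + (- 1) * B p z)"
  define T12 where "T12 = (\<lambda>p z. 1 * T1 p z + 1 * T2 p z)"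
  define \<Theta> where "\<Theta> = (\<lambda>p z. 1 * T12 p z + 1 * T3 p z)"
  have lc: "(\<lambda>p z. r * F p z + s * H p z) \<in> E_alg c \<mu> \<nu>" if "F \<in> E_alg c \<mu> \<nu>" "H \<in> E_alg c \<mu> \<nu>" for r s F H
    by (intro E_alg_add E_alg_cmult that)
  have T1: "T1 \<in> E_alg c \<mu> \<nu>" and T2: "T2 \<in> E_alg c \<mu> \<nu>" and T3: "T3 \<in> E_alg c \<mu> \<nu>"
    unfolding T1_def T2_def T3_def
    by (rule lc[OF hP' hP], rule lc[OF Q(1) Q'(1)], rule lc[OF Id_E_in_E_alg B(1)])
  have T12: "T12 \<in> E_alg c \<mu> \<nu>"
    unfolding T12_def by (rule lc[OF T1 T2])
  have \<Theta>: "\<Theta> \<in> E_alg c \<mu> \<nu>"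
    unfolding \<Theta>_def by (rule lc[OF T12 T3])
  have act: "act_L \<Theta> \<xi> = curvature_op c nab W W' \<xi>" if \<xi>: "\<xi> \<in> Xi" for \<xi>
  proof
    fix z
    let ?N = "nabla0 c \<mu>"
    have GX: "?G V \<xi> \<in> Xi" and NX: "?N V \<xi> \<in> Xi" for V
      by (rule potential_Xi[OF \<mu> nab \<xi>], rule nabla0_Xi[OF \<xi>])
    have nab_eq: "nab V f = (\<lambda>z. ?N V f z + ?G V f z)" for V f
      by (simp add: potential_def)
    have two: "nab V (nab V' \<xi>) z = ?N V (?N V' \<xi>) z + ?N V (?G V' \<xi>) z + (?G V (?N V' \<xi>) z + ?G V (?G V' \<xi>) z)" for V V'
    proof -
      have "nab V (nab V' \<xi>) z = ?N V (\<lambda>z. ?N V' \<xi> z + ?G V' \<xi> z) z + ?G V (\<lambda>z. ?N V' \<xi> z + ?G V' \<xi> z) z"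
        by (simp add: nab_eq[of V "nab V' \<xi>"] nab_eq[of V' \<xi>, symmetric])
      moreover have "?N V (\<lambda>z. ?N V' \<xi> z + ?G V' \<xi> z) z = ?N V (?N V' \<xi>) z + ?N V (?G V' \<xi>) z"
        using nabla0_lincomb[OF Xi_differentiable[OF NX] Xi_differentiable[OF GX],
          where c = c and \<mu> = \<mu> and W = V and z = z and a = 1 and b = 1] by simp
      ultimately show ?thesis
        by (simp only: potential_add[OF \<mu> nab NX GX])
    qed
    have comm: "?N V (?G V' \<xi>) z - ?G V' (?N V \<xi>) z = act_L (hat_delta c \<mu> V R) \<xi> z"
      if "R \<in> E_alg c \<mu> \<nu>" "\<forall>\<xi>\<in>Xi. act_L R \<xi> = ?G V' \<xi>" for V V' R
      using nabla0_act_L[OF \<mu> that(1) \<xi>, of V z] that(2) \<xi> NX by simp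
    have "curvature_op c nab W W' \<xi> z = curvature_op c ?N W W' \<xi> z
        + (?N W (?G W' \<xi>) z - ?G W' (?N W \<xi>) z) - (?N W' (?G W \<xi>) z - ?G W (?N W' \<xi>) z)
        + (?G W (?G W' \<xi>) z - ?G W' (?G W \<xi>) z) - ?G (bracket c W W') \<xi> z"
      unfolding curvature_op_def two by (simp add: nab_eq[of "bracket c W W'"])
    also have "\<dots> = cnj \<theta> * \<xi> z + act_L (hat_delta c \<mu> W P') \<xi> z - act_L (hat_delta c \<mu> W' P) \<xi> z
        + (act_L Q \<xi> z - act_L Q' \<xi> z) - act_L B \<xi> z"
      using Q(2) Q'(2) B(2) \<xi>
      unfolding comm[OF P'] comm[OF P]
      unfolding W_def W'_def curvature_op_nabla0[OF \<mu> \<xi>] \<theta>_def by simp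
    also have "\<dots> = act_L \<Theta> \<xi> z"
    proof -
      have Id: "act_L Id_E \<xi> z = \<xi> z"
        using act_L_Id[of 1 \<xi> z] by simp
      show ?thesis
        unfolding \<Theta>_def act_L_lincomb[OF T12 T3 \<xi>]
        unfolding T12_def act_L_lincomb[OF T1 T2 \<xi>]
        unfolding T1_def T2_def T3_def act_L_lincomb[OF hP' hP \<xi>] act_L_lincomb[OF Q(1) Q'(1) \<xi>]
          act_L_lincomb[OF Id_E_in_E_alg B(1) \<xi>] Id
        by simp
    qed
    finally show "act_L \<Theta> \<xi> z = curvature_op c nab W W' \<xi> z" ..
  qed
  have trQ: "tr \<mu> (Q 0) = tr \<mu> (Q' 0)"
  proof (rule tr_composite_commute[OF \<mu> P(1) P'(1)])
    show "act_L Q \<xi> = act_L P (act_L P' \<xi>)" "act_L Q' \<xi> = act_L P' (act_L P \<xi>)" if \<xi>: "\<xi> \<in> Xi" for \<xi>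
      using P(2) P'(2) Q(2) Q'(2) \<xi> potential_Xi[OF \<mu> nab \<xi>] by simp_all
  qed
  have lt: "tr \<mu> (\<lambda>z. r * F 0 z + s * H 0 z) = r * tr \<mu> (F 0) + s * tr \<mu> (H 0)"
    if "F \<in> E_alg c \<mu> \<nu>" "H \<in> E_alg c \<mu> \<nu>" for r s F H
    by (intro tr_lincomb smooth_continuous E_alg_smooth[OF that(1)] E_alg_smooth[OF that(2)])
  have "tr \<mu> (Id_E 0) = 2 * of_real \<bar>\<mu>\<bar>"
    using tr_const[of \<mu> 1] by (simp add: Id_E_def[abs_def])
  then have "tr \<mu> (\<Theta> 0) = 2 * of_real \<bar>\<mu>\<bar> * \<theta> - tr \<mu> (B 0)"
    unfolding \<Theta>_def lt[OF T12 T3]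
    unfolding T12_def lt[OF T1 T2]
    unfolding T1_def T2_def T3_def lt[OF hP' hP] lt[OF Q(1) Q'(1)] lt[OF Id_E_in_E_alg B(1)]
      tr_hat_delta[OF P(1)] tr_hat_delta[OF P'(1)] trQ
    by simp
  then show ?thesis
    using that[OF \<Theta> act B(1)] B(2) unfolding \<theta>_def by blast
qed

lemma curvature_eqI:
  assumes "\<Theta> \<in> E_alg c \<mu> \<nu>" "\<And>\<xi>. \<xi> \<in> Xi \<Longrightarrow> act_L \<Theta> \<xi> = curvature_op c nab W W' \<xi>"
  shows "curvature c \<mu> \<nu> nab W W' = \<Theta>"
  unfolding curvature_def
proof (rule the_equality)
  show "\<Theta> \<in> E_alg c \<mu> \<nu> \<and> (\<forall>\<xi>\<in>Xi. act_L \<Theta> \<xi> = curvature_op c nab W W' \<xi>)"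
    using assms by blast
  fix \<Psi> assume \<Psi>: "\<Psi> \<in> E_alg c \<mu> \<nu> \<and> (\<forall>\<xi>\<in>Xi. act_L \<Psi> \<xi> = curvature_op c nab W W' \<xi>)"
  show "\<Psi> = \<Theta>"
    by (rule act_L_inject) (use \<Psi> assms(2) in simp)
qed

lemma act_L_curvature:
  assumes "\<xi> \<in> Xi"
  shows "act_L (curvature c \<mu> \<nu> nab W W') \<xi> = curvature_op c nab W W' \<xi>"
proof -
  obtain a b d a' b' d' where W: "W = (a, b, d)" "W' = (a', b', d')"
    by (cases W, cases W')
  show ?thesis
  proof (rule curvature_element[of a b d a' b' d', folded W])
    fix \<Theta> assume \<Theta>: "\<Theta> \<in> E_alg c \<mu> \<nu>" "\<And>\<xi>. \<xi> \<in> Xi \<Longrightarrow> act_L \<Theta> \<xi> = curvature_op c nab W W' \<xi>"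
    have "curvature c \<mu> \<nu> nab W W' = \<Theta>"
      by (rule curvature_eqI[OF \<Theta>(1)]) (rule \<Theta>(2))
    then show ?thesis
      by (simp only: \<Theta>(2)[OF assms])
  qed
qed

text \<open>
  Compatibility makes \<open>\<nabla>\<^sub>Z - \<nabla>\<^sup>0\<^sub>Z\<close> skew: testing it in degree zero on a bump, where \<open>\<delta>\<^sub>Z\<close> vanishes,
  shows that the degree-zero coefficient is imaginary.
\<close>

lemma central_potential_imaginary:
  assumes "\<And>\<xi>. \<xi> \<in> Xi \<Longrightarrow> act_L \<Psi> \<xi> = potential c \<mu> nab (0, 0, t) \<xi>"
  shows "cnj (\<Psi> 0 z) = - \<Psi> 0 z"
proof -
  obtain x y where z: "z = (x, y)" by (cases z)
  let ?b = "bump x" and ?W = "(0, 0, t) :: heis"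
  have b: "?b (z + (of_int k, 0)) = (if k = 0 then 1 else 0)" for k
    using bump_eq[of "z + (of_int k, 0)" x k] by (simp add: z)
  have b0: "?b z = 1"
    using b[of 0] by (simp add: zero_prod_def[symmetric])
  have R: "inner_R c \<mu> \<nu> f ?b 0 z = f z" "inner_R c \<mu> \<nu> ?b f 0 z = cnj (f z)" for f
  proof -
    have "term_R c \<mu> \<nu> f ?b (0, k) z = 0" "term_R c \<mu> \<nu> ?b f (0, k) z = 0" if "k \<noteq> 0" for k
      using that b[of k] by (simp_all add: term_R_def)
    then have "inner_R c \<mu> \<nu> f ?b 0 z = term_R c \<mu> \<nu> f ?b (0, 0) z"
      "inner_R c \<mu> \<nu> ?b f 0 z = term_R c \<mu> \<nu> ?b f (0, 0) z"
      unfolding inner_R_eq by (auto intro!: infsum_single)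
    then show "inner_R c \<mu> \<nu> f ?b 0 z = f z" "inner_R c \<mu> \<nu> ?b f 0 z = cnj (f z)"
      using b0 by (simp_all add: term_R_def e_def zero_prod_def[symmetric])
  qed
  have "delta c \<mu> ?W (inner_R c \<mu> \<nu> ?b ?b) 0 z = 0"
    by (simp add: delta_eq)
  then have 1: "nab ?W ?b z + cnj (nab ?W ?b z) = 0"
    using connection_metric[OF nab bump_Xi bump_Xi, of ?W x x, THEN fun_cong, of 0, THEN fun_cong, of z]
    by (simp add: R)
  have 2: "nabla0 c \<mu> ?W ?b z + cnj (nabla0 c \<mu> ?W ?b z) = 0"
    by (simp add: nabla0_eq b0)
  have "cnj (\<Psi> 0 z) = potential c \<mu> nab ?W ?b z"
    using act_L_bump[of \<Psi> x 0 y] assms[OF bump_Xi[of x]] by (simp add: z)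
  then have "cnj (\<Psi> 0 z) + \<Psi> 0 z = potential c \<mu> nab ?W ?b z + cnj (potential c \<mu> nab ?W ?b z)"
    by (metis complex_cnj_cnj)
  also have "\<dots> = (nab ?W ?b z + cnj (nab ?W ?b z)) - (nabla0 c \<mu> ?W ?b z + cnj (nabla0 c \<mu> ?W ?b z))"
    by (simp add: potential_def)
  also have "\<dots> = 0"
    unfolding 1 2 by simp
  finally show ?thesis
    by (simp add: eq_neg_iff_add_eq_0)
qed

text \<open>
  Comparing traces: the constant is the reference value corrected by the average of the
  degree-zero coefficient of \<open>G\<^bsub>[W,W']\<^esub>\<close>, which is imaginary, and is \<open>0\<close> when \<open>[W,W'] = 0\<close>.
\<close>

lemma constant_curvature_value:
  assumes const: "curvature c \<mu> \<nu> nab (a, b, d) (a', b', d') = (\<lambda>p z. k * Id_E p z)"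
  obtains s :: real where "k = of_real ((b * d' - b' * d) * pi / \<mu>) * \<i> + of_real s * \<i>"
    "a * b' - a' * b = 0 \<Longrightarrow> s = 0"
proof -
  let ?W = "(a, b, d)" and ?W' = "(a', b', d')"
  define t where "t = of_int c * (a * b' - a' * b)"
  have br: "bracket c ?W ?W' = (0, 0, t)"
    by (simp add: bracket_def t_def)
  obtain \<Theta> \<Psi> where \<Theta>: "\<Theta> \<in> E_alg c \<mu> \<nu>" "\<And>\<xi>. \<xi> \<in> Xi \<Longrightarrow> act_L \<Theta> \<xi> = curvature_op c nab ?W ?W' \<xi>"
    and \<Psi>: "\<Psi> \<in> E_alg c \<mu> \<nu>" "\<And>\<xi>. \<xi> \<in> Xi \<Longrightarrow> act_L \<Psi> \<xi> = potential c \<mu> nab (0, 0, t) \<xi>"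
    and trace: "tr \<mu> (\<Theta> 0) = 2 * of_real \<bar>\<mu>\<bar> * (of_real ((b * d' - b' * d) * pi / \<mu>) * \<i>) - tr \<mu> (\<Psi> 0)"
    by (rule curvature_element[of a b d a' b' d', unfolded br]) (rule that)
  have "\<Theta> 0 = (\<lambda>_. k)"
    using curvature_eqI[OF \<Theta>] const by (simp add: Id_E_def fun_eq_iff)
  then have 1: "2 * of_real \<bar>\<mu>\<bar> * k = 2 * of_real \<bar>\<mu>\<bar> * (of_real ((b * d' - b' * d) * pi / \<mu>) * \<i>) - tr \<mu> (\<Psi> 0)"
    using trace tr_const[of \<mu> k] by simp
  have "cnj (tr \<mu> (\<Psi> 0)) = tr \<mu> (\<lambda>z. - \<Psi> 0 z)"
    unfolding tr_cnj[symmetric]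
    by (rule arg_cong[of _ _ "tr \<mu>"], rule ext, rule central_potential_imaginary[OF \<Psi>(2)])
  also have "\<dots> = - tr \<mu> (\<Psi> 0)"
    by (simp add: tr_def)
  finally have "Re (tr \<mu> (\<Psi> 0)) = 0"
    by (simp add: complex_eq_iff)
  then have 2: "tr \<mu> (\<Psi> 0) = of_real (Im (tr \<mu> (\<Psi> 0))) * \<i>"
    by (simp add: complex_eq_iff)
  show ?thesis
  proof (rule that[of "- Im (tr \<mu> (\<Psi> 0)) / (2 * \<bar>\<mu>\<bar>)"])
    have "2 * of_real \<bar>\<mu>\<bar> * k = 2 * of_real \<bar>\<mu>\<bar> *
        (of_real ((b * d' - b' * d) * pi / \<mu>) * \<i> + of_real (- Im (tr \<mu> (\<Psi> 0)) / (2 * \<bar>\<mu>\<bar>)) * \<i>)"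
      unfolding 1 by (subst 2) (use \<mu> in \<open>simp add: field_simps\<close>)
    then show "k = of_real ((b * d' - b' * d) * pi / \<mu>) * \<i> + of_real (- Im (tr \<mu> (\<Psi> 0)) / (2 * \<bar>\<mu>\<bar>)) * \<i>"
      using \<mu> by simp
    assume "a * b' - a' * b = 0"
    then have t0: "t = 0" by (simp add: t_def)
    have "\<Psi> 0 z = 0" for z
    proof -
      have "nab (0, 0, 0) (bump (fst z)) z = 0" "nabla0 c \<mu> (0, 0, 0) (bump (fst z)) z = 0"
        using linear_0[OF connection_linear[OF nab bump_Xi, of "fst z" z]] linear_0[OF nabla0_linear]
        by (simp_all add: zero_prod_def)
      then have "potential c \<mu> nab (0, 0, t) (bump (fst z)) z = 0"
        by (simp add: potential_def t0)
      then show ?thesis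
        using act_L_bump[of \<Psi> "fst z" 0 "snd z"] \<Psi>(2)[OF bump_Xi[of "fst z"]] by simp
    qed
    then have "\<Psi> 0 = (\<lambda>_. 0)"
      by (rule ext)
    then show "- Im (tr \<mu> (\<Psi> 0)) / (2 * \<bar>\<mu>\<bar>) = 0"
      using tr_const[of \<mu> 0] by simp
  qed
qed

text \<open>
  The bracket enters linearly, so the three basis values determine the curvature.
\<close>

lemma curvature_op_bilinear:
  assumes "\<xi> \<in> Xi"
  shows "curvature_op c nab (a, b, d) (a', b', d') \<xi> z =
    of_real (a * b' - a' * b) * curvature_op c nab hX hY \<xi> z +
    of_real (a * d' - a' * d) * curvature_op c nab hX hZ \<xi> z +
    of_real (b * d' - b' * d) * curvature_op c nab hY hZ \<xi> z"
proof -
  have exp: "nab (a, b, d) f = (\<lambda>z. of_real a * nab hX f z + of_real b * nab hY f z + of_real d * nab hZ f z)"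
    if f: "f \<in> Xi" for a b d f
  proof
    fix z
    note lin = connection_linear[OF nab f, of z]
    have "(a, b, d) = a *\<^sub>R hX + b *\<^sub>R hY + d *\<^sub>R hZ"
      by (simp add: hX_def hY_def hZ_def)
    then have "nab (a, b, d) f z = nab (a *\<^sub>R hX + b *\<^sub>R hY + d *\<^sub>R hZ) f z"
      by (simp only:)
    also have "\<dots> = a *\<^sub>R nab hX f z + b *\<^sub>R nab hY f z + d *\<^sub>R nab hZ f z"
      by (simp only: linear_add[OF lin] linear_scale[OF lin])
    finally show "nab (a, b, d) f z = of_real a * nab hX f z + of_real b * nab hY f z + of_real d * nab hZ f z"
      by (simp only: scaleR_conv_of_real)
  qed
  note X = connection_Xi[OF nab assms]
  have lc: "nab V (nab (a, b, d) \<xi>) z = of_real a * nab V (nab hX \<xi>) z + of_real b * nab V (nab hY \<xi>) z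
      + of_real d * nab V (nab hZ \<xi>) z" for V a b d
  proof -
    have "nab V (\<lambda>z. 1 * (\<lambda>z. of_real a * nab hX \<xi> z + of_real b * nab hY \<xi> z) z + of_real d * nab hZ \<xi> z) =
      (\<lambda>z. 1 * nab V (\<lambda>z. of_real a * nab hX \<xi> z + of_real b * nab hY \<xi> z) z + of_real d * nab V (nab hZ \<xi>) z)"
      by (rule connection_lincomb[OF nab _ X]) (intro Xi_add Xi_cmult X)
    then show ?thesis
      unfolding exp[OF assms] connection_lincomb[OF nab X X] by (drule_tac fun_cong[of _ _ z]) simp
  qed
  have expand: "nab (a, b, d) (nab (a', b', d') \<xi>) z =
      of_real a * (of_real a' * nab hX (nab hX \<xi>) z + of_real b' * nab hX (nab hY \<xi>) z + of_real d' * nab hX (nab hZ \<xi>) z) +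
      of_real b * (of_real a' * nab hY (nab hX \<xi>) z + of_real b' * nab hY (nab hY \<xi>) z + of_real d' * nab hY (nab hZ \<xi>) z) +
      of_real d * (of_real a' * nab hZ (nab hX \<xi>) z + of_real b' * nab hZ (nab hY \<xi>) z + of_real d' * nab hZ (nab hZ \<xi>) z)"
    for a b d a' b' d'
    unfolding lc[symmetric] by (simp add: exp[OF X])
  have br: "bracket c hX hY = (0, 0, of_int c)" "bracket c hX hZ = (0, 0, 0)" "bracket c hY hZ = (0, 0, 0)"
    by (simp_all add: bracket_def hX_def hY_def hZ_def)
  have bra: "bracket c (a, b, d) (a', b', d') = (0, 0, of_int c * (a * b' - a' * b))"
    by (simp add: bracket_def)
  have nz: "nab (0, 0, t) \<xi> z = of_real t * nab hZ \<xi> z" for t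
    using exp[OF assms, of 0 0 t] by simp
  show ?thesis
    unfolding curvature_op_def bra br nz expand by (simp add: algebra_simps)
qed

lemma YM_scalar:
  assumes "curvature c \<mu> \<nu> nab hX hY = (\<lambda>p z. k1 * Id_E p z)"
    and "curvature c \<mu> \<nu> nab hX hZ = (\<lambda>p z. k2 * Id_E p z)"
    and "curvature c \<mu> \<nu> nab hY hZ = (\<lambda>p z. k3 * Id_E p z)"
  shows "YM c \<mu> \<nu> nab = - (2 * \<bar>\<mu>\<bar> * Re (k1\<^sup>2 + k2\<^sup>2 + k3\<^sup>2))"
proof -
  have sq: "mult_E (\<lambda>p z. k * Id_E p z) (\<lambda>p z. k * Id_E p z) = (\<lambda>p z. k\<^sup>2 * Id_E p z)" for k
  proof (intro ext)
    fix p and z :: "real \<times> real"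
    obtain x y where z: "z = (x, y)" by (cases z)
    have "mult_E (\<lambda>p z. k * Id_E p z) (\<lambda>p z. k * Id_E p z) p z =
        k * Id_E 0 (x, y) * (k * Id_E (p - 0) (x + of_int 0, y))"
      unfolding mult_E_def z prod.case by (rule infsum_single) (simp add: Id_E_def)
    then show "mult_E (\<lambda>p z. k * Id_E p z) (\<lambda>p z. k * Id_E p z) p z = k\<^sup>2 * Id_E p z"
      by (simp add: Id_E_def power2_eq_square)
  qed
  have "YM c \<mu> \<nu> nab = - Re (trace_E c \<mu> \<nu> (\<lambda>p z. (k1\<^sup>2 + k2\<^sup>2 + k3\<^sup>2) * Id_E p z))"
    unfolding YM_def Let_def assms sq by (simp add: distrib_right)
  also have "\<dots> = - (2 * \<bar>\<mu>\<bar> * Re (k1\<^sup>2 + k2\<^sup>2 + k3\<^sup>2))"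
    unfolding trace_E_scalar[OF \<mu>] by simp
  finally show ?thesis .
qed

lemma constant_curvature_data:
  assumes "constant_curvature c \<mu> \<nu> nab"
  obtains s :: real where "curvature c \<mu> \<nu> nab hX hY = (\<lambda>p z. of_real s * \<i> * Id_E p z)"
    "curvature c \<mu> \<nu> nab hX hZ = (\<lambda>p z. 0)"
    "curvature c \<mu> \<nu> nab hY hZ = (\<lambda>p z. of_real pi * \<i> / of_real \<mu> * Id_E p z)"
    "YM c \<mu> \<nu> nab = 2 * \<bar>\<mu>\<bar> * (s\<^sup>2 + (pi / \<mu>)\<^sup>2)"
proof -
  obtain k1 k2 k3 where k: "curvature c \<mu> \<nu> nab hX hY = (\<lambda>p z. k1 * Id_E p z)"
    "curvature c \<mu> \<nu> nab hX hZ = (\<lambda>p z. k2 * Id_E p z)" "curvature c \<mu> \<nu> nab hY hZ = (\<lambda>p z. k3 * Id_E p z)"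
    using assms unfolding constant_curvature_def by meson
  obtain s where s: "k1 = of_real s * \<i>"
    using constant_curvature_value[OF k(1)[unfolded hX_def hY_def]] by auto
  have k2: "k2 = 0"
    using constant_curvature_value[OF k(2)[unfolded hX_def hZ_def]] by auto
  have k3: "k3 = of_real (pi / \<mu>) * \<i>"
    using constant_curvature_value[OF k(3)[unfolded hY_def hZ_def]] by auto
  show ?thesis
  proof (rule that[of s])
    show "curvature c \<mu> \<nu> nab hX hY = (\<lambda>p z. of_real s * \<i> * Id_E p z)"
      unfolding k s by (rule refl)
    show "curvature c \<mu> \<nu> nab hX hZ = (\<lambda>p z. 0)"
      unfolding k k2 by simp
    show "curvature c \<mu> \<nu> nab hY hZ = (\<lambda>p z. of_real pi * \<i> / of_real \<mu> * Id_E p z)"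
      unfolding k k3 by simp
    show "YM c \<mu> \<nu> nab = 2 * \<bar>\<mu>\<bar> * (s\<^sup>2 + (pi / \<mu>)\<^sup>2)"
      unfolding YM_scalar[OF k] s k2 k3 by (simp add: power2_eq_square algebra_simps)
  qed
qed

end

lemma curvature_cong:
  assumes \<mu>: "\<mu> \<noteq> 0" and nab: "compatible_connection c \<mu> \<nu> nab" and nab': "compatible_connection c \<mu> \<nu> nab'"
    and eq: "curvature c \<mu> \<nu> nab hX hY = curvature c \<mu> \<nu> nab' hX hY"
      "curvature c \<mu> \<nu> nab hX hZ = curvature c \<mu> \<nu> nab' hX hZ"
      "curvature c \<mu> \<nu> nab hY hZ = curvature c \<mu> \<nu> nab' hY hZ"
  shows "curvature c \<mu> \<nu> nab W W' = curvature c \<mu> \<nu> nab' W W'"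
proof (rule act_L_inject)
  fix \<xi> assume \<xi>: "\<xi> \<in> Xi"
  obtain a b d a' b' d' where W: "W = (a, b, d)" "W' = (a', b', d')"
    by (cases W, cases W')
  show "act_L (curvature c \<mu> \<nu> nab W W') \<xi> = act_L (curvature c \<mu> \<nu> nab' W W') \<xi>"
  proof
    fix z
    show "act_L (curvature c \<mu> \<nu> nab W W') \<xi> z = act_L (curvature c \<mu> \<nu> nab' W W') \<xi> z"
      unfolding act_L_curvature[OF \<mu> nab \<xi>] act_L_curvature[OF \<mu> nab' \<xi>] W
        curvature_op_bilinear[OF \<mu> nab \<xi>] curvature_op_bilinear[OF \<mu> nab' \<xi>]
      unfolding act_L_curvature[OF \<mu> nab \<xi>, symmetric] act_L_curvature[OF \<mu> nab' \<xi>, symmetric] eq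
      by (rule refl)
  qed
qed

lemma curvature_nabla0:
  assumes \<mu>: "\<mu> \<noteq> 0"
  shows "curvature c \<mu> \<nu> (nabla0 c \<mu>) (a, b, d) (a', b', d') =
    (\<lambda>p z. of_real ((b * d' - b' * d) * pi / \<mu>) * \<i> * Id_E p z)"
proof (rule curvature_eqI[OF \<mu> nabla0_compatible[OF \<mu>]])
  show "(\<lambda>p z. of_real ((b * d' - b' * d) * pi / \<mu>) * \<i> * Id_E p z) \<in> E_alg c \<mu> \<nu>"
    by (rule E_alg_cmult[OF Id_E_in_E_alg])
  show "act_L (\<lambda>p z. of_real ((b * d' - b' * d) * pi / \<mu>) * \<i> * Id_E p z) \<xi> =
      curvature_op c (nabla0 c \<mu>) (a, b, d) (a', b', d') \<xi>" if "\<xi> \<in> Xi" for \<xi>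
    by (rule ext) (simp only: act_L_Id curvature_op_nabla0[OF \<mu> that], simp)
qed

lemma constant_curvature_nabla0:
  assumes "\<mu> \<noteq> 0"
  shows "constant_curvature c \<mu> \<nu> (nabla0 c \<mu>)"
  unfolding constant_curvature_def
proof (intro allI)
  fix W W' :: heis
  show "\<exists>a. curvature c \<mu> \<nu> (nabla0 c \<mu>) W W' = (\<lambda>p z. a * Id_E p z)"
    by (cases W, cases W') (simp only: curvature_nabla0[OF assms], rule exI, rule refl)
qed

theorem theorem4p3:
  fixes c :: int and \<mu> \<nu> :: real and nab :: "heis \<Rightarrow> fnM \<Rightarrow> fnM"
  assumes "c \<ge> 1" and "\<mu> \<noteq> 0"
    and "compatible_connection c \<mu> \<nu> nab"
    and "constant_curvature c \<mu> \<nu> nab"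
  shows "compatible_connection c \<mu> \<nu> (nabla0 c \<mu>) \<and>
    ((\<forall>nab'. compatible_connection c \<mu> \<nu> nab' \<and> constant_curvature c \<mu> \<nu> nab' \<longrightarrow>
         YM c \<mu> \<nu> nab \<le> YM c \<mu> \<nu> nab')
      \<longleftrightarrow> (\<forall>W W'. curvature c \<mu> \<nu> nab W W' = curvature c \<mu> \<nu> (nabla0 c \<mu>) W W')) \<and>
    ((\<forall>W W'. curvature c \<mu> \<nu> nab W W' = curvature c \<mu> \<nu> (nabla0 c \<mu>) W W')
      \<longleftrightarrow> curvature c \<mu> \<nu> nab hX hY = (\<lambda>p z. 0) \<and>
          curvature c \<mu> \<nu> nab hX hZ = (\<lambda>p z. 0) \<and>
          curvature c \<mu> \<nu> nab hY hZ = (\<lambda>p z. of_real pi * \<i> / of_real \<mu> * Id_E p z))"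
proof -
  let ?C = "curvature c \<mu> \<nu>" and ?N = "nabla0 c \<mu>" and ?k = "of_real pi * \<i> / of_real \<mu> :: complex"
  note \<mu> = assms(2) and nab = assms(3)
  have N: "compatible_connection c \<mu> \<nu> ?N" "constant_curvature c \<mu> \<nu> ?N"
    by (rule nabla0_compatible[OF \<mu>], rule constant_curvature_nabla0[OF \<mu>])
  have N0: "?C ?N hX hY = (\<lambda>p z. 0)" "?C ?N hX hZ = (\<lambda>p z. 0)" "?C ?N hY hZ = (\<lambda>p z. ?k * Id_E p z)"
    unfolding hX_def hY_def hZ_def curvature_nabla0[OF \<mu>] by (simp_all add: mult.commute)
  have YM_N: "YM c \<mu> \<nu> ?N = 2 * \<bar>\<mu>\<bar> * (pi / \<mu>)\<^sup>2"
    using YM_scalar[OF \<mu> N(1), of 0 0 ?k] N0 by (simp add: power2_eq_square)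
  have lower: "YM c \<mu> \<nu> ?N \<le> YM c \<mu> \<nu> nab'"
    if nab': "compatible_connection c \<mu> \<nu> nab'" "constant_curvature c \<mu> \<nu> nab'" for nab'
  proof -
    obtain s where "YM c \<mu> \<nu> nab' = 2 * \<bar>\<mu>\<bar> * (s\<^sup>2 + (pi / \<mu>)\<^sup>2)"
      by (rule constant_curvature_data[OF \<mu> nab']) (rule that)
    then show ?thesis
      unfolding YM_N by (simp add: mult_left_mono)
  qed
  obtain s where s: "?C nab hX hY = (\<lambda>p z. of_real s * \<i> * Id_E p z)"
    "?C nab hX hZ = (\<lambda>p z. 0)" "?C nab hY hZ = (\<lambda>p z. ?k * Id_E p z)"
    and YM_nab: "YM c \<mu> \<nu> nab = 2 * \<bar>\<mu>\<bar> * (s\<^sup>2 + (pi / \<mu>)\<^sup>2)"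
    by (rule constant_curvature_data[OF \<mu> nab assms(4)]) (rule that)
  have all: "(\<forall>W W'. ?C nab W W' = ?C ?N W W') \<longleftrightarrow> ?C nab hX hY = (\<lambda>p z. 0) \<and> ?C nab hX hZ = (\<lambda>p z. 0) \<and>
      ?C nab hY hZ = (\<lambda>p z. ?k * Id_E p z)" (is "?A \<longleftrightarrow> ?B")
  proof
    assume ?A
    then show ?B
      by (simp only: N0)
  next
    assume ?B
    then have *: "?C nab hX hY = ?C ?N hX hY" "?C nab hX hZ = ?C ?N hX hZ" "?C nab hY hZ = ?C ?N hY hZ"
      by (simp_all only: N0)
    show ?A
      by (intro allI) (rule curvature_cong[OF \<mu> nab N(1) *])
  qed
  have min: "(\<forall>nab'. compatible_connection c \<mu> \<nu> nab' \<and> constant_curvature c \<mu> \<nu> nab' \<longrightarrow>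
         YM c \<mu> \<nu> nab \<le> YM c \<mu> \<nu> nab') \<longleftrightarrow> s = 0"
  proof
    assume "\<forall>nab'. compatible_connection c \<mu> \<nu> nab' \<and> constant_curvature c \<mu> \<nu> nab' \<longrightarrow>
         YM c \<mu> \<nu> nab \<le> YM c \<mu> \<nu> nab'"
    then have "YM c \<mu> \<nu> nab \<le> YM c \<mu> \<nu> ?N"
      using N by blast
    then have "2 * \<bar>\<mu>\<bar> * s\<^sup>2 \<le> 0"
      unfolding YM_nab YM_N by (simp add: distrib_left)
    then show "s = 0"
      using \<mu> by (simp add: mult_le_0_iff)
  next
    assume "s = 0"
    then have "YM c \<mu> \<nu> nab = YM c \<mu> \<nu> ?N"
      unfolding YM_nab YM_N by simp
    then show "\<forall>nab'. compatible_connection c \<mu> \<nu> nab' \<and> constant_curvature c \<mu> \<nu> nab' \<longrightarrow>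
         YM c \<mu> \<nu> nab \<le> YM c \<mu> \<nu> nab'"
      using lower by simp
  qed
  have "s = 0 \<longleftrightarrow> ?B"
  proof
    assume ?B
    then have "?C nab hX hY 0 (0, 0) = 0"
      by simp
    then show "s = 0"
      unfolding s(1) by (simp add: Id_E_def)
  qed (simp add: s)
  then have fin: "s = 0 \<longleftrightarrow> (\<forall>W W'. ?C nab W W' = ?C ?N W W')"
    unfolding all .
  show ?thesis
    by (rule conjI[OF N(1) conjI[OF trans[OF min fin] all]])
qed

end
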